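(* Let $A_0,A_1\in\mathbb{R}^{2\times2}$ be Hurwitz matrices and let $\lambda\in(0,1)$ be such that $A_\lambda=(1-\lambda)A_0+\lambda A_1$ has two real eigenvalues of opposite signs, $-\lambda_-<0<\lambda_+$. Set $\lambda_0=\lambda$, $\lambda_1=1-\lambda$, and let $\beta>0$. Let $(V_k)_{k\ge1}$ be a sequence of independent random matrices, each with distribution equal to the half sum (i.e. the mixture with weights $1/2$, $1/2$) of the image measures of the exponential law of parameter $1$ by the two mappings $$s\mapsto\exp\left(\frac{s}{\beta\lambda_0}A_0\right)\quad\text{and}\quad t\mapsto\exp\left(\frac{t}{\beta\lambda_1}A_1\right).$$ Then, almost surely, $$\lim_{k\to\infty}\frac1k\log\|V_kV_{k-1}\cdots V_1\|=\frac{\chi(\beta/2)}{2\lambda(1-\lambda)\beta},$$ where $\chi$ is the growth exponent defined in the context, and if $\beta$ is sufficiently large this limit is positive.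
   Context: A real $2\times2$ matrix is Hurwitz if both of its eigenvalues have negative real part. For $\gamma>0$, let $(I_t)_{t\ge0}$ be the continuous-time Markov process on $\{0,1\}$ that jumps from $i$ to $1-i$ at rate $\gamma\lambda_i$, and let $(X_t)_{t\ge0}$ solve $X_t=X_0+\int_0^tA_{I_s}X_s\,ds$. The number $\chi(\gamma)\in\mathbb{R}$ is the almost sure limit of $\frac1t\log\|X_t\|$ as $t\to\infty$; this limit exists, is deterministic, and is the same for every initial law $\nu$ of $(X_0,I_0)$ such that $\nu(\{0\}\times\{0,1\})=0$. *)

theory Defs
  imports "HOL-Probability.Probability"
begin

definition mat_exp :: "real^'n^'n \<Rightarrow> real^'n^'n" where
  "mat_exp M = (\<Sum>k. (1 / fact k) *\<^sub>R (((\<lambda>N. M ** N) ^^ k) (mat 1)))"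

definition eigenvalue :: "('a::field)^'n^'n \<Rightarrow> 'a \<Rightarrow> bool" where
  "eigenvalue M z \<longleftrightarrow> (\<exists>v. v \<noteq> 0 \<and> M *v v = z *s v)"

definition hurwitz :: "real^2^2 \<Rightarrow> bool" where
  "hurwitz M \<longleftrightarrow>
     (\<forall>z. eigenvalue (\<chi> i j. complex_of_real (M $ i $ j)) z \<longrightarrow> Re z < 0)"

abbreviation exp_law :: "real measure" where
  "exp_law \<equiv> density lborel (\<lambda>x. ennreal (exponential_density 1 x))"

text \<open>
  The state space {0, 1} is the type \<^typ>\<open>2\<close>, whose elements are 0 and 1 (there \<open>2 = 0\<close>).
  The state after \<open>n\<close> jumps is determined by the initial state.
\<close>

definition jump_chain :: "2 \<Rightarrow> nat \<Rightarrow> 2" where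
  "jump_chain i n = (if even n then i else 1 - i)"

text \<open>
  Continuous-time Markov process on {0, 1} leaving \<open>i\<close> at rate \<open>r i\<close>, in the jump chain and
  holding time form: \<open>T n\<close> is the time of the \<open>n\<close>-th jump and, given the initial data, the
  holding times \<open>T (n + 1) - T n\<close> are independent and exponential with parameter
  \<open>r (jump_chain (I 0) n)\<close>. Equivalently, after multiplication by these parameters they are
  independent, exponential with parameter 1, and independent of the initial data. The initial data
  are the pair of \<open>I 0\<close> and a further random variable \<open>x0\<close>, on which \<open>I\<close> may depend only
  through \<open>I 0\<close>; later \<open>x0\<close> is the initial value of the process driven by \<open>I\<close>.
\<close>

definition markov_jump_process ::
    "'w measure \<Rightarrow> (2 \<Rightarrow> real) \<Rightarrow> ('w \<Rightarrow> real^2) \<Rightarrow> (real \<Rightarrow> 'w \<Rightarrow> 2) \<Rightarrow> bool" where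
  "markov_jump_process M r x0 I \<longleftrightarrow>
     (\<forall>t\<ge>0. I t \<in> M \<rightarrow>\<^sub>M count_space UNIV) \<and>
     (\<exists>T :: nat \<Rightarrow> 'w \<Rightarrow> real.
        (AE \<omega> in M. T 0 \<omega> = 0 \<and>
           (\<forall>n t. T n \<omega> \<le> t \<and> t < T (Suc n) \<omega> \<longrightarrow> I t \<omega> = jump_chain (I 0 \<omega>) n)) \<and>
        (let S = (\<lambda>n \<omega>. r (jump_chain (I 0 \<omega>) n) * (T (Suc n) \<omega> - T n \<omega>)) in
           prob_space.indep_vars M (\<lambda>_. borel) S UNIV \<and>
           (\<forall>n. distr M borel (S n) = exp_law) \<and>
           prob_space.indep_set M
             (sets (vimage_algebra (space M) (\<lambda>\<omega>. (x0 \<omega>, I 0 \<omega>))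
                (borel \<Otimes>\<^sub>M count_space UNIV)))
             (sets (vimage_algebra (space M) (\<lambda>\<omega> n. S n \<omega>) (Pi\<^sub>M UNIV (\<lambda>_. borel))))))"

definition switched_system ::
    "'w measure \<Rightarrow> (2 \<Rightarrow> real^2^2) \<Rightarrow> (2 \<Rightarrow> real) \<Rightarrow> (real \<Rightarrow> 'w \<Rightarrow> 2) \<Rightarrow> (real \<Rightarrow> 'w \<Rightarrow> real^2) \<Rightarrow> bool"
  where
  "switched_system M A r I X \<longleftrightarrow>
     prob_space M \<and>
     markov_jump_process M r (X 0) I \<and>
     (AE \<omega> in M. \<forall>t\<ge>0.
        ((\<lambda>s. A (I s \<omega>) *v X s \<omega>) has_integral (X t \<omega> - X 0 \<omega>)) {0..t})"

text \<open>
  The definite description is over all realisations of the process, with all initial laws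
  giving no mass to the origin. A type must be chosen for the sample spaces;
  \<^typ>\<open>nat \<Rightarrow> real\<close> is large enough to carry any initial law on the product of the plane
  and {0, 1} together with the holding times.
\<close>

definition growth_exponent :: "(2 \<Rightarrow> real^2^2) \<Rightarrow> (2 \<Rightarrow> real) \<Rightarrow> real \<Rightarrow> real" where
  "growth_exponent A lam \<gamma> =
     (THE c. \<forall>(M :: (nat \<Rightarrow> real) measure) I X.
        switched_system M A (\<lambda>i. \<gamma> * lam i) I X \<and> (AE \<omega> in M. X 0 \<omega> \<noteq> 0) \<longrightarrow>
        (AE \<omega> in M. ((\<lambda>t. ln (norm (X t \<omega>)) / t) \<longlongrightarrow> c) at_top))"

primrec left_prod :: "(nat \<Rightarrow> real^'n^'n) \<Rightarrow> nat \<Rightarrow> real^'n^'n" where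
  "left_prod V 0 = mat 1"
| "left_prod V (Suc k) = V (Suc k) ** left_prod V k"

definition has_half_sum_law ::
    "'w measure \<Rightarrow> (2 \<Rightarrow> real^2^2) \<Rightarrow> (2 \<Rightarrow> real) \<Rightarrow> real \<Rightarrow> ('w \<Rightarrow> real^2^2) \<Rightarrow> bool" where
  "has_half_sum_law M A lam \<beta> W \<longleftrightarrow>
     (\<forall>B\<in>sets borel. measure (distr M borel W) B =
        (1/2) * measure (distr exp_law borel (\<lambda>s. mat_exp ((s / (\<beta> * lam 0)) *\<^sub>R A 0))) B +
        (1/2) * measure (distr exp_law borel (\<lambda>t. mat_exp ((t / (\<beta> * lam 1)) *\<^sub>R A 1))) B)"

end

theory Submission
  imports Defs
begin

text \<open>
  Both exponents are read off from one Poisson equation. Let \<open>R\<^sub>i\<close> average a function over the flow of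
  \<open>A i\<close> run for an exponential time with rate \<open>\<beta> lam i\<close>. The chain of directions driven by the mixture
  \<open>(R\<^sub>0 + R\<^sub>1) / 2\<close> satisfies Doeblin's condition on the projective line, because the set of directions from
  which a neighbourhood of the expanding eigendirection of the mean matrix cannot be reached is compact
  and invariant under both flows, hence empty. This gives a bounded \<open>f\<close> and a constant \<open>c\<close> with
  \<open>(R\<^sub>0 G + R\<^sub>1 G) / 2 = G + c\<close> for \<open>G = ln |x| + f x\<close>, so that \<open>G - k c\<close> is a martingale along the product and
  a law of large numbers for orthogonal increments yields the limit \<open>c\<close>.
  A geometric sum of exponential times being exponential, \<open>G\<^sub>i = R\<^sub>i G\<close> solves the corresponding equation for
  the alternating flow with rates \<open>\<beta> lam i / 2\<close>, where \<open>G\<close> grows by \<open>2 c\<close> per jump; dividing by the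
  mean holding time gives the continuous-time exponent.
  For positivity one compares \<open>G\<^sub>i\<close> with an explicit function of the same type which grows in mean for
  fast switching.
\<close>

section \<open>Linear flows\<close>

text \<open>The two flows may rotate, so no cone of directions need be invariant; irreducibility
  comes from the mean matrix alone. Its eigenvectors are not eigenvectors of \<open>A 0\<close> or
  \<open>A 1\<close>, since stability would make both eigenvalues negative while their weighted mean
  is positive. Hence the flow of \<open>A 0\<close> crosses the expanding direction transversally,
  and one orbit can serve as minorizing measure for all directions. The number of steps needed to
  reach it varies with the direction, which is why contraction is shown for averages of powers of
  the operator. Positivity resists plain averaging: at the contracting eigendirection of the mean
  matrix the logarithm of every fixed norm decreases in mean, and fast switching pushes away from it
  only on the scale \<gamma>^(-1/2). So the quadratic form in the test function degenerates with
  \<gamma>, and a corrector of order 1/\<gamma> removes the first order oscillation. The exponent is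
  a definite description over all realisations of the process; it has a value only if at least one
  realisation exists, so one is constructed.\<close>

primrec matpow :: "real^'n^'n \<Rightarrow> nat \<Rightarrow> real^'n^'n" where
  "matpow M 0 = mat 1"
| "matpow M (Suc k) = M ** matpow M k"

lemma funpow_matpow: "((\<lambda>N. M ** N) ^^ k) (mat 1) = matpow M k"
  by (induction k) auto

lemma matpow_scaleR: "matpow (t *\<^sub>R M) k = t ^ k *\<^sub>R matpow M k"
  by (induction k)
    (auto simp: vec_eq_iff matrix_matrix_mult_def sum_distrib_left algebra_simps)

text \<open>The sum of all absolute entries dominates every row sum, so it multiplies by at most
  itself per factor. This gives each entry of the exponential a power series with infinite radius of
  convergence, which may be differentiated termwise.\<close>

lemma matpow_entry_bound:
  fixes M :: "real^'n^'n"
  shows "\<exists>C\<ge>0. \<forall>k i j. \<bar>matpow M k $ i $ j\<bar> \<le> C ^ k"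
proof (intro exI[of _ "\<Sum>i\<in>UNIV. \<Sum>l\<in>UNIV. \<bar>M $ i $ l\<bar>"] conjI allI)
  let ?C = "\<Sum>i\<in>UNIV. \<Sum>l\<in>UNIV. \<bar>M $ i $ l\<bar>"
  show C: "0 \<le> ?C" by (intro sum_nonneg) auto
  fix k i j
  show "\<bar>matpow M k $ i $ j\<bar> \<le> ?C ^ k"
  proof (induction k arbitrary: i j)
    case 0
    then show ?case by (auto simp: mat_def)
  next
    case (Suc k)
    have "\<bar>matpow M (Suc k) $ i $ j\<bar> \<le> (\<Sum>l\<in>UNIV. \<bar>M $ i $ l * matpow M k $ l $ j\<bar>)"
      by (simp add: matrix_matrix_mult_def)
    also have "\<dots> \<le> (\<Sum>l\<in>UNIV. \<bar>M $ i $ l\<bar> * ?C ^ k)"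
      by (intro sum_mono) (auto simp: abs_mult intro!: mult_left_mono Suc)
    also have "\<dots> = (\<Sum>l\<in>UNIV. \<bar>M $ i $ l\<bar>) * ?C ^ k"
      by (simp add: sum_distrib_right)
    also have "\<dots> \<le> ?C * ?C ^ k"
      using C by (intro mult_right_mono member_le_sum[of i UNIV "\<lambda>i. \<Sum>l\<in>UNIV. \<bar>M $ i $ l\<bar>"])
        (auto intro: sum_nonneg)
    finally show ?case by simp
  qed
qed

lemma summable_matpow_entry:
  fixes M :: "real^'n^'n"
  shows "summable (\<lambda>k. matpow M k $ i $ j / fact k * t ^ k)"
proof -
  obtain C where C: "C \<ge> 0" "\<And>k i j. \<bar>matpow M k $ i $ j\<bar> \<le> C ^ k"
    using matpow_entry_bound[of M] by auto
  have "summable (\<lambda>k. (C * \<bar>t\<bar>) ^ k /\<^sub>R fact k)"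
    using sums_summable[OF exp_converges[of "C * \<bar>t\<bar>"]] .
  then show ?thesis
  proof (rule summable_comparison_test'[where N = 0])
    fix k :: nat
    have "\<bar>matpow M k $ i $ j\<bar> * \<bar>t\<bar> ^ k \<le> C ^ k * \<bar>t\<bar> ^ k"
      by (intro mult_right_mono C) auto
    then show "norm (matpow M k $ i $ j / fact k * t ^ k) \<le> (C * \<bar>t\<bar>) ^ k /\<^sub>R fact k"
      by (simp add: abs_mult power_abs power_mult_distrib field_simps)
  qed
qed

lemma mat_exp_entry:
  fixes M :: "real^'n^'n"
  shows "mat_exp (t *\<^sub>R M) $ i $ j = (\<Sum>k. matpow M k $ i $ j / fact k * t ^ k)"
proof -
  let ?L = "\<chi> i j. \<Sum>k. matpow M k $ i $ j / fact k * t ^ k"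
  have "(\<lambda>k. (1 / fact k) *\<^sub>R matpow (t *\<^sub>R M) k) sums ?L"
    unfolding sums_def
  proof (intro vec_tendstoI)
    fix i j
    have "(\<lambda>n. \<Sum>k<n. matpow M k $ i $ j / fact k * t ^ k) \<longlonglongrightarrow> ?L $ i $ j"
      using summable_sums[OF summable_matpow_entry[of M i j t]] by (simp add: sums_def)
    then show "(\<lambda>n. (\<Sum>k<n. (1 / fact k) *\<^sub>R matpow (t *\<^sub>R M) k) $ i $ j) \<longlonglongrightarrow> ?L $ i $ j"
      by (simp add: matpow_scaleR mult.commute)
  qed
  then show ?thesis
    by (simp add: mat_exp_def funpow_matpow sums_unique[symmetric])
qed

lemma mat_exp_0 [simp]: "mat_exp (0 :: real^'n^'n) = mat 1"
proof -
  have "mat_exp (0 *\<^sub>R (mat 1 :: real^'n^'n)) $ i $ j = mat 1 $ i $ j" for i j :: 'n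
  proof -
    have "(\<Sum>k. matpow (mat 1) k $ i $ j / fact k * 0 ^ k) = (\<Sum>k\<in>{0}. matpow (mat 1) k $ i $ j / fact k * (0::real) ^ k)"
      by (rule suminf_finite) auto
    then show ?thesis by (simp add: mat_exp_entry del: scaleR_zero_left)
  qed
  then show ?thesis by (simp add: vec_eq_iff)
qed

lemma DERIV_mat_exp_entry:
  fixes M :: "real^'n^'n"
  shows "((\<lambda>t. mat_exp (t *\<^sub>R M) $ i $ j) has_real_derivative
          (\<Sum>l\<in>UNIV. M $ i $ l * mat_exp (t *\<^sub>R M) $ l $ j)) (at t)"
proof -
  let ?c = "\<lambda>k. matpow M k $ i $ j / fact k"
  have "((\<lambda>t. \<Sum>k. ?c k * t ^ k) has_real_derivative (\<Sum>k. diffs ?c k * t ^ k)) (at t)"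
    by (rule termdiffs_strong_converges_everywhere) (rule summable_matpow_entry)
  moreover have "diffs ?c k * t ^ k = (\<Sum>l\<in>UNIV. M $ i $ l * (matpow M k $ l $ j / fact k * t ^ k))" for k
  proof -
    have "diffs ?c k = matpow M (Suc k) $ i $ j / fact k"
      by (simp add: diffs_def del: of_nat_Suc)
    then show ?thesis
      by (simp add: matrix_matrix_mult_def sum_divide_distrib sum_distrib_right mult.assoc)
  qed
  then have "(\<Sum>k. diffs ?c k * t ^ k) = (\<Sum>l\<in>UNIV. M $ i $ l * mat_exp (t *\<^sub>R M) $ l $ j)"
    by (simp only: mat_exp_entry suminf_sum summable_mult summable_matpow_entry suminf_mult)
  ultimately show ?thesis by (simp add: mat_exp_entry)
qed

lemma has_vector_derivative_mat_exp:
  fixes M :: "real^'n^'n"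
  shows "((\<lambda>t. mat_exp (t *\<^sub>R M) *v x) has_vector_derivative M *v (mat_exp (t *\<^sub>R M) *v x)) (at t within S)"
proof -
  have "((\<lambda>t. (mat_exp (t *\<^sub>R M) *v x) \<bullet> b) has_vector_derivative (M *v (mat_exp (t *\<^sub>R M) *v x)) \<bullet> b) (at t within S)"
    if b: "b \<in> Basis" for b
  proof -
    obtain i where i: "b = axis i 1" using b by (auto simp: Basis_vec_def)
    have "((\<lambda>t. \<Sum>j\<in>UNIV. mat_exp (t *\<^sub>R M) $ i $ j * x $ j) has_real_derivative
       (\<Sum>j\<in>UNIV. (\<Sum>l\<in>UNIV. M $ i $ l * mat_exp (t *\<^sub>R M) $ l $ j) * x $ j)) (at t within S)"
      by (intro derivative_eq_intros has_field_derivative_at_within[OF DERIV_mat_exp_entry] refl)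
        (auto intro!: derivative_eq_intros has_field_derivative_at_within[OF DERIV_mat_exp_entry])
    moreover have "(\<Sum>j\<in>UNIV. (\<Sum>l\<in>UNIV. M $ i $ l * mat_exp (t *\<^sub>R M) $ l $ j) * x $ j)
        = (M *v (mat_exp (t *\<^sub>R M) *v x)) $ i"
      unfolding matrix_vector_mult_def
      by (simp add: sum_distrib_right sum_distrib_left mult.assoc) (rule sum.swap)
    ultimately show ?thesis
      by (simp add: i inner_axis has_real_derivative_iff_has_vector_derivative matrix_vector_mult_def)
  qed
  then show ?thesis
    unfolding has_vector_derivative_def
    by (subst has_derivative_componentwise_within) simp
qed

lemma has_vector_derivative_mat_exp_shift:
  fixes M :: "real^'n^'n"
  shows "((\<lambda>t. mat_exp ((t + c) *\<^sub>R M) *v x) has_vector_derivative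
     M *v (mat_exp ((t + c) *\<^sub>R M) *v x)) (at t within S)"
proof (rule has_vector_derivative_at_within)
  have "((\<lambda>t. t + c) has_vector_derivative 1) (at t)"
    by (auto intro!: derivative_eq_intros)
  from vector_diff_chain_at[OF this has_vector_derivative_mat_exp[of M x]]
  show "((\<lambda>t. mat_exp ((t + c) *\<^sub>R M) *v x) has_vector_derivative
     M *v (mat_exp ((t + c) *\<^sub>R M) *v x)) (at t)" by (simp add: o_def)
qed

section \<open>Growth bounds, uniqueness and the group law of linear flows\<close>

definition mnorm :: "real^'n^'n \<Rightarrow> real" where
  "mnorm M = onorm (\<lambda>x. M *v x)"

lemma mnorm_bound: "norm (M *v x) \<le> mnorm M * norm (x::real^'n)"
  unfolding mnorm_def by (rule onorm) (simp add: linear_linear)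

lemma mnorm_nonneg: "0 \<le> mnorm M"
  unfolding mnorm_def by (rule onorm_pos_le) (simp add: linear_linear)

text \<open>Both bounds follow since \<open>(|Y|\<^sup>2)' = 2 Y \<bullet> M Y\<close> lies between \<open>\<plusminus> 2 |M| |Y|\<^sup>2\<close>.\<close>

lemma linear_ode_norm_bounds:
  fixes M :: "real^'n^'n"
  assumes ab: "a \<le> b" and cont: "continuous_on {a..b} Y"
    and der: "\<And>t. a < t \<Longrightarrow> t < b \<Longrightarrow> (Y has_vector_derivative M *v Y t) (at t)"
  shows "norm (Y b) \<le> exp (mnorm M * (b - a)) * norm (Y a)"
    and "exp (- mnorm M * (b - a)) * norm (Y a) \<le> norm (Y b)"
proof -
  let ?K = "mnorm M"
  have inner: "\<bar>y \<bullet> (M *v y)\<bar> \<le> ?K * (y \<bullet> y)" for y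
  proof -
    have "\<bar>y \<bullet> (M *v y)\<bar> \<le> norm y * norm (M *v y)" by (rule Cauchy_Schwarz_ineq2)
    also have "\<dots> \<le> norm y * (?K * norm y)" by (intro mult_left_mono mnorm_bound) auto
    finally show ?thesis by (simp add: dot_square_norm power2_eq_square algebra_simps)
  qed
  have D: "((\<lambda>t. exp (c * t) * (Y t \<bullet> Y t)) has_real_derivative
      exp (c * t) * (c * (Y t \<bullet> Y t) + 2 * (Y t \<bullet> (M *v Y t)))) (at t)" if "a < t" "t < b" for t c
  proof -
    have "((\<lambda>t. Y t \<bullet> Y t) has_real_derivative (Y t \<bullet> (M *v Y t) + (M *v Y t) \<bullet> Y t)) (at t)"
      using bounded_bilinear.has_vector_derivative[OF bounded_bilinear_inner der[OF that] der[OF that]]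
      by (simp add: has_real_derivative_iff_has_vector_derivative)
    then show ?thesis
      by (auto intro!: derivative_eq_intros simp: algebra_simps inner_commute)
  qed
  have C: "continuous_on {a..b} (\<lambda>t. exp (c * t) * (Y t \<bullet> Y t))" for c
    by (intro continuous_intros cont)
  have "exp (- 2 * ?K * b) * (Y b \<bullet> Y b) \<le> exp (- 2 * ?K * a) * (Y a \<bullet> Y a)"
  proof (rule DERIV_nonpos_imp_decreasing_open[OF ab _ C])
    fix t assume t: "a < t" "t < b"
    have "- 2 * ?K * (Y t \<bullet> Y t) + 2 * (Y t \<bullet> (M *v Y t)) \<le> 0"
      using inner[of "Y t"] by linarith
    then show "\<exists>y. ((\<lambda>t. exp (- 2 * ?K * t) * (Y t \<bullet> Y t)) has_real_derivative y) (at t) \<and> y \<le> 0"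
      using D[OF t, of "- 2 * ?K"] by (meson mult_nonneg_nonpos exp_ge_zero)
  qed
  then have "(norm (Y b))\<^sup>2 \<le> exp (2 * ?K * b) * (exp (- 2 * ?K * a) * (norm (Y a))\<^sup>2)"
    by (simp add: dot_square_norm exp_minus field_simps)
  also have "exp (2 * ?K * b) * (exp (- 2 * ?K * a) * (norm (Y a))\<^sup>2)
      = (exp (2 * ?K * b) * exp (- 2 * ?K * a)) * (norm (Y a))\<^sup>2" by simp
  also have "exp (2 * ?K * b) * exp (- 2 * ?K * a) = (exp (?K * (b - a)))\<^sup>2"
    unfolding exp_double[symmetric] exp_add[symmetric] by (simp add: algebra_simps)
  also have "\<dots> * (norm (Y a))\<^sup>2 = (exp (?K * (b - a)) * norm (Y a))\<^sup>2"
    by (simp add: power_mult_distrib)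
  finally show "norm (Y b) \<le> exp (mnorm M * (b - a)) * norm (Y a)"
    by (rule power2_le_imp_le) simp
  have "exp (2 * ?K * a) * (Y a \<bullet> Y a) \<le> exp (2 * ?K * b) * (Y b \<bullet> Y b)"
  proof (rule DERIV_nonneg_imp_increasing_open[OF ab _ C])
    fix t assume t: "a < t" "t < b"
    have "2 * ?K * (Y t \<bullet> Y t) + 2 * (Y t \<bullet> (M *v Y t)) \<ge> 0"
      using inner[of "Y t"] by linarith
    then show "\<exists>y. ((\<lambda>t. exp (2 * ?K * t) * (Y t \<bullet> Y t)) has_real_derivative y) (at t) \<and> y \<ge> 0"
      using D[OF t, of "2 * ?K"] by (meson mult_nonneg_nonneg exp_ge_zero)
  qed
  then have "exp (- (2 * ?K * b)) * (exp (2 * ?K * a) * (norm (Y a))\<^sup>2) \<le> (norm (Y b))\<^sup>2"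
    by (simp add: dot_square_norm exp_minus field_simps)
  moreover have "exp (- (2 * ?K * b)) * (exp (2 * ?K * a) * (norm (Y a))\<^sup>2)
      = (exp (- (2 * ?K * b)) * exp (2 * ?K * a)) * (norm (Y a))\<^sup>2" by simp
  moreover have "exp (- (2 * ?K * b)) * exp (2 * ?K * a) = (exp (- ?K * (b - a)))\<^sup>2"
    unfolding exp_double[symmetric] exp_add[symmetric] by (simp add: algebra_simps)
  ultimately have "(exp (- ?K * (b - a)) * norm (Y a))\<^sup>2 \<le> (norm (Y b))\<^sup>2"
    by (simp add: power_mult_distrib)
  then show "exp (- mnorm M * (b - a)) * norm (Y a) \<le> norm (Y b)"
    by (rule power2_le_imp_le) simp
qed

lemma continuous_on_mat_exp_vec [continuous_intros]:
  fixes M :: "real^'n^'n"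
  shows "continuous_on S (\<lambda>t. mat_exp (t *\<^sub>R M) *v x)"
  unfolding continuous_on_eq_continuous_within
  using has_vector_derivative_continuous[OF has_vector_derivative_mat_exp] by blast

text \<open>The difference from the exponential solution vanishes at \<open>a\<close>, and the
  growth bound keeps it zero. The derivative is asked only in the open interval because switched
  paths have corners at the jumps.\<close>

lemma linear_ode_unique:
  fixes M :: "real^'n^'n"
  assumes ab: "a \<le> b" and cont: "continuous_on {a..b} Y"
    and der: "\<And>t. a < t \<Longrightarrow> t < b \<Longrightarrow> (Y has_vector_derivative M *v Y t) (at t)"
  shows "Y b = mat_exp ((b - a) *\<^sub>R M) *v Y a"
proof -
  let ?E = "\<lambda>t. mat_exp ((t - a) *\<^sub>R M) *v Y a"
  have E: "(?E has_vector_derivative M *v ?E t) (at t)" for t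
    using has_vector_derivative_mat_exp_shift[of "- a" M "Y a" t UNIV] by simp
  have "norm (Y b - ?E b) \<le> exp (mnorm M * (b - a)) * norm (Y a - ?E a)"
  proof (rule linear_ode_norm_bounds(1)[OF ab])
    have "continuous_on {a..b} ?E"
      using has_vector_derivative_continuous[OF E] by (intro continuous_at_imp_continuous_on) auto
    then show "continuous_on {a..b} (\<lambda>t. Y t - ?E t)" by (intro continuous_on_diff cont)
    show "((\<lambda>t. Y t - ?E t) has_vector_derivative M *v (Y t - ?E t)) (at t)" if "a < t" "t < b" for t
      using has_vector_derivative_diff[OF der[OF that] E] by (simp add: matrix_vector_mult_diff_distrib)
  qed
  then show ?thesis by simp
qed

lemma mat_exp_add:
  fixes M :: "real^'n^'n"
  shows "mat_exp ((s + t) *\<^sub>R M) *v x = mat_exp (s *\<^sub>R M) *v (mat_exp (t *\<^sub>R M) *v x)"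
proof -
  have pos: "mat_exp ((s + t) *\<^sub>R M) *v x = mat_exp (s *\<^sub>R M) *v (mat_exp (t *\<^sub>R M) *v x)"
    if "0 \<le> s" for s t and x :: "real^'n"
  proof -
    let ?Y = "\<lambda>r. mat_exp ((r + t) *\<^sub>R M) *v x"
    have D: "(?Y has_vector_derivative M *v ?Y r) (at r)" for r
      by (rule has_vector_derivative_mat_exp_shift)
    have "?Y s = mat_exp ((s - 0) *\<^sub>R M) *v ?Y 0"
      using that
      by (intro linear_ode_unique)
        (auto intro: D intro!: continuous_at_imp_continuous_on has_vector_derivative_continuous[OF D])
    then show ?thesis by simp
  qed
  show ?thesis
  proof (cases "0 \<le> s")
    case True
    then show ?thesis by (rule pos)
  next
    case False
    then have s: "0 \<le> - s" by simp
    let ?y = "mat_exp (s *\<^sub>R M) *v (mat_exp (t *\<^sub>R M) *v x)"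
    have "mat_exp ((- s) *\<^sub>R M) *v ?y = mat_exp (t *\<^sub>R M) *v x"
      using pos[OF s, of s "mat_exp (t *\<^sub>R M) *v x"] by simp
    moreover have "mat_exp ((- s) *\<^sub>R M) *v (mat_exp ((s + t) *\<^sub>R M) *v x) = mat_exp (t *\<^sub>R M) *v x"
      using pos[OF s, of "s + t" x] by simp
    \<comment> \<open>For negative \<open>s\<close> both sides have the same image under the
      exponential at time \<open>- s\<close>; the lower norm bound makes that map injective.\<close>
    moreover have "inj (\<lambda>x. mat_exp ((- s) *\<^sub>R M) *v x)"
    proof (rule injI)
      fix x y assume e: "mat_exp ((- s) *\<^sub>R M) *v x = mat_exp ((- s) *\<^sub>R M) *v y"
      have n: "exp (- mnorm M * (- s - 0)) * norm (mat_exp (0 *\<^sub>R M) *v (x - y)) \<le> norm (mat_exp ((- s) *\<^sub>R M) *v (x - y))"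
        using s by (intro linear_ode_norm_bounds(2)) (auto intro: has_vector_derivative_mat_exp continuous_intros)
      have "norm (mat_exp ((- s) *\<^sub>R M) *v (x - y)) = 0"
        using e by (simp add: matrix_vector_mult_diff_distrib)
      with n have "exp (- mnorm M * (- s - 0)) * norm (x - y) \<le> 0" by simp
      then show "x = y" by (simp add: mult_le_0_iff)
    qed
    ultimately show ?thesis by (metis injD)
  qed
qed

lemma mat_exp_norm_bounds:
  fixes M :: "real^'n^'n"
  assumes "0 \<le> t"
  shows "norm (mat_exp (t *\<^sub>R M) *v x) \<le> exp (mnorm M * t) * norm x"
    and "exp (- mnorm M * t) * norm x \<le> norm (mat_exp (t *\<^sub>R M) *v x)"
proof -
  let ?Y = "\<lambda>t. mat_exp (t *\<^sub>R M) *v x"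
  show "norm (mat_exp (t *\<^sub>R M) *v x) \<le> exp (mnorm M * t) * norm x"
    using linear_ode_norm_bounds(1)[OF assms, of ?Y M] has_vector_derivative_mat_exp continuous_on_mat_exp_vec
    by force
  show "exp (- mnorm M * t) * norm x \<le> norm (mat_exp (t *\<^sub>R M) *v x)"
    using linear_ode_norm_bounds(2)[OF assms, of ?Y M] has_vector_derivative_mat_exp continuous_on_mat_exp_vec
    by force
qed

lemma mat_exp_minus_cancel:
  fixes M :: "real^'n^'n"
  shows "mat_exp ((- s) *\<^sub>R M) *v (mat_exp (s *\<^sub>R M) *v x) = x"
  using mat_exp_add[of "- s" s M x] by simp

lemma mat_exp_vec_eq_0 [simp]:
  fixes M :: "real^'n^'n"
  shows "mat_exp (s *\<^sub>R M) *v x = 0 \<longleftrightarrow> x = 0"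
  using mat_exp_minus_cancel[of s M x] by (metis matrix_vector_mult_0_right)

lemma continuous_mat_exp:
  fixes M :: "real^'n^'n"
  shows "continuous_on UNIV (\<lambda>t. mat_exp (t *\<^sub>R M))"
proof -
  have "continuous_on UNIV (\<lambda>t. mat_exp (t *\<^sub>R M) $ i $ j)" for i j
    by (rule DERIV_continuous_on, rule has_field_derivative_at_within, rule DERIV_mat_exp_entry)
  then have "continuous_on UNIV (\<lambda>t. \<chi> i j. mat_exp (t *\<^sub>R M) $ i $ j)"
    by (intro continuous_on_vec_lambda) 
  then show ?thesis by simp
qed

lemma continuous_on_mat_exp_joint [continuous_intros]:
  fixes M :: "real^'n^'n"
  assumes "continuous_on S f" "continuous_on S g"
  shows "continuous_on S (\<lambda>p. mat_exp (f p *\<^sub>R M) *v g p)"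
proof -
  have "continuous_on S (\<lambda>p. mat_exp (f p *\<^sub>R M))"
    using continuous_on_compose2[OF continuous_mat_exp assms(1)] by auto
  then have "continuous_on S (\<lambda>p. mat_exp (f p *\<^sub>R M) $ i $ j)" for i j
    by (intro continuous_intros)
  moreover have "continuous_on S (\<lambda>p. g p $ j)" for j
    by (intro continuous_intros assms(2))
  ultimately show ?thesis
    unfolding matrix_vector_mult_def by (intro continuous_on_vec_lambda continuous_on_sum continuous_on_mult) auto
qed

section \<open>A law of large numbers for orthogonal increments\<close>

lemma abs_mult_le_sum_squares: "\<bar>a * b\<bar> \<le> a\<^sup>2 + (b::real)\<^sup>2"
proof -
  have "0 \<le> (\<bar>a\<bar> - \<bar>b\<bar>)\<^sup>2" by simp
  then have "2 * \<bar>a * b\<bar> \<le> a\<^sup>2 + b\<^sup>2" by (simp add: power2_diff abs_mult)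
  then show ?thesis using abs_ge_zero[of "a * b"] by linarith
qed

lemma power2_sum_le: "(a + b)\<^sup>2 \<le> 2 * (a\<^sup>2 + (b::real)\<^sup>2)"
  using zero_le_power2[of "a - b"] by (simp add: power2_sum power2_diff)

lemma AE_summable_of_summable_expectation:
  fixes W :: "nat \<Rightarrow> 'a \<Rightarrow> real"
  assumes W: "\<And>n. integrable M (W n)" "\<And>n \<omega>. 0 \<le> W n \<omega>"
    and b: "\<And>n. (\<integral>\<omega>. W n \<omega> \<partial>M) \<le> b n" "summable b"
  shows "AE \<omega> in M. summable (\<lambda>n. W n \<omega>)"
proof -
  note [measurable] = borel_measurable_integrable[OF W(1)]
  have b0: "0 \<le> b n" for n
    using b(1)[of n] integral_nonneg_AE[of "W n" M] W(2) by (meson AE_I2 order_trans)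
  have "(\<integral>\<^sup>+\<omega>. (\<Sum>n. ennreal (W n \<omega>)) \<partial>M) = (\<Sum>n. \<integral>\<^sup>+\<omega>. ennreal (W n \<omega>) \<partial>M)"
    by (rule nn_integral_suminf) measurable
  also have "\<dots> = (\<Sum>n. ennreal (\<integral>\<omega>. W n \<omega> \<partial>M))"
    by (intro suminf_cong nn_integral_eq_integral W) (auto simp: W)
  also have "\<dots> \<le> (\<Sum>n. ennreal (b n))"
    by (intro suminf_le ennreal_leI b) auto
  also have "\<dots> = ennreal (\<Sum>n. b n)"
    by (rule suminf_ennreal2[OF b0 b(2)])
  finally have "(\<integral>\<^sup>+\<omega>. (\<Sum>n. ennreal (W n \<omega>)) \<partial>M) < \<infinity>"
    by (metis ennreal_less_top infinity_ennreal_def order_le_less_trans)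
  then have "AE \<omega> in M. (\<Sum>n. ennreal (W n \<omega>)) \<noteq> \<infinity>"
    by (intro nn_integral_noteq_infinite) auto
  then show ?thesis
    by eventually_elim (auto intro!: summable_suminf_not_top W)
qed

text \<open>Rajchman's argument: second moments give convergence along the squares, and a second moment
  bound for the sum of the absolute increments controls the gaps between consecutive squares.\<close>

lemma slln_orthogonal:
  fixes D :: "nat \<Rightarrow> 'a \<Rightarrow> real"
  assumes meas: "\<And>n. D n \<in> borel_measurable M"
    and sq: "\<And>n. integrable M (\<lambda>\<omega>. (D n \<omega>)\<^sup>2)"
    and bd: "\<And>n. (\<integral>\<omega>. (D n \<omega>)\<^sup>2 \<partial>M) \<le> C"
    and orth: "\<And>i j. i < j \<Longrightarrow> (\<integral>\<omega>. D i \<omega> * D j \<omega> \<partial>M) = 0"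
  shows "AE \<omega> in M. (\<lambda>n. (\<Sum>k<n. D k \<omega>) / real n) \<longlonglongrightarrow> 0"
proof -
  have C0: "0 \<le> C"
    using bd[of 0] integral_nonneg_AE[of "\<lambda>\<omega>. (D 0 \<omega>)\<^sup>2" M] by (meson AE_I2 order_trans zero_le_power2)
  have int: "integrable M (\<lambda>\<omega>. D i \<omega> * D j \<omega>)" for i j
  proof (rule Bochner_Integration.integrable_bound)
    show "integrable M (\<lambda>\<omega>. (D i \<omega>)\<^sup>2 + (D j \<omega>)\<^sup>2)" by (intro Bochner_Integration.integrable_add sq)
    show "(\<lambda>\<omega>. D i \<omega> * D j \<omega>) \<in> borel_measurable M" using meas by measurable
    show "AE x in M. norm (D i x * D j x) \<le> norm ((D i x)\<^sup>2 + (D j x)\<^sup>2)"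
      by (simp add: abs_mult_le_sum_squares)
  qed
  have sum_sq: "integrable M (\<lambda>\<omega>. (\<Sum>k<n. D k \<omega>)\<^sup>2) \<and> (\<integral>\<omega>. (\<Sum>k<n. D k \<omega>)\<^sup>2 \<partial>M) \<le> real n * C" for n
  proof (induction n)
    case (Suc n)
    have eq: "(\<Sum>k<Suc n. D k \<omega>)\<^sup>2 = (\<Sum>k<n. D k \<omega>)\<^sup>2 + (2 * (\<Sum>k<n. D k \<omega> * D n \<omega>) + (D n \<omega>)\<^sup>2)" for \<omega>
      by (simp add: power2_sum sum_distrib_right [symmetric])
    have i: "integrable M (\<lambda>\<omega>. \<Sum>k<n. D k \<omega> * D n \<omega>)" by (intro Bochner_Integration.integrable_sum int)
    have "(\<integral>\<omega>. (\<Sum>k<n. D k \<omega> * D n \<omega>) \<partial>M) = 0"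
      by (subst Bochner_Integration.integral_sum) (auto simp: int orth)
    then show ?case
      unfolding eq using Suc i sq[of n] bd[of n] by (simp add: algebra_simps)
  qed simp
  let ?U = "\<lambda>k \<omega>. \<Sum>j\<in>{k\<^sup>2..<(Suc k)\<^sup>2}. \<bar>D j \<omega>\<bar>"
  have card: "card {k\<^sup>2..<(Suc k)\<^sup>2} = 2 * k + 1" for k :: nat
    by (simp add: power2_eq_square)
  have U_le: "(?U k \<omega>)\<^sup>2 \<le> real (2 * k + 1) * (\<Sum>j\<in>{k\<^sup>2..<(Suc k)\<^sup>2}. (D j \<omega>)\<^sup>2)" for k \<omega>
    using sum_squared_le_sum_of_squares[of "\<lambda>j. \<bar>D j \<omega>\<bar>" "{k\<^sup>2..<(Suc k)\<^sup>2}"] unfolding card by (simp add: mult.commute)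
  have U_int: "integrable M (\<lambda>\<omega>. \<Sum>j\<in>{k\<^sup>2..<(Suc k)\<^sup>2}. (D j \<omega>)\<^sup>2)" for k
    by (intro Bochner_Integration.integrable_sum sq)
  \<comment> \<open>The first summand controls the sum at the square \<open>k^2\<close>, the second,
    by Cauchy-Schwarz, everything up to the next square. A convergent series forces
    \<open>?W k\<close> to 0, which handles both at once.\<close>
  let ?W = "\<lambda>k \<omega>. ((\<Sum>j<k\<^sup>2. D j \<omega>)\<^sup>2 + real (2 * k + 1) * (\<Sum>j\<in>{k\<^sup>2..<(Suc k)\<^sup>2}. (D j \<omega>)\<^sup>2)) / real k ^ 4"
  \<comment> \<open>Orthogonality contributes \<open>k^2 C\<close>, the gap
    \<open>(2 k + 1)^2 C \<le> 9 k^2 C\<close>; division by \<open>k^4\<close> leaves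
    \<open>10 C / k^2\<close>.\<close>
  let ?b = "\<lambda>k. 10 * C * (1 / real k ^ 2)"
  have "AE \<omega> in M. summable (\<lambda>k. ?W k \<omega>)"
  proof (rule AE_summable_of_summable_expectation)
    show "integrable M (?W k)" for k
      using sum_sq[of "k\<^sup>2"] U_int[of k] by (intro integrable_divide Bochner_Integration.integrable_add integrable_mult_right) auto
    show "0 \<le> ?W k \<omega>" for k \<omega> by (intro divide_nonneg_nonneg add_nonneg_nonneg mult_nonneg_nonneg sum_nonneg) auto
    show "summable ?b" by (intro summable_mult inverse_power_summable[where 'a = real, THEN summable_cong[THEN iffD1, rotated]])
      (auto simp: field_simps)
    show "(\<integral>\<omega>. ?W k \<omega> \<partial>M) \<le> ?b k" for k
    proof (cases "k = 0")
      case False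
      have "(\<integral>\<omega>. (\<Sum>j\<in>{k\<^sup>2..<(Suc k)\<^sup>2}. (D j \<omega>)\<^sup>2) \<partial>M) \<le> real (2 * k + 1) * C"
        using sum_bounded_above[of "{k\<^sup>2..<(Suc k)\<^sup>2}" "\<lambda>j. \<integral>\<omega>. (D j \<omega>)\<^sup>2 \<partial>M" C]
        unfolding card by (subst Bochner_Integration.integral_sum) (auto simp: sq bd)
      then have "real (2 * k + 1) * (\<integral>\<omega>. (\<Sum>j\<in>{k\<^sup>2..<(Suc k)\<^sup>2}. (D j \<omega>)\<^sup>2) \<partial>M) \<le> real (2 * k + 1) * (real (2 * k + 1) * C)"
        by (intro mult_left_mono) auto
      also have "\<dots> \<le> (3 * real k) * (3 * real k * C)"
        using False C0 by (intro mult_mono mult_right_mono) auto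
      finally have "(\<integral>\<omega>. (\<Sum>j<k\<^sup>2. D j \<omega>)\<^sup>2 \<partial>M) + real (2 * k + 1) * (\<integral>\<omega>. (\<Sum>j\<in>{k\<^sup>2..<(Suc k)\<^sup>2}. (D j \<omega>)\<^sup>2) \<partial>M)
          \<le> 10 * C * real k ^ 2"
        using sum_sq[of "k\<^sup>2"] by (simp add: power2_eq_square algebra_simps)
      moreover have "(\<integral>\<omega>. ?W k \<omega> \<partial>M) = ((\<integral>\<omega>. (\<Sum>j<k\<^sup>2. D j \<omega>)\<^sup>2 \<partial>M) + real (2 * k + 1) * (\<integral>\<omega>. (\<Sum>j\<in>{k\<^sup>2..<(Suc k)\<^sup>2}. (D j \<omega>)\<^sup>2) \<partial>M)) / real k ^ 4"
        using sum_sq[of "k\<^sup>2"] U_int[of k] by simp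
      ultimately have "(\<integral>\<omega>. ?W k \<omega> \<partial>M) \<le> 10 * C * real k ^ 2 / real k ^ 4"
        by (simp only: divide_right_mono zero_le_power of_nat_0_le_iff)
      also have "\<dots> = ?b k" using False by (simp add: field_simps power4_eq_xxxx power2_eq_square)
      finally show ?thesis .
    qed simp
  qed
  then show ?thesis
  proof eventually_elim
    case (elim \<omega>)
    define R where "R k = (\<bar>\<Sum>j<k\<^sup>2. D j \<omega>\<bar> + ?U k \<omega>) / (real k)\<^sup>2" for k
    have R0: "0 \<le> R k" for k unfolding R_def by (intro divide_nonneg_nonneg add_nonneg_nonneg sum_nonneg) auto
    have "(\<lambda>k. ?W k \<omega>) \<longlonglongrightarrow> 0" by (rule summable_LIMSEQ_zero[OF elim])
    then have "(\<lambda>k. sqrt (2 * ?W k \<omega>)) \<longlonglongrightarrow> sqrt (2 * 0)" by (intro tendsto_intros)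
    then have W0: "(\<lambda>k. sqrt (2 * ?W k \<omega>)) \<longlonglongrightarrow> 0" by simp
    have "R k \<le> sqrt (2 * ?W k \<omega>)" for k
    proof (rule real_le_rsqrt)
      have "(\<bar>\<Sum>j<k\<^sup>2. D j \<omega>\<bar> + ?U k \<omega>)\<^sup>2 \<le> 2 * (\<bar>\<Sum>j<k\<^sup>2. D j \<omega>\<bar>\<^sup>2 + (?U k \<omega>)\<^sup>2)"
        by (rule power2_sum_le)
      also have "\<dots> \<le> 2 * ((\<Sum>j<k\<^sup>2. D j \<omega>)\<^sup>2 + real (2 * k + 1) * (\<Sum>j\<in>{k\<^sup>2..<(Suc k)\<^sup>2}. (D j \<omega>)\<^sup>2))"
        using U_le[of \<omega> k] by simp
      finally have "(\<bar>\<Sum>j<k\<^sup>2. D j \<omega>\<bar> + ?U k \<omega>)\<^sup>2 / real k ^ 4 \<le> \<dots> / real k ^ 4"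
        by (rule divide_right_mono) simp
      then show "(R k)\<^sup>2 \<le> 2 * ?W k \<omega>" by (simp add: R_def power_divide)
    qed
    then have R_lim: "R \<longlonglongrightarrow> 0" by (intro tendsto_sandwich[OF _ _ tendsto_const W0]) (auto simp: R0)
    \<comment> \<open>The integer square root: \<open>n\<close> lies between the squares of
      \<open>s n\<close> and \<open>s n + 1\<close>.\<close>
    define s where "s n = nat \<lfloor>sqrt (real n)\<rfloor>" for n
    have s1: "(s n)\<^sup>2 \<le> n" for n
    proof -
      have "real (s n) \<le> sqrt (real n)" unfolding s_def by (simp add: of_nat_nat)
      then have "(real (s n))\<^sup>2 \<le> (sqrt (real n))\<^sup>2" by (intro power_mono) auto
      then have "real ((s n)\<^sup>2) \<le> real n" by simp
      then show ?thesis by (simp only: of_nat_le_iff)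
    qed
    have s2: "n < (Suc (s n))\<^sup>2" for n
    proof -
      have "sqrt (real n) < real (Suc (s n))" unfolding s_def by (simp add: of_nat_nat) linarith
      then have "(sqrt (real n))\<^sup>2 < (real (Suc (s n)))\<^sup>2" by (intro power_strict_mono) auto
      then have "real n < real ((Suc (s n))\<^sup>2)" by simp
      then show ?thesis by (simp only: of_nat_less_iff)
    qed
    have s_lim: "filterlim s at_top sequentially"
      unfolding filterlim_at_top
    proof
      fix Z show "\<forall>\<^sub>F n in sequentially. Z \<le> s n"
        using eventually_ge_at_top[of "Z\<^sup>2"]
      proof eventually_elim
        case (elim n)
        then have "Z\<^sup>2 < (Suc (s n))\<^sup>2" using s2[of n] by linarith
        then have "Z < Suc (s n)" by (rule power_less_imp_less_base) simp
        then show ?case by simp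
      qed
    qed
    have "\<bar>(\<Sum>k<n. D k \<omega>) / real n\<bar> \<le> R (s n)" if n: "n \<ge> 1" for n
    proof -
      have "(\<Sum>k<n. D k \<omega>) = (\<Sum>k<(s n)\<^sup>2. D k \<omega>) + (\<Sum>k\<in>{(s n)\<^sup>2..<n}. D k \<omega>)"
        using s1[of n] by (metis sum.lessThan_Suc atLeast0LessThan sum.atLeastLessThan_concat zero_le)
      moreover have "\<bar>\<Sum>k\<in>{(s n)\<^sup>2..<n}. D k \<omega>\<bar> \<le> (\<Sum>k\<in>{(s n)\<^sup>2..<n}. \<bar>D k \<omega>\<bar>)" by (rule sum_abs)
      moreover have "\<dots> \<le> ?U (s n) \<omega>" using s2[of n] by (intro sum_mono2) auto
      ultimately have num: "\<bar>\<Sum>k<n. D k \<omega>\<bar> \<le> \<bar>\<Sum>j<(s n)\<^sup>2. D j \<omega>\<bar> + ?U (s n) \<omega>" by linarith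
      have "s n \<noteq> 0" using s2[of n] n by (intro notI) simp
      then have pos: "0 < (real (s n))\<^sup>2" by simp
      have "(real (s n))\<^sup>2 \<le> real n" using s1[of n] by (metis of_nat_le_iff of_nat_power)
      then have "\<bar>\<Sum>k<n. D k \<omega>\<bar> / real n \<le> R (s n)"
        unfolding R_def using num pos by (intro frac_le) auto
      then show ?thesis by simp
    qed
    then have "\<forall>\<^sub>F n in sequentially. norm ((\<Sum>k<n. D k \<omega>) / real n) \<le> R (s n)"
      by (intro eventually_sequentiallyI[of 1]) simp
    then show ?case
      by (rule Lim_null_comparison) (rule filterlim_compose[OF R_lim s_lim])
  qed
qed

section \<open>Random recursions driven by independent noise\<close>

primrec chain :: "(nat \<Rightarrow> 's \<Rightarrow> 'b \<Rightarrow> 's) \<Rightarrow> 's \<Rightarrow> (nat \<Rightarrow> 'b) \<Rightarrow> nat \<Rightarrow> 's" where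
  "chain \<Phi> y f 0 = y"
| "chain \<Phi> y f (Suc n) = \<Phi> n (chain \<Phi> y f n) (f n)"

lemma chain_cong: "(\<And>k. k < n \<Longrightarrow> f k = g k) \<Longrightarrow> chain \<Phi> y f n = chain \<Phi> y g n"
  by (induction n) auto

lemma measurable_chain:
  assumes \<Phi>: "\<And>n. (\<lambda>(y, v). \<Phi> n y v) \<in> S \<Otimes>\<^sub>M N \<rightarrow>\<^sub>M S" and y: "y \<in> space S" and n: "{..<n} \<subseteq> I"
  shows "(\<lambda>f. chain \<Phi> y f n) \<in> PiM I (\<lambda>_. N) \<rightarrow>\<^sub>M S"
  using n
proof (induction n)
  case (Suc n)
  note [measurable] = \<Phi>
  have [measurable]: "(\<lambda>f. chain \<Phi> y f n) \<in> PiM I (\<lambda>_. N) \<rightarrow>\<^sub>M S"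
    using Suc by (simp add: lessThan_Suc)
  have [measurable]: "(\<lambda>f. f n) \<in> PiM I (\<lambda>_. N) \<rightarrow>\<^sub>M N"
    using Suc.prems by (intro measurable_component_singleton) auto
  have "(\<lambda>f. (\<lambda>(y, v). \<Phi> n y v) (chain \<Phi> y f n, f n)) \<in> PiM I (\<lambda>_. N) \<rightarrow>\<^sub>M S" by measurable
  then show ?case by simp
qed (use y in auto)

text \<open>The state before step \<open>n\<close> is a function of the noise before
  \<open>n\<close>, hence independent of the noise of step \<open>n\<close>. Integrating the latter
  first with the state frozen makes centred increments orthogonal. The map may depend on
  \<open>n\<close> so that random products, alternating flows and holding times are all
  instances.\<close>

lemma (in prob_space) chain_slln:
  fixes d :: "nat \<Rightarrow> 's \<Rightarrow> 'b \<Rightarrow> real"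
  assumes indep: "indep_vars (\<lambda>_. N) \<xi> UNIV"
    and \<Phi>: "\<And>n. (\<lambda>(y, v). \<Phi> n y v) \<in> S \<Otimes>\<^sub>M N \<rightarrow>\<^sub>M S"
    and d: "\<And>n. (\<lambda>(y, v). d n y v) \<in> borel_measurable (S \<Otimes>\<^sub>M N)"
    and y0: "y0 \<in> space S"
    and mean: "\<And>n y. y \<in> space S \<Longrightarrow> (\<integral>\<omega>. d n y (\<xi> n \<omega>) \<partial>M) = 0"
    and sq: "\<And>n y. y \<in> space S \<Longrightarrow> integrable M (\<lambda>\<omega>. (d n y (\<xi> n \<omega>))\<^sup>2)"
    and bd: "\<And>n y. y \<in> space S \<Longrightarrow> (\<integral>\<omega>. (d n y (\<xi> n \<omega>))\<^sup>2 \<partial>M) \<le> C"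
  shows "AE \<omega> in M. (\<lambda>n. (\<Sum>k<n. d k (chain \<Phi> y0 (\<lambda>j. \<xi> j \<omega>) k) (\<xi> k \<omega>)) / real n) \<longlonglongrightarrow> 0"
proof (rule slln_orthogonal)
  let ?Y = "\<lambda>n \<omega>. chain \<Phi> y0 (\<lambda>j. \<xi> j \<omega>) n"
  let ?D = "\<lambda>k \<omega>. d k (?Y k \<omega>) (\<xi> k \<omega>)"
  have \<xi>[measurable]: "\<And>j. random_variable N (\<xi> j)" using indep by (auto simp: indep_vars_def)
  have [measurable]: "(\<lambda>\<omega> j. \<xi> j \<omega>) \<in> M \<rightarrow>\<^sub>M PiM UNIV (\<lambda>_. N)"
    by (intro measurable_PiM_single') (auto simp: measurable_space[OF \<xi>])
  have Y[measurable]: "?Y n \<in> M \<rightarrow>\<^sub>M S" for n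
    by (rule measurable_compose[OF _ measurable_chain[OF \<Phi> y0], of _ _ UNIV]) auto
  have dcomp[measurable (raw)]: "\<And>n f g K. f \<in> K \<rightarrow>\<^sub>M S \<Longrightarrow> g \<in> K \<rightarrow>\<^sub>M N \<Longrightarrow> (\<lambda>x. d n (f x) (g x)) \<in> borel_measurable K"
    using measurable_compose[OF measurable_Pair d] by simp
  show "?D n \<in> borel_measurable M" for n by measurable
  let ?R = "\<lambda>I \<omega>. restrict (\<lambda>i. \<xi> i \<omega>) I"
  let ?P = "\<lambda>I. PiM I (\<lambda>_::nat. N)"
  have R[measurable]: "?R I \<in> M \<rightarrow>\<^sub>M ?P I" for I by (intro measurable_restrict \<xi>)
  let ?L = "\<lambda>I. distr M (?P I) (?R I)"
  have prob_L: "prob_space (?L I)" for I by (rule prob_space_distr[OF R])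
  have joint: "?L {..<n} \<Otimes>\<^sub>M ?L {n} = distr M (?P {..<n} \<Otimes>\<^sub>M ?P {n}) (\<lambda>\<omega>. (?R {..<n} \<omega>, ?R {n} \<omega>))" for n
    using indep_var_restrict[OF indep, of "{..<n}" "{n}"] by (simp add: indep_var_distribution_eq)
  have YR: "?Y k \<omega> = chain \<Phi> y0 (?R {..<n} \<omega>) k" if "k \<le> n" for k n \<omega>
    using that by (intro chain_cong) auto
  have c[measurable]: "(\<lambda>f. chain \<Phi> y0 f k) \<in> ?P {..<n} \<rightarrow>\<^sub>M S" if "k \<le> n" for k n
    using that by (intro measurable_chain[OF \<Phi> y0]) auto
  have comp[measurable]: "(\<lambda>f. f k) \<in> ?P I \<rightarrow>\<^sub>M N" if "k \<in> I" for k I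
    using that by (intro measurable_component_singleton)
  have sp: "chain \<Phi> y0 f n \<in> space S" if "f \<in> space (?P {..<n})" for f n
    using measurable_space[OF c that] by simp
  have nn: "(\<integral>\<^sup>+\<omega>. ennreal ((?D n \<omega>)\<^sup>2) \<partial>M) \<le> ennreal C" for n
  proof -
    interpret L: prob_space "?L {n}" by (rule prob_L)
    interpret L': prob_space "?L {..<n}" by (rule prob_L)
    have [measurable]: "(\<lambda>f. chain \<Phi> y0 f n) \<in> ?P {..<n} \<rightarrow>\<^sub>M S" by (rule c) simp
    have [measurable]: "(\<lambda>f. f n) \<in> ?P {n} \<rightarrow>\<^sub>M N" by (rule comp) simp
    have "(\<integral>\<^sup>+\<omega>. ennreal ((?D n \<omega>)\<^sup>2) \<partial>M)
        = (\<integral>\<^sup>+\<omega>. (\<lambda>p. ennreal ((d n (chain \<Phi> y0 (fst p) n) (snd p n))\<^sup>2)) (?R {..<n} \<omega>, ?R {n} \<omega>) \<partial>M)"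
      by (simp add: YR[of n n])
    also have "\<dots> = (\<integral>\<^sup>+p. ennreal ((d n (chain \<Phi> y0 (fst p) n) (snd p n))\<^sup>2) \<partial>(?L {..<n} \<Otimes>\<^sub>M ?L {n}))"
      unfolding joint by (subst nn_integral_distr) auto
    also have "\<dots> = (\<integral>\<^sup>+f. \<integral>\<^sup>+g. ennreal ((d n (chain \<Phi> y0 f n) (g n))\<^sup>2) \<partial>?L {n} \<partial>?L {..<n})"
      by (subst L.nn_integral_fst[symmetric]) auto
    also have "\<dots> \<le> (\<integral>\<^sup>+f. ennreal C \<partial>?L {..<n})"
    proof (rule nn_integral_mono)
      fix f assume "f \<in> space (?L {..<n})"
      then have y: "chain \<Phi> y0 f n \<in> space S" using sp by simp
      then have [measurable]: "(\<lambda>v. d n (chain \<Phi> y0 f n) v) \<in> borel_measurable N" by measurable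
      have "(\<integral>\<^sup>+g. ennreal ((d n (chain \<Phi> y0 f n) (g n))\<^sup>2) \<partial>?L {n}) = (\<integral>\<^sup>+\<omega>. ennreal ((d n (chain \<Phi> y0 f n) (\<xi> n \<omega>))\<^sup>2) \<partial>M)"
        by (subst nn_integral_distr) auto
      also have "\<dots> = ennreal (\<integral>\<omega>. (d n (chain \<Phi> y0 f n) (\<xi> n \<omega>))\<^sup>2 \<partial>M)"
        by (rule nn_integral_eq_integral[OF sq[OF y]]) auto
      also have "\<dots> \<le> ennreal C" by (intro ennreal_leI bd y)
      finally show "(\<integral>\<^sup>+g. ennreal ((d n (chain \<Phi> y0 f n) (g n))\<^sup>2) \<partial>?L {n}) \<le> ennreal C" .
    qed
    also have "\<dots> = ennreal C" by (simp add: L'.emeasure_space_1 del: space_distr)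
    finally show ?thesis .
  qed
  have C0: "0 \<le> C"
    using bd[OF y0, of 0] integral_nonneg_AE[of "\<lambda>\<omega>. (d 0 y0 (\<xi> 0 \<omega>))\<^sup>2" M]
    by (meson AE_I2 order_trans zero_le_power2)
  show sqD: "integrable M (\<lambda>\<omega>. (?D n \<omega>)\<^sup>2)" for n
    using nn[of n] by (intro integrableI_bounded) (auto simp: order_le_less_trans)
  show "(\<integral>\<omega>. (?D n \<omega>)\<^sup>2 \<partial>M) \<le> C" for n
    using nn[of n] C0 nn_integral_eq_integral[OF sqD] by (simp add: ennreal_le_iff)
  show "(\<integral>\<omega>. ?D i \<omega> * ?D n \<omega> \<partial>M) = 0" if "i < n" for i n
  proof -
    interpret L: prob_space "?L {n}" by (rule prob_L)
    interpret L': prob_space "?L {..<n}" by (rule prob_L)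
    interpret P: pair_prob_space "?L {..<n}" "?L {n}" ..
    have [measurable]: "(\<lambda>f. chain \<Phi> y0 f n) \<in> ?P {..<n} \<rightarrow>\<^sub>M S" by (rule c) simp
    have [measurable]: "(\<lambda>f. chain \<Phi> y0 f i) \<in> ?P {..<n} \<rightarrow>\<^sub>M S" by (rule c) (use that in simp)
    have [measurable]: "(\<lambda>f. f n) \<in> ?P {n} \<rightarrow>\<^sub>M N" by (rule comp) simp
    have [measurable]: "(\<lambda>f. f i) \<in> ?P {..<n} \<rightarrow>\<^sub>M N" by (rule comp) (use that in simp)
    \<comment> \<open>As \<open>i < n\<close>, the earlier increment depends on the past coordinates
      alone and is a constant factor of the inner integral.\<close>
    let ?h = "\<lambda>f. d i (chain \<Phi> y0 f i) (f i)"
    let ?G = "\<lambda>p. ?h (fst p) * d n (chain \<Phi> y0 (fst p) n) (snd p n)"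
    have eq: "?D i \<omega> * ?D n \<omega> = ?G (?R {..<n} \<omega>, ?R {n} \<omega>)" for \<omega>
      using that YR[of i n \<omega>] YR[of n n \<omega>] by simp
    have [measurable]: "?G \<in> borel_measurable (?P {..<n} \<Otimes>\<^sub>M ?P {n})" by measurable
    have "integrable M (\<lambda>\<omega>. ?D i \<omega> * ?D n \<omega>)"
    proof (rule Bochner_Integration.integrable_bound)
      show "integrable M (\<lambda>\<omega>. (?D i \<omega>)\<^sup>2 + (?D n \<omega>)\<^sup>2)" by (intro Bochner_Integration.integrable_add sqD)
      show "AE \<omega> in M. norm (?D i \<omega> * ?D n \<omega>) \<le> norm ((?D i \<omega>)\<^sup>2 + (?D n \<omega>)\<^sup>2)"
        by (simp add: abs_mult_le_sum_squares)
    qed measurable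
    then have int: "integrable (?L {..<n} \<Otimes>\<^sub>M ?L {n}) ?G"
      unfolding joint eq by (subst integrable_distr_eq) auto
    have "(\<integral>\<omega>. ?D i \<omega> * ?D n \<omega> \<partial>M) = integral\<^sup>L (?L {..<n} \<Otimes>\<^sub>M ?L {n}) ?G"
      unfolding joint eq by (subst integral_distr) auto
    also have "\<dots> = (\<integral>f. \<integral>g. ?G (f, g) \<partial>?L {n} \<partial>?L {..<n})"
      by (rule P.integral_fst'[OF int, symmetric])
    also have "\<dots> = (\<integral>f. 0 \<partial>?L {..<n})"
    proof (rule Bochner_Integration.integral_cong[OF refl])
      fix f assume "f \<in> space (?L {..<n})"
      then have y: "chain \<Phi> y0 f n \<in> space S" using sp by simp
      then have [measurable]: "(\<lambda>v. d n (chain \<Phi> y0 f n) v) \<in> borel_measurable N" by measurable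
      have "(\<integral>g. d n (chain \<Phi> y0 f n) (g n) \<partial>?L {n}) = (\<integral>\<omega>. d n (chain \<Phi> y0 f n) (\<xi> n \<omega>) \<partial>M)"
        by (subst integral_distr) auto
      then show "(\<integral>g. ?G (f, g) \<partial>?L {n}) = 0" using mean[OF y] by simp
    qed
    finally show ?thesis by simp
  qed
qed

section \<open>Markov operators on functions of the direction\<close>

text \<open>Bounded Borel functions on the projective line, kept as functions on the plane that are
  constant on punctured lines. The origin is no direction and its value carries no information, so
  bounds and positivity are always asked off the origin.\<close>

definition proj_fun :: "(real^2 \<Rightarrow> real) \<Rightarrow> bool" where
  "proj_fun f \<longleftrightarrow> f \<in> borel_measurable borel \<and> (\<forall>c x. c \<noteq> 0 \<longrightarrow> f (c *\<^sub>R x) = f x) \<and> (\<exists>B. \<forall>x. \<bar>f x\<bar> \<le> B)"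

lemma proj_fun_measurable [measurable_dest]: "proj_fun f \<Longrightarrow> f \<in> borel_measurable borel"
  and proj_fun_scale: "proj_fun f \<Longrightarrow> c \<noteq> 0 \<Longrightarrow> f (c *\<^sub>R x) = f x"
  and proj_fun_bounded: "proj_fun f \<Longrightarrow> \<exists>B. \<forall>x. \<bar>f x\<bar> \<le> B"
  by (auto simp: proj_fun_def)

lemma proj_fun_const [simp]: "proj_fun (\<lambda>_. c)"
  by (auto simp: proj_fun_def)

lemma proj_fun_add: "proj_fun f \<Longrightarrow> proj_fun g \<Longrightarrow> proj_fun (\<lambda>x. f x + g x)"
  unfolding proj_fun_def by (auto, meson abs_triangle_ineq add_mono order_trans)

lemma proj_fun_cmult: "proj_fun f \<Longrightarrow> proj_fun (\<lambda>x. c * f x)"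
  unfolding proj_fun_def by (auto simp: abs_mult) (meson abs_ge_zero mult_left_mono)

lemma proj_fun_diff: "proj_fun f \<Longrightarrow> proj_fun g \<Longrightarrow> proj_fun (\<lambda>x. f x - g x)"
  using proj_fun_add[of f "\<lambda>x. -1 * g x"] proj_fun_cmult[of g "-1"] by simp

lemma proj_fun_sum: "(\<And>i. i \<in> I \<Longrightarrow> proj_fun (f i)) \<Longrightarrow> proj_fun (\<lambda>x. \<Sum>i\<in>I. f i x)"
  by (induction I rule: infinite_finite_induct) (auto intro: proj_fun_add)

text \<open>Algebraic form of a Markov kernel on the projective line. Every limit exchanged with
  \<open>K\<close> below is uniform in the direction, so linearity, positivity and constants suffice
  and no invariant law has to be constructed.\<close>

definition markov_op :: "((real^2 \<Rightarrow> real) \<Rightarrow> real^2 \<Rightarrow> real) \<Rightarrow> bool" where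
  "markov_op K \<longleftrightarrow> (\<forall>f. proj_fun f \<longrightarrow> proj_fun (K f)) \<and>
     (\<forall>f g. proj_fun f \<longrightarrow> proj_fun g \<longrightarrow> K (\<lambda>x. f x + g x) = (\<lambda>x. K f x + K g x)) \<and>
     (\<forall>f c. proj_fun f \<longrightarrow> K (\<lambda>x. c * f x) = (\<lambda>x. c * K f x)) \<and>
     (\<forall>c. K (\<lambda>_. c) = (\<lambda>_. c)) \<and>
     (\<forall>f. proj_fun f \<longrightarrow> (\<forall>x. x \<noteq> 0 \<longrightarrow> 0 \<le> f x) \<longrightarrow> (\<forall>x. x \<noteq> 0 \<longrightarrow> 0 \<le> K f x))"

lemma markov_opD:
  assumes "markov_op K"
  shows "proj_fun f \<Longrightarrow> proj_fun (K f)"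
    and "proj_fun f \<Longrightarrow> proj_fun g \<Longrightarrow> K (\<lambda>x. f x + g x) = (\<lambda>x. K f x + K g x)"
    and "proj_fun f \<Longrightarrow> K (\<lambda>x. c * f x) = (\<lambda>x. c * K f x)"
    and "K (\<lambda>_. c) = (\<lambda>_. c)"
    and "proj_fun f \<Longrightarrow> (\<And>x. x \<noteq> 0 \<Longrightarrow> 0 \<le> f x) \<Longrightarrow> x \<noteq> 0 \<Longrightarrow> 0 \<le> K f x"
  using assms unfolding markov_op_def by auto

lemma markov_op_diff:
  assumes "markov_op K" "proj_fun f" "proj_fun g"
  shows "K (\<lambda>x. f x - g x) = (\<lambda>x. K f x - K g x)"
  using markov_opD(2)[OF assms(1,2), of "\<lambda>x. -1 * g x"] markov_opD(3)[OF assms(1,3), of "-1"] proj_fun_cmult[OF assms(3), of "-1"]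
  by simp

lemma markov_op_sum:
  assumes "markov_op K" "\<And>i. i \<in> I \<Longrightarrow> proj_fun (f i)"
  shows "K (\<lambda>x. \<Sum>i\<in>I. f i x) = (\<lambda>x. \<Sum>i\<in>I. K (f i) x)"
  using assms(2)
  by (induction I rule: infinite_finite_induct)
    (simp_all add: markov_opD(4)[OF assms(1)] markov_opD(2)[OF assms(1)] proj_fun_sum)

lemma markov_op_mono:
  assumes K: "markov_op K" "proj_fun f" "proj_fun g" and le: "\<And>x. x \<noteq> 0 \<Longrightarrow> f x \<le> g x" and x: "x \<noteq> 0"
  shows "K f x \<le> K g x"
  using markov_opD(5)[OF K(1) proj_fun_diff[OF K(3,2)] _ x] le markov_op_diff[OF K(1,3,2)] by simp

lemma markov_op_bounds:
  assumes K: "markov_op K" "proj_fun f" and x: "x \<noteq> 0"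
  shows "(\<And>x. x \<noteq> 0 \<Longrightarrow> a \<le> f x) \<Longrightarrow> a \<le> K f x" "(\<And>x. x \<noteq> 0 \<Longrightarrow> f x \<le> b) \<Longrightarrow> K f x \<le> b"
  using markov_op_mono[OF K(1) proj_fun_const K(2) _ x, of a]
    markov_op_mono[OF K proj_fun_const _ x, of b] markov_opD(4)[OF K(1)]
  by auto

lemma markov_op_funpow:
  assumes K: "markov_op K"
  shows "markov_op (K ^^ m)"
proof (induction m)
  case 0
  then show ?case by (auto simp: markov_op_def)
next
  case (Suc m)
  note S = markov_opD[OF Suc] and K' = markov_opD[OF K]
  show ?case
    unfolding markov_op_def
  proof (intro conjI allI impI)
    fix f x assume "proj_fun f" "\<forall>x. x \<noteq> 0 \<longrightarrow> 0 \<le> f x" "(x::real^2) \<noteq> 0"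
    then show "0 \<le> (K ^^ Suc m) f x" using S(1,5) K'(5) by simp
  qed (simp_all add: S(1-4) K'(1-4))
qed

section \<open>Averages of powers and the Poisson equation\<close>

lemma markov_op_average:
  assumes K: "markov_op K"
  shows "markov_op (\<lambda>f x. (\<Sum>m\<le>M. (K ^^ m) f x) / real (Suc M))"
proof -
  have S: "markov_op (K ^^ m)" for m by (rule markov_op_funpow[OF K])
  show ?thesis
    unfolding markov_op_def
  proof (intro conjI allI impI)
    fix f :: "real^2 \<Rightarrow> real" assume f: "proj_fun f"
    show "proj_fun (\<lambda>x. (\<Sum>m\<le>M. (K ^^ m) f x) / real (Suc M))"
      using proj_fun_cmult[OF proj_fun_sum, of "{..M}" "\<lambda>m. (K ^^ m) f" "1 / real (Suc M)"] markov_opD(1)[OF S f]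
      by (simp add: divide_inverse mult.commute)
    fix g assume g: "proj_fun g"
    show "(\<lambda>x. (\<Sum>m\<le>M. (K ^^ m) (\<lambda>x. f x + g x) x) / real (Suc M)) =
         (\<lambda>x. (\<Sum>m\<le>M. (K ^^ m) f x) / real (Suc M) + (\<Sum>m\<le>M. (K ^^ m) g x) / real (Suc M))"
      by (simp add: markov_opD(2)[OF S f g] sum.distrib add_divide_distrib)
  next
    fix f :: "real^2 \<Rightarrow> real" and c assume f: "proj_fun f"
    show "(\<lambda>x. (\<Sum>m\<le>M. (K ^^ m) (\<lambda>x. c * f x) x) / real (Suc M)) = (\<lambda>x. c * ((\<Sum>m\<le>M. (K ^^ m) f x) / real (Suc M)))"
      by (simp add: markov_opD(3)[OF S f] sum_distrib_left)
  next
    fix c :: real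
    show "(\<lambda>x. (\<Sum>m\<le>M. (K ^^ m) (\<lambda>_. c) x) / real (Suc M)) = (\<lambda>_. c)"
      by (simp add: markov_opD(4)[OF S])
  next
    fix f and x :: "real^2" assume "proj_fun f" "\<forall>x. x \<noteq> 0 \<longrightarrow> 0 \<le> f x" "x \<noteq> 0"
    then show "0 \<le> (\<Sum>m\<le>M. (K ^^ m) f x) / real (Suc M)"
      by (intro divide_nonneg_nonneg sum_nonneg markov_opD(5)[OF S]) auto
  qed
qed

text \<open>The infima of \<open>K^n q\<close> increase, the suprema decrease, and the contraction
  squeezes them geometrically onto one number \<open>c\<close>, the stationary mean of
  \<open>q\<close>. The solution is the Neumann series of \<open>K^n q - c\<close>; it converges
  uniformly, so \<open>K\<close> may be applied term by term and the sum telescopes.\<close>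

lemma poisson_of_contraction:
  assumes K: "markov_op K" and q: "proj_fun q" and \<theta>: "0 \<le> \<theta>" "\<theta> < 1"
    and contr: "\<And>f a b. proj_fun f \<Longrightarrow> (\<And>x. x \<noteq> 0 \<Longrightarrow> a \<le> f x \<and> f x \<le> b) \<Longrightarrow>
       \<exists>a' b'. (\<forall>x. x \<noteq> 0 \<longrightarrow> a' \<le> K f x \<and> K f x \<le> b') \<and> b' - a' \<le> \<theta> * (b - a)"
  shows "\<exists>c f. proj_fun f \<and> (\<forall>x. x \<noteq> 0 \<longrightarrow> f x - K f x = q x - c)"
proof -
  let ?g = "\<lambda>n. (K ^^ n) q"
  have g: "proj_fun (?g n)" for n by (rule markov_opD(1)[OF markov_op_funpow[OF K] q])
  define A where "A n = (INF x\<in>-{0}. ?g n x)" for n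
  define B where "B n = (SUP x\<in>-{0}. ?g n x)" for n
  define e :: "real^2" where "e = axis 1 1"
  have e: "e \<noteq> 0" by (simp add: e_def axis_eq_0_iff)
  then have ne: "-{0::real^2} \<noteq> {}" by blast
  have bdd: "bdd_below (?g n ` (-{0}))" "bdd_above (?g n ` (-{0}))" for n
  proof -
    obtain C where C: "\<bar>?g n x\<bar> \<le> C" for x using proj_fun_bounded[OF g] by blast
    have "- C \<le> ?g n x" "?g n x \<le> C" for x using C[of x] by auto
    then show "bdd_below (?g n ` (-{0}))" "bdd_above (?g n ` (-{0}))"
      by (auto intro!: bdd_belowI2[of _ "-C"] bdd_aboveI2[of _ _ C])
  qed
  have AB: "A n \<le> ?g n x" "?g n x \<le> B n" if "x \<noteq> 0" for n x
    unfolding A_def B_def using that by (auto intro!: cINF_lower cSUP_upper bdd)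
  have A_ge: "a \<le> A n" if "\<And>x. x \<noteq> 0 \<Longrightarrow> a \<le> ?g n x" for a n
    unfolding A_def using that by (intro cINF_greatest ne) auto
  have B_le: "B n \<le> b" if "\<And>x. x \<noteq> 0 \<Longrightarrow> ?g n x \<le> b" for b n
    unfolding B_def using that by (intro cSUP_least ne) auto
  have Amono: "A n \<le> A (Suc n)" for n
    by (rule A_ge) (simp add: markov_op_bounds(1)[OF K g] AB)
  have Bmono: "B (Suc n) \<le> B n" for n
    by (rule B_le) (simp add: markov_op_bounds(2)[OF K g] AB)
  have A_inc: "incseq A" using Amono by (rule incseq_SucI)
  have B_dec: "decseq B" using Bmono by (rule decseq_SucI)
  have A_le_B: "A n \<le> B n" for n using AB[OF e, of n] by linarith
  have len: "B n - A n \<le> \<theta> ^ n * (B 0 - A 0)" for n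
  proof (induction n)
    case (Suc n)
    obtain a' b' where ab: "\<And>x. x \<noteq> 0 \<Longrightarrow> a' \<le> K (?g n) x \<and> K (?g n) x \<le> b'" "b' - a' \<le> \<theta> * (B n - A n)"
      using contr[OF g, of "A n" n "B n"] AB by blast
    have "a' \<le> A (Suc n)" "B (Suc n) \<le> b'"
      using ab(1) by (auto intro!: A_ge B_le)
    then have "B (Suc n) - A (Suc n) \<le> \<theta> * (B n - A n)" using ab(2) by linarith
    also have "\<dots> \<le> \<theta> * (\<theta> ^ n * (B 0 - A 0))" by (intro mult_left_mono Suc \<theta>)
    finally show ?case by simp
  qed simp
  define L where "L = B 0 - A 0"
  have L0: "0 \<le> L" using A_le_B[of 0] by (simp add: L_def)
  have "bdd_above (range A)"
    by (rule bdd_aboveI2[of _ _ "B 0"]) (meson A_le_B B_dec decseqD le0 order_trans)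
  define c where "c = (SUP n. A n)"
  have c: "A n \<le> c" "c \<le> B n" for n
  proof -
    show "A n \<le> c" unfolding c_def by (rule cSUP_upper) (use \<open>bdd_above (range A)\<close> in auto)
    have "A m \<le> B n" for m
      using incseqD[OF A_inc, of m "max m n"] decseqD[OF B_dec, of n "max m n"] A_le_B[of "max m n"] by linarith
    then show "c \<le> B n" unfolding c_def by (intro cSUP_least) auto
  qed
  have dist: "\<bar>?g n x - c\<bar> \<le> L * \<theta> ^ n" if "x \<noteq> 0" for n x
    using AB[OF that, of n] c[of n] len[of n] by (simp add: L_def mult.commute abs_le_iff)
  \<comment> \<open>The geometric bound says nothing at the origin, where the series could diverge;
    the value 0 makes it converge everywhere.\<close>
  define h where "h n x = (if x = 0 then 0 else ?g n x - c)" for n x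
  have h: "proj_fun (h n)" for n
  proof -
    note [measurable] = proj_fun_measurable[OF g[of n]]
    obtain C where C: "\<bar>?g n x\<bar> \<le> C" for x using proj_fun_bounded[OF g] by blast
    have "\<bar>h n x\<bar> \<le> C + \<bar>c\<bar>" for x using C[of x] C[of 0] by (auto simp: h_def)
    moreover have "h n \<in> borel_measurable borel" unfolding h_def by measurable
    moreover have "h n (k *\<^sub>R x) = h n x" if "k \<noteq> 0" for k x
      using that by (simp add: h_def proj_fun_scale[OF g])
    ultimately show ?thesis unfolding proj_fun_def by blast
  qed
  have hb: "\<bar>h n x\<bar> \<le> L * \<theta> ^ n" for n x
    using dist[of x n] L0 \<theta> by (auto simp: h_def)
  have geo: "summable (\<lambda>n. L * \<theta> ^ n)" using \<theta> by (intro summable_mult summable_geometric) auto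
  have hs: "summable (\<lambda>n. h n x)" for x
    by (rule summable_comparison_test'[OF geo, of 0]) (use hb in auto)
  define f where "f x = (\<Sum>n. h n x)" for x
  have tail: "\<bar>f x - (\<Sum>n<N. h n x)\<bar> \<le> L * \<theta> ^ N / (1 - \<theta>)" for x N
  proof -
    have "f x - (\<Sum>n<N. h n x) = (\<Sum>n. h (n + N) x)"
      unfolding f_def using suminf_split_initial_segment[OF hs, of x N] by simp
    moreover have "\<bar>\<Sum>n. h (n + N) x\<bar> \<le> (\<Sum>n. L * \<theta> ^ N * \<theta> ^ n)"
    proof -
      have s: "summable (\<lambda>n. L * \<theta> ^ N * \<theta> ^ n)" using \<theta> by (intro summable_mult summable_geometric) auto
      have "norm (h (n + N) x) \<le> L * \<theta> ^ N * \<theta> ^ n" for n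
        using hb[of "n + N" x] by (simp add: power_add mult.commute mult.left_commute)
      then show ?thesis using norm_suminf_le[of "\<lambda>n. h (n + N) x", OF _ s] by simp
    qed
    moreover have "(\<Sum>n. L * \<theta> ^ N * \<theta> ^ n) = L * \<theta> ^ N * (1 / (1 - \<theta>))"
      using \<theta> by (subst suminf_mult) (auto simp: suminf_geometric)
    ultimately show ?thesis by simp
  qed
  have f: "proj_fun f"
  proof -
    note [measurable] = proj_fun_measurable[OF h]
    have "f \<in> borel_measurable borel" unfolding f_def by measurable
    moreover have "\<bar>f x\<bar> \<le> L / (1 - \<theta>)" for x using tail[of x 0] by simp
    moreover have "f (k *\<^sub>R x) = f x" if "k \<noteq> 0" for k x
      unfolding f_def using that by (simp add: proj_fun_scale[OF h])
    ultimately show ?thesis unfolding proj_fun_def by blast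
  qed
  have "f x - K f x = q x - c" if x: "x \<noteq> 0" for x
  proof -
    have Kh: "K (h n) x = ?g (Suc n) x - c" for n
    proof -
      have "K (h n) x = K (\<lambda>x. ?g n x - c) x"
        using markov_op_mono[OF K h proj_fun_diff[OF g proj_fun_const] _ x, of n n c]
          markov_op_mono[OF K proj_fun_diff[OF g proj_fun_const] h _ x, of n c n]
        by (auto simp: h_def)
      then show ?thesis using markov_op_diff[OF K g proj_fun_const, of n c] markov_opD(4)[OF K] by simp
    qed
    have part: "(\<Sum>n<N. h n x) - K (\<lambda>x. \<Sum>n<N. h n x) x = q x - c - (?g N x - c)" for N
    proof -
      have "(\<Sum>n<N. h n x) - K (\<lambda>x. \<Sum>n<N. h n x) x = (\<Sum>n<N. (?g n x - c) - (?g (Suc n) x - c))"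
        using x by (simp only: markov_op_sum[OF K h] Kh sum_subtractf[symmetric]) (simp add: h_def)
      also have "\<dots> = (?g 0 x - c) - (?g N x - c)" by (rule sum_lessThan_telescope')
      finally show ?thesis by simp
    qed
    have z: "(\<lambda>N. L * \<theta> ^ N) \<longlonglongrightarrow> 0" using \<theta> by (intro tendsto_mult_right_zero LIMSEQ_power_zero) auto
    have l1: "(\<lambda>N. q x - c - (?g N x - c)) \<longlonglongrightarrow> q x - c"
    proof -
      have "(\<lambda>N. ?g N x - c) \<longlonglongrightarrow> 0"
        by (rule Lim_null_comparison[OF _ z]) (use dist[OF x] in auto)
      then show ?thesis using tendsto_diff[OF tendsto_const[of "q x - c"]] by fastforce
    qed
    have l2: "(\<lambda>N. \<Sum>n<N. h n x) \<longlonglongrightarrow> f x"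
      unfolding f_def by (rule summable_LIMSEQ[OF hs])
    have l3: "(\<lambda>N. K (\<lambda>x. \<Sum>n<N. h n x) x) \<longlonglongrightarrow> K f x"
    proof -
      have s: "proj_fun (\<lambda>x. \<Sum>n<N. h n x)" for N by (intro proj_fun_sum h)
      have Kb: "\<bar>K (\<lambda>x. \<Sum>n<N. h n x) x - K f x\<bar> \<le> L * \<theta> ^ N / (1 - \<theta>)" for N
      proof -
        have d: "proj_fun (\<lambda>x. (\<Sum>n<N. h n x) - f x)" by (intro proj_fun_diff s f)
        have "K (\<lambda>x. (\<Sum>n<N. h n x) - f x) x = K (\<lambda>x. \<Sum>n<N. h n x) x - K f x"
          using markov_op_diff[OF K s f] by simp
        moreover have "- (L * \<theta> ^ N / (1 - \<theta>)) \<le> (\<Sum>n<N. h n x) - f x" "(\<Sum>n<N. h n x) - f x \<le> L * \<theta> ^ N / (1 - \<theta>)" for x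
          using tail[of x N] by (auto simp: abs_le_iff)
        ultimately show ?thesis
          using markov_op_bounds[OF K d x, of "- (L * \<theta> ^ N / (1 - \<theta>))"] markov_op_bounds(2)[OF K d x, of "L * \<theta> ^ N / (1 - \<theta>)"]
          by (auto simp: abs_le_iff)
      qed
      have "(\<lambda>N. K (\<lambda>x. \<Sum>n<N. h n x) x - K f x) \<longlonglongrightarrow> 0"
      proof (rule Lim_null_comparison)
        show "\<forall>\<^sub>F N in sequentially. norm (K (\<lambda>x. \<Sum>n<N. h n x) x - K f x) \<le> L * \<theta> ^ N / (1 - \<theta>)"
          unfolding real_norm_def by (intro always_eventually allI Kb)
      qed (rule tendsto_divide_zero[OF z])
      then show ?thesis by (simp add: LIM_zero_iff)
    qed
    from tendsto_diff[OF l2 l3] l1 show ?thesis unfolding part by (rule LIMSEQ_unique)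
  qed
  with f show ?thesis by blast
qed

text \<open>If \<open>f\<close> solves the equation for the average of the powers, then the average
  over \<open>m\<close> of the partial sums of \<open>Q^j f\<close>, \<open>j < m\<close>, solves it
  for \<open>Q\<close>: applying \<open>1 - Q\<close> telescopes each partial sum to
  \<open>f - Q^m f\<close>.\<close>

lemma poisson_of_average_contraction:
  assumes Q: "markov_op Q" and q: "proj_fun q" and \<theta>: "0 \<le> \<theta>" "\<theta> < 1"
    and contr: "\<And>f a b. proj_fun f \<Longrightarrow> (\<And>x. x \<noteq> 0 \<Longrightarrow> a \<le> f x \<and> f x \<le> b) \<Longrightarrow>
       \<exists>a' b'. (\<forall>x. x \<noteq> 0 \<longrightarrow> a' \<le> (\<Sum>m\<le>M. (Q ^^ m) f x) / real (Suc M) \<and> (\<Sum>m\<le>M. (Q ^^ m) f x) / real (Suc M) \<le> b')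
          \<and> b' - a' \<le> \<theta> * (b - a)"
  shows "\<exists>c f. proj_fun f \<and> (\<forall>x. x \<noteq> 0 \<longrightarrow> f x - Q f x = q x - c)"
proof -
  have S: "markov_op (Q ^^ m)" for m by (rule markov_op_funpow[OF Q])
  obtain c f where f: "proj_fun f" "\<And>x. x \<noteq> 0 \<Longrightarrow> f x - (\<Sum>m\<le>M. (Q ^^ m) f x) / real (Suc M) = q x - c"
    using poisson_of_contraction[OF markov_op_average[OF Q] q \<theta> contr] by blast
  have Qf: "proj_fun ((Q ^^ m) f)" for m by (rule markov_opD(1)[OF S f(1)])
  let ?F = "\<lambda>x. 1 / real (Suc M) * (\<Sum>m\<le>M. \<Sum>j<m. (Q ^^ j) f x)"
  have in1: "proj_fun (\<lambda>x. \<Sum>j<m. (Q ^^ j) f x)" for m by (intro proj_fun_sum Qf)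
  have in2: "proj_fun (\<lambda>x. \<Sum>m\<le>M. \<Sum>j<m. (Q ^^ j) f x)" by (intro proj_fun_sum in1)
  have F: "proj_fun ?F" by (intro proj_fun_cmult in2)
  have "?F x - Q ?F x = f x - (\<Sum>m\<le>M. (Q ^^ m) f x) / real (Suc M)" for x
  proof -
    have "Q ?F x = 1 / real (Suc M) * (\<Sum>m\<le>M. \<Sum>j<m. (Q ^^ Suc j) f x)"
      by (simp only: markov_opD(3)[OF Q in2] markov_op_sum[OF Q in1] markov_op_sum[OF Q Qf] funpow.simps o_apply)
    then have "?F x - Q ?F x = 1 / real (Suc M) * (\<Sum>m\<le>M. \<Sum>j<m. (Q ^^ j) f x - (Q ^^ Suc j) f x)"
      by (simp add: sum_subtractf right_diff_distrib)
    also have "(\<Sum>m\<le>M. \<Sum>j<m. (Q ^^ j) f x - (Q ^^ Suc j) f x) = (\<Sum>m\<le>M. f x - (Q ^^ m) f x)"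
      by (intro sum.cong refl) (subst sum_lessThan_telescope', simp)
    also have "\<dots> = real (Suc M) * f x - (\<Sum>m\<le>M. (Q ^^ m) f x)"
      by (simp add: sum_subtractf)
    finally show ?thesis by (simp add: field_simps)
  qed
  then have "?F x - Q ?F x = q x - c" if "x \<noteq> 0" for x using f(2)[OF that] by simp
  with F show ?thesis by blast
qed

section \<open>Exponentially sampled flows\<close>

lemma prob_space_exp_law: "prob_space exp_law"
  by (rule prob_space_exponential_density) simp

lemma sets_exp_law [measurable_cong, simp]: "sets exp_law = sets borel"
  by simp

lemma AE_exp_law_nonneg: "AE s in exp_law. 0 \<le> s"
  by (subst AE_density) (auto simp: exponential_density_def)

lemma integral_exp_law:
  fixes g :: "real \<Rightarrow> real"
  assumes "g \<in> borel_measurable borel"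
  shows "(\<integral>s. g s \<partial>exp_law) = (\<integral>s. exponential_density 1 s * g s \<partial>lborel)"
  using assms by (subst integral_real_density) (auto simp: exponential_density_nonneg)

lemma integrable_exp_law_iff:
  fixes g :: "real \<Rightarrow> real"
  assumes "g \<in> borel_measurable borel"
  shows "integrable exp_law g \<longleftrightarrow> integrable lborel (\<lambda>s. exponential_density 1 s * g s)"
  using assms by (subst integrable_real_density) (auto simp: exponential_density_nonneg)

lemma two_cases: "(i::2) = 0 \<or> i = 1"
proof -
  have "(2::2) = 0" by simp
  then show ?thesis using exhaust_2[of i] by metis
qed

section \<open>The resolvent of a linear flow\<close>

lemma borel_measurable_mat_exp_joint:
  "(\<lambda>p. mat_exp (fst p *\<^sub>R M) *v snd p) \<in> borel_measurable (borel \<Otimes>\<^sub>M (borel :: (real^'n) measure))"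
  unfolding borel_prod by (intro borel_measurable_continuous_onI continuous_intros)

lemma borel_measurable_mat_exp [measurable (raw)]:
  assumes f: "f \<in> borel_measurable N" and g: "g \<in> borel_measurable N"
  shows "(\<lambda>x. mat_exp (f x *\<^sub>R M) *v (g x :: real^'n)) \<in> borel_measurable N"
  using measurable_compose[OF measurable_Pair[OF f g] borel_measurable_mat_exp_joint[of M]] by simp

text \<open>The resolvent at 1 of the generator of the flow, that is of differentiation along the
  field \<open>M x\<close>. Other exponential rates are obtained by scaling the matrix.\<close>

definition resolv :: "real^2^2 \<Rightarrow> (real^2 \<Rightarrow> real) \<Rightarrow> real^2 \<Rightarrow> real" where
  "resolv M f x = (\<integral>s. f (mat_exp (s *\<^sub>R M) *v x) \<partial>exp_law)"

lemma integrable_resolv: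
  assumes f: "proj_fun f"
  shows "integrable exp_law (\<lambda>s. f (mat_exp (s *\<^sub>R M) *v x))"
proof -
  interpret prob_space exp_law by (rule prob_space_exp_law)
  note [measurable] = proj_fun_measurable[OF f]
  obtain B where "\<And>x. \<bar>f x\<bar> \<le> B" using proj_fun_bounded[OF f] by blast
  then show ?thesis by (intro integrable_const_bound[of _ B]) auto
qed

lemma borel_measurable_resolv:
  assumes [measurable]: "f \<in> borel_measurable borel"
  shows "resolv M f \<in> borel_measurable borel"
proof -
  interpret prob_space exp_law by (rule prob_space_exp_law)
  show ?thesis unfolding resolv_def by measurable
qed

lemma markov_op_resolv: "markov_op (resolv M)"
  unfolding markov_op_def
proof (intro conjI allI impI)
  interpret prob_space exp_law by (rule prob_space_exp_law)
  fix f :: "real^2 \<Rightarrow> real" assume f: "proj_fun f"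
  obtain B where B: "\<And>x. \<bar>f x\<bar> \<le> B" using proj_fun_bounded[OF f] by blast
  have "\<bar>resolv M f x\<bar> \<le> B" for x
  proof -
    have "\<bar>resolv M f x\<bar> \<le> (\<integral>s. \<bar>f (mat_exp (s *\<^sub>R M) *v x)\<bar> \<partial>exp_law)"
      unfolding resolv_def by (rule integral_abs_bound)
    also have "\<dots> \<le> (\<integral>s. B \<partial>exp_law)"
      by (intro integral_mono integrable_abs integrable_resolv[OF f]) (auto simp: B)
    finally show ?thesis using prob_space by simp
  qed
  moreover have "resolv M f (c *\<^sub>R x) = resolv M f x" if "c \<noteq> 0" for c x
    unfolding resolv_def
    by (simp add: matrix_vector_mult_scaleR proj_fun_scale[OF f that])
  ultimately show "proj_fun (resolv M f)"
    unfolding proj_fun_def using borel_measurable_resolv[OF proj_fun_measurable[OF f]] by blast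
  show "resolv M (\<lambda>x. c * f x) = (\<lambda>x. c * resolv M f x)" for c
    unfolding resolv_def by simp
  show "resolv M (\<lambda>x. f x + g x) = (\<lambda>x. resolv M f x + resolv M g x)" if "proj_fun g" for g
    unfolding resolv_def using integrable_resolv[OF f] integrable_resolv[OF that] by simp
  show "0 \<le> resolv M f x" if "\<forall>x. x \<noteq> 0 \<longrightarrow> 0 \<le> f x" "x \<noteq> 0" for x
    unfolding resolv_def using that by (intro integral_nonneg_AE) auto
next
  interpret prob_space exp_law by (rule prob_space_exp_law)
  show "resolv M (\<lambda>_. c) = (\<lambda>_. c)" for c
    unfolding resolv_def using prob_space by simp
qed

text \<open>The minorizing functional: the flow line through \<open>v\<close>, sampled after time 1. A start at time
  \<open>\<tau>\<close> on this line with \<open>\<bar>\<tau>\<bar> \<le> 1\<close> only costs a constant factor.\<close>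

definition late_mean :: "real^2^2 \<Rightarrow> real^2 \<Rightarrow> (real^2 \<Rightarrow> real) \<Rightarrow> real" where
  "late_mean M v f = (\<integral>s. indicator {1..} s * f (mat_exp (s *\<^sub>R M) *v v) \<partial>exp_law)"

lemma integrable_late_mean:
  assumes f: "proj_fun f"
  shows "integrable exp_law (\<lambda>s. indicator {1..} s * f (mat_exp (s *\<^sub>R M) *v x))"
proof -
  interpret prob_space exp_law by (rule prob_space_exp_law)
  note [measurable] = proj_fun_measurable[OF f]
  show ?thesis
    by (rule Bochner_Integration.integrable_bound[OF integrable_resolv[OF f, of M x]]) (auto split: split_indicator)
qed

text \<open>Substitute \<open>t = s + \<tau>\<close>. The cut at 1 ensures \<open>s \<ge> 0\<close>
  for every admissible \<open>\<tau>\<close>, so no mass is lost at the start of the exponential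
  density, and the density itself changes by a factor of at most \<open>exp 1\<close>.\<close>

lemma resolv_ge_late_mean:
  assumes f: "proj_fun f" and nn: "\<And>x. x \<noteq> 0 \<Longrightarrow> 0 \<le> f x" and v: "v \<noteq> 0" and \<tau>: "\<bar>\<tau>\<bar> \<le> 1"
  shows "exp (-1) * late_mean M v f \<le> resolv M f (mat_exp (\<tau> *\<^sub>R M) *v v)"
proof -
  note [measurable] = proj_fun_measurable[OF f]
  let ?d = "exponential_density 1" and ?F = "\<lambda>t. f (mat_exp (t *\<^sub>R M) *v v)"
  let ?G = "\<lambda>t. ?d t * (indicator {1..} t * ?F t)"
  have F0: "0 \<le> ?F t" for t using v by (intro nn) auto
  have G_int: "integrable lborel ?G"
    using integrable_late_mean[OF f, of M v] by (subst (asm) integrable_exp_law_iff) auto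
  have R_int: "integrable lborel (\<lambda>s. ?d s * ?F (s + \<tau>))"
    using integrable_resolv[OF f, of M "mat_exp (\<tau> *\<^sub>R M) *v v"]
    by (subst (asm) integrable_exp_law_iff) (auto simp: mat_exp_add)
  have "late_mean M v f = (\<integral>t. ?G t \<partial>lborel)"
    unfolding late_mean_def by (rule integral_exp_law) measurable
  also have "\<dots> = (\<integral>s. ?G (\<tau> + s) \<partial>lborel)"
    using lborel_integral_real_affine[of 1 ?G \<tau>] by simp
  also have "\<dots> \<le> (\<integral>s. exp 1 * (?d s * ?F (s + \<tau>)) \<partial>lborel)"
  proof (rule integral_mono)
    show "integrable lborel (\<lambda>s. ?G (\<tau> + s))"
      using lborel_integrable_real_affine[OF G_int, of 1 \<tau>] by simp
    show "integrable lborel (\<lambda>s. exp 1 * (?d s * ?F (s + \<tau>)))" using R_int by simp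
    show "?G (\<tau> + s) \<le> exp 1 * (?d s * ?F (s + \<tau>))" for s
    proof (cases "1 \<le> \<tau> + s")
      case True
      then have s: "0 \<le> s" using \<tau> by linarith
      have "exp (- (\<tau> + s)) \<le> exp 1 * exp (- s)"
        unfolding exp_add[symmetric] using \<tau> by simp
      then have "exp (- (\<tau> + s)) * ?F (s + \<tau>) \<le> exp 1 * exp (- s) * ?F (s + \<tau>)"
        by (intro mult_right_mono F0)
      then show ?thesis using True s by (simp add: exponential_density_def add.commute)
    next
      case False
      then show ?thesis using F0[of "s + \<tau>"]
        by (auto intro!: mult_nonneg_nonneg exponential_density_nonneg)
    qed
  qed
  also have "\<dots> = exp 1 * resolv M f (mat_exp (\<tau> *\<^sub>R M) *v v)"
    unfolding resolv_def by (subst integral_exp_law) (auto simp: mat_exp_add)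
  finally show ?thesis by (simp add: exp_minus field_simps)
qed

lemma late_mean_diff_const:
  assumes f: "proj_fun f"
  shows "late_mean M v (\<lambda>x. f x - c) = late_mean M v f - c * late_mean M v (\<lambda>_. 1)"
  unfolding late_mean_def
  using integrable_late_mean[OF f, of M v] integrable_late_mean[of "\<lambda>_. 1" M v]
  by (simp add: right_diff_distrib mult.commute[of _ c])

lemma measure_exp_law_Ico_pos:
  assumes "0 \<le> s" "s < t"
  shows "0 < measure exp_law {s..<t}"
proof -
  interpret prob_space exp_law by (rule prob_space_exp_law)
  have "ennreal (exp (- t) * (t - s)) = (\<integral>\<^sup>+x. ennreal (exp (- t)) * indicator {s..<t} x \<partial>lborel)"
    using assms by (simp add: nn_integral_cmult_indicator ennreal_mult)
  also have "\<dots> \<le> (\<integral>\<^sup>+x. ennreal (exponential_density 1 x) * indicator {s..<t} x \<partial>lborel)"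
    using assms by (intro nn_integral_mono) (auto split: split_indicator simp: exponential_density_def)
  also have "\<dots> = emeasure exp_law {s..<t}"
    by (subst emeasure_density) auto
  finally have "exp (- t) * (t - s) \<le> measure exp_law {s..<t}"
    by (simp add: emeasure_eq_measure)
  moreover have "0 < exp (- t) * (t - s)" using assms by simp
  ultimately show ?thesis by linarith
qed

lemma late_mean_one_pos: "0 < late_mean M v (\<lambda>_. 1)"
proof -
  interpret prob_space exp_law by (rule prob_space_exp_law)
  have "0 < measure exp_law {1..<2}" by (rule measure_exp_law_Ico_pos) auto
  also have "\<dots> \<le> measure exp_law {1..}" by (rule finite_measure_mono) auto
  finally show ?thesis by (simp add: late_mean_def)
qed

text \<open>Two strict signs, rather than the zero itself, are recorded because they survive a small
  change of the initial point: the transversal crossing persists for nearby directions.\<close>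

lemma zero_deriv_sign_change:
  fixes h :: "real \<Rightarrow> real"
  assumes "(h has_real_derivative D) (at 0)" "h 0 = 0" "D \<noteq> 0" "0 < e"
  shows "\<exists>t1 t2. - e < t1 \<and> t1 < e \<and> - e < t2 \<and> t2 < e \<and> h t1 < 0 \<and> 0 < h t2"
proof (cases "0 < D")
  case True
  obtain d where d: "0 < d" "\<And>t. 0 < t \<Longrightarrow> t < d \<Longrightarrow> h 0 < h (0 + t)"
    using DERIV_pos_inc_right[OF assms(1) True] by blast
  obtain d' where d': "0 < d'" "\<And>t. 0 < t \<Longrightarrow> t < d' \<Longrightarrow> h (0 - t) < h 0"
    using DERIV_pos_inc_left[OF assms(1) True] by blast
  show ?thesis
    using d(1) d'(1) assms(2,4) d(2)[of "min d e / 2"] d'(2)[of "min d' e / 2"]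
    by (intro exI[of _ "- (min d' e / 2)"] exI[of _ "min d e / 2"]) auto
next
  case False
  then have D: "D < 0" using assms(3) by simp
  obtain d where d: "0 < d" "\<And>t. 0 < t \<Longrightarrow> t < d \<Longrightarrow> h (0 + t) < h 0"
    using DERIV_neg_dec_right[OF assms(1) D] by blast
  obtain d' where d': "0 < d'" "\<And>t. 0 < t \<Longrightarrow> t < d' \<Longrightarrow> h 0 < h (0 - t)"
    using DERIV_neg_dec_left[OF assms(1) D] by blast
  show ?thesis
    using d(1) d'(1) assms(2,4) d(2)[of "min d e / 2"] d'(2)[of "min d' e / 2"]
    by (intro exI[of _ "min d e / 2"] exI[of _ "- (min d' e / 2)"]) auto
qed

section \<open>Doeblin's condition on the projective line\<close>

lemma DERIV_inner_flow:
  "((\<lambda>t. b \<bullet> (mat_exp (t *\<^sub>R M) *v x)) has_real_derivative b \<bullet> (M *v (mat_exp (t *\<^sub>R M) *v x))) (at t)"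
  for b x :: "real^'n"
  using bounded_linear.has_vector_derivative[OF bounded_linear_inner_right has_vector_derivative_mat_exp]
  by (simp add: has_real_derivative_iff_has_vector_derivative)

text \<open>With each matrix divided by its rate, \<open>a 0 + a 1\<close> is a positive multiple of
  the mean matrix; \<open>vp\<close>, \<open>vm\<close> are its expanding and contracting
  eigenvectors and \<open>bu\<close>, \<open>bw\<close> the dual basis. The last two assumptions say
  that the flow of \<open>a 0\<close> leaves either eigendirection with nonzero angular
  speed.\<close>

locale flow_pair =
  fixes a :: "2 \<Rightarrow> real^2^2" and vp vm bu bw :: "real^2" and p m :: real
  assumes p_pos: "0 < p" and m_pos: "0 < m"
    and dual: "bu \<bullet> vp = 1" "bu \<bullet> vm = 0" "bw \<bullet> vp = 0" "bw \<bullet> vm = 1"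
    and expand: "\<And>x. x = (bu \<bullet> x) *\<^sub>R vp + (bw \<bullet> x) *\<^sub>R vm"
    and sum_vp: "a 0 *v vp + a 1 *v vp = p *\<^sub>R vp"
    and sum_vm: "a 0 *v vm + a 1 *v vm = - m *\<^sub>R vm"
    and ne_vp: "bw \<bullet> (a 0 *v vp) \<noteq> 0"
    and ne_vm: "bu \<bullet> (a 0 *v vm) \<noteq> 0"
begin

definition Q :: "(real^2 \<Rightarrow> real) \<Rightarrow> real^2 \<Rightarrow> real" where
  "Q f x = (resolv (a 0) f x + resolv (a 1) f x) / 2"

lemma markov_op_Q: "markov_op Q"
proof -
  note R = markov_opD[OF markov_op_resolv]
  show ?thesis
    unfolding markov_op_def Q_def
  proof (intro conjI allI impI)
    fix f :: "real^2 \<Rightarrow> real" assume f: "proj_fun f"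
    show "proj_fun (\<lambda>x. (resolv (a 0) f x + resolv (a 1) f x) / 2)"
      using proj_fun_cmult[OF proj_fun_add[OF R(1)[OF f] R(1)[OF f]], of "1/2" "a 0" "a 1"] by simp
    show "0 \<le> (resolv (a 0) f x + resolv (a 1) f x) / 2" if "\<forall>x. x \<noteq> 0 \<longrightarrow> 0 \<le> f x" "x \<noteq> 0" for x
      using R(5)[OF f, of x "a 0"] R(5)[OF f, of x "a 1"] that by simp
    show "(\<lambda>x. (resolv (a 0) (\<lambda>x. f x + g x) x + resolv (a 1) (\<lambda>x. f x + g x) x) / 2) =
        (\<lambda>x. (resolv (a 0) f x + resolv (a 1) f x) / 2 + (resolv (a 0) g x + resolv (a 1) g x) / 2)" if g: "proj_fun g" for g
      by (simp add: R(2)[OF f g] add_divide_distrib algebra_simps)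
    show "(\<lambda>x. (resolv (a 0) (\<lambda>x. c * f x) x + resolv (a 1) (\<lambda>x. c * f x) x) / 2) =
        (\<lambda>x. c * ((resolv (a 0) f x + resolv (a 1) f x) / 2))" for c
      by (simp add: R(3)[OF f] distrib_left)
  qed (simp add: R(4))
qed

lemma Q_ge_half_resolv:
  assumes "proj_fun f" "\<And>x. x \<noteq> 0 \<Longrightarrow> 0 \<le> f x" "x \<noteq> 0"
  shows "resolv (a i) f x / 2 \<le> Q f x"
  using two_cases[of i] markov_opD(5)[OF markov_op_resolv assms, of "a 0"] markov_opD(5)[OF markov_op_resolv assms, of "a 1"]
  by (auto simp: Q_def)

lemma vp_ne: "vp \<noteq> 0"
  using dual by auto

lemma Qm: "markov_op (Q ^^ k)"
  by (rule markov_op_funpow[OF markov_op_Q])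

abbreviation "\<phi> \<equiv> late_mean (a 0) vp"

text \<open>Local form of Doeblin's condition with one fixed minorizing functional. The
  neighbourhood is built in so that good points form an open set and constants can be made uniform
  by compactness; the number of steps may vary with the point.\<close>

definition good :: "real^2 \<Rightarrow> bool" where
  "good x \<longleftrightarrow> (\<exists>U k \<eta>. open U \<and> x \<in> U \<and> 0 \<notin> U \<and> 0 < \<eta> \<and>
     (\<forall>y\<in>U. \<forall>f. proj_fun f \<longrightarrow> (\<forall>x. x \<noteq> 0 \<longrightarrow> 0 \<le> f x) \<longrightarrow> \<eta> * \<phi> f \<le> (Q ^^ k) f y))"

lemma goodI:
  assumes "open U" "x \<in> U" "x \<noteq> 0" "0 < \<eta>"
    "\<And>y f. y \<in> U \<Longrightarrow> y \<noteq> 0 \<Longrightarrow> proj_fun f \<Longrightarrow> (\<And>x. x \<noteq> 0 \<Longrightarrow> 0 \<le> f x) \<Longrightarrow> \<eta> * \<phi> f \<le> (Q ^^ k) f y"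
  shows "good x"
  unfolding good_def using assms
  by (intro exI[of _ "U - {0}"] exI[of _ k] exI[of _ \<eta>]) (auto intro: open_delete)

lemma open_good: "open {x. good x}"
proof (subst open_subopen, intro ballI)
  fix x assume "x \<in> {x. good x}"
  then obtain U k \<eta> where U: "open U" "x \<in> U" "0 \<notin> U" "0 < \<eta>"
     "\<forall>y\<in>U. \<forall>f. proj_fun f \<longrightarrow> (\<forall>x. x \<noteq> 0 \<longrightarrow> 0 \<le> f x) \<longrightarrow> \<eta> * \<phi> f \<le> (Q ^^ k) f y"
    unfolding good_def by blast
  then show "\<exists>T. open T \<and> x \<in> T \<and> T \<subseteq> {x. good x}"
    by (intro exI[of _ U]) (auto simp: good_def)
qed

lemma good_scale:
  assumes x: "good x" and c: "c \<noteq> 0"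
  shows "good (c *\<^sub>R x)"
proof -
  obtain U k \<eta> where U: "open U" "x \<in> U" "0 \<notin> U" "0 < \<eta>"
     "\<forall>y\<in>U. \<forall>f. proj_fun f \<longrightarrow> (\<forall>x. x \<noteq> 0 \<longrightarrow> 0 \<le> f x) \<longrightarrow> \<eta> * \<phi> f \<le> (Q ^^ k) f y"
    using x unfolding good_def by blast
  show ?thesis
  proof (rule goodI[of "(*\<^sub>R) c ` U" _ \<eta> k])
    show "open ((*\<^sub>R) c ` U)" using c U(1) by (rule open_scaling)
    show "c *\<^sub>R x \<in> (*\<^sub>R) c ` U" "c *\<^sub>R x \<noteq> 0" "0 < \<eta>" using U c by auto
    fix y f assume "y \<in> (*\<^sub>R) c ` U" and f: "proj_fun f" "\<And>x. x \<noteq> 0 \<Longrightarrow> 0 \<le> f x"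
    then obtain z where z: "z \<in> U" "y = c *\<^sub>R z" by auto
    have "(Q ^^ k) f y = (Q ^^ k) f z"
      using z c by (simp add: proj_fun_scale[OF markov_opD(1)[OF Qm f(1)]])
    then show "\<eta> * \<phi> f \<le> (Q ^^ k) f y" using U(5) z f by auto
  qed
qed

text \<open>By joint continuity nearby starts are carried into the good neighbourhood at all times
  of a short interval. This interval has positive exponential mass, and choosing flow
  \<open>i\<close> costs a factor 1/2; the result is a minorization with one more step.\<close>

lemma good_backward:
  assumes g: "good (mat_exp (s *\<^sub>R a i) *v x)" and s: "0 \<le> s"
  shows "good x"
proof -
  obtain U k \<eta> where U: "open U" "mat_exp (s *\<^sub>R a i) *v x \<in> U" "0 \<notin> U" "0 < \<eta>"
     "\<forall>y\<in>U. \<forall>f. proj_fun f \<longrightarrow> (\<forall>x. x \<noteq> 0 \<longrightarrow> 0 \<le> f x) \<longrightarrow> \<eta> * \<phi> f \<le> (Q ^^ k) f y"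
    using g unfolding good_def by blast
  have x: "x \<noteq> 0" using U(2,3) by auto
  let ?V = "(\<lambda>p. mat_exp (fst p *\<^sub>R a i) *v snd p) -` U"
  have "open ?V" by (rule open_vimage[OF U(1)]) (intro continuous_intros)
  moreover have "(s, x) \<in> ?V" using U(2) by simp
  ultimately obtain S W where SW': "open S" "open W" "(s, x) \<in> S \<times> W" "S \<times> W \<subseteq> ?V"
    by (rule open_prod_elim)
  then have SW: "open S" "open W" "s \<in> S" "x \<in> W" "S \<times> W \<subseteq> ?V" by simp_all
  obtain e where e: "0 < e" "ball s e \<subseteq> S" using SW(1,3) open_contains_ball by blast
  \<comment> \<open>Taken to the right of \<open>s\<close>, so that it consists of nonnegative times
    even for \<open>s = 0\<close>.\<close>
  let ?I = "{s..<s + e}"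
  have I: "?I \<subseteq> S" using e(2) by (auto simp: dist_real_def subset_iff)
  have mass: "0 < measure exp_law ?I" using s e by (intro measure_exp_law_Ico_pos) auto
  interpret prob_space exp_law by (rule prob_space_exp_law)
  show ?thesis
  proof (rule goodI[of W _ "\<eta> * measure exp_law ?I / 2" "Suc k"])
    show "open W" "x \<in> W" "x \<noteq> 0" "0 < \<eta> * measure exp_law ?I / 2" using SW x U mass by auto
    fix y f assume y: "y \<in> W" "y \<noteq> 0" and f: "proj_fun f" "\<And>x. x \<noteq> 0 \<Longrightarrow> 0 \<le> f x"
    let ?g = "(Q ^^ k) f"
    have g: "proj_fun ?g" by (rule markov_opD(1)[OF Qm f(1)])
    have g0: "0 \<le> ?g x" if "x \<noteq> 0" for x by (rule markov_opD(5)[OF Qm f that])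
    have "\<eta> * \<phi> f * measure exp_law ?I = (\<integral>t. indicator ?I t * (\<eta> * \<phi> f) \<partial>exp_law)" by simp
    also have "\<dots> \<le> resolv (a i) ?g y"
      unfolding resolv_def
    proof (rule integral_mono)
      show "integrable exp_law (\<lambda>t. indicator ?I t * (\<eta> * \<phi> f))"
        by (rule integrable_mult_left) (simp add: emeasure_eq_measure)
      show "integrable exp_law (\<lambda>t. ?g (mat_exp (t *\<^sub>R a i) *v y))" by (rule integrable_resolv[OF g])
      show "indicator ?I t * (\<eta> * \<phi> f) \<le> ?g (mat_exp (t *\<^sub>R a i) *v y)" for t
      proof (cases "t \<in> ?I")
        case True
        then have "(t, y) \<in> S \<times> W" using I y(1) by blast
        then have "(t, y) \<in> ?V" using SW(5) by blast
        then have "mat_exp (t *\<^sub>R a i) *v y \<in> U" by simp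
        then show ?thesis using U(5) f True by auto
      next
        case False
        then show ?thesis using g0 y by simp
      qed
    qed
    finally have "\<eta> * measure exp_law ?I / 2 * \<phi> f \<le> resolv (a i) ?g y / 2" by (simp add: mult_ac)
    also have "\<dots> \<le> Q ?g y" by (rule Q_ge_half_resolv[OF g g0 y(2)])
    finally show "\<eta> * measure exp_law ?I / 2 * \<phi> f \<le> (Q ^^ Suc k) f y" by simp
  qed
qed

text \<open>The \<open>bw\<close> coordinate along the flow of \<open>a 0\<close> changes sign near
  \<open>vp\<close>, so by the intermediate value theorem every nearby \<open>y\<close> meets the
  line of \<open>vp\<close> at a time \<open>\<tau>\<close> in [-1, 1]. Up to a scalar,
  \<open>y\<close> is then the point at time \<open>- \<tau>\<close> of the minorizing
  orbit.\<close>

lemma good_vp: "good vp"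
proof -
  let ?h = "\<lambda>t y. bw \<bullet> (mat_exp (t *\<^sub>R a 0) *v y)"
  have D: "((\<lambda>t. ?h t vp) has_real_derivative bw \<bullet> (a 0 *v vp)) (at 0)"
    using DERIV_inner_flow[of bw "a 0" vp 0] by simp
  obtain t1 t2 where t: "-1 < t1" "t1 < 1" "-1 < t2" "t2 < 1" "?h t1 vp < 0" "0 < ?h t2 vp"
    using zero_deriv_sign_change[OF D _ ne_vp, of 1] dual by auto
  let ?U = "{y. ?h t1 y < 0} \<inter> {y. 0 < ?h t2 y}"
  show ?thesis
  proof (rule goodI[of ?U _ "exp (-1) / 2" 1])
    show "open ?U" by (intro open_Int open_Collect_less continuous_intros)
    show "vp \<in> ?U" "vp \<noteq> 0" "0 < exp (-1) / (2::real)" using t vp_ne by auto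
    fix y f assume y: "y \<in> ?U" "y \<noteq> 0" and f: "proj_fun f" "\<And>x. x \<noteq> 0 \<Longrightarrow> 0 \<le> f x"
    have cont: "continuous_on S (\<lambda>t. ?h t y)" for S by (intro continuous_intros)
    have "\<exists>t. \<bar>t\<bar> \<le> 1 \<and> ?h t y = 0"
    proof (cases "t1 \<le> t2")
      case True
      obtain t where "t1 \<le> t" "t \<le> t2" "?h t y = 0"
        using IVT'[OF _ _ True cont, of 0] y by auto
      then show ?thesis using t by (intro exI[of _ t]) auto
    next
      case False
      then have le: "t2 \<le> t1" by simp
      obtain t where "t2 \<le> t" "t \<le> t1" "?h t y = 0"
        using IVT2'[OF _ _ le cont, of 0] y by auto
      then show ?thesis using t by (intro exI[of _ t]) auto
    qed
    then obtain \<tau> where \<tau>: "\<bar>\<tau>\<bar> \<le> 1" "?h \<tau> y = 0" by blast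
    let ?z = "mat_exp (\<tau> *\<^sub>R a 0) *v y"
    have z: "?z = (bu \<bullet> ?z) *\<^sub>R vp"
      by (rule trans[OF expand]) (simp only: \<tau>(2) scaleR_zero_left add_0_right)
    have c: "bu \<bullet> ?z \<noteq> 0"
    proof
      assume "bu \<bullet> ?z = 0"
      with z have "?z = 0" by (metis scaleR_zero_left)
      then show False using y(2) by simp
    qed
    have "y = mat_exp ((- \<tau>) *\<^sub>R a 0) *v ?z" by (simp only: mat_exp_minus_cancel)
    also have "\<dots> = (bu \<bullet> ?z) *\<^sub>R (mat_exp ((- \<tau>) *\<^sub>R a 0) *v vp)"
      by (rule trans[OF arg_cong[OF z]]) (simp only: matrix_vector_mult_scaleR)
    finally have "resolv (a 0) f y = resolv (a 0) f (mat_exp ((- \<tau>) *\<^sub>R a 0) *v vp)"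
      using proj_fun_scale[OF markov_opD(1)[OF markov_op_resolv f(1)] c] by metis
    then have "exp (-1) * \<phi> f \<le> resolv (a 0) f y"
      using resolv_ge_late_mean[OF f vp_ne, of "- \<tau>" "a 0"] \<tau>(1) by simp
    then show "exp (-1) / 2 * \<phi> f \<le> (Q ^^ 1) f y"
      using Q_ge_half_resolv[OF f y(2), of 0] by simp
  qed
qed

text \<open>The expression is the velocity of the chart coordinate \<open>u / w\<close> at a point
  with \<open>w = 1\<close>, and \<open>\<sigma>\<close> selects the upper or the lower endpoint.
  Bad points stay bad under both flows, so an extremal one cannot move outwards.\<close>

lemma extremal_bad_point:
  assumes bad: "\<not> good (y *\<^sub>R vp + vm)" and \<sigma>: "\<sigma> = 1 \<or> \<sigma> = (-1::real)"
    and ext: "\<And>y'. \<not> good (y' *\<^sub>R vp + vm) \<Longrightarrow> \<sigma> * y' \<le> \<sigma> * y"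
  shows "\<sigma> * (bu \<bullet> (a i *v (y *\<^sub>R vp + vm)) - y * (bw \<bullet> (a i *v (y *\<^sub>R vp + vm)))) \<le> 0" (is "?D \<le> 0")
proof (rule ccontr)
  assume "\<not> ?D \<le> 0"
  then have D0: "0 < ?D" by simp
  let ?x = "y *\<^sub>R vp + vm"
  let ?X = "\<lambda>t. mat_exp (t *\<^sub>R a i) *v ?x"
  \<comment> \<open>The displacement of the chart coordinate times the coordinate \<open>w\<close>,
    which is positive for small times; this avoids differentiating a quotient.\<close>
  let ?h = "\<lambda>t. \<sigma> * (bu \<bullet> ?X t - y * (bw \<bullet> ?X t))"
  have d: "(?h has_real_derivative ?D) (at 0)"
    by (rule derivative_eq_intros DERIV_inner_flow refl)+ simp
  obtain e where e: "0 < e" "\<And>t. 0 < t \<Longrightarrow> t < e \<Longrightarrow> ?h 0 < ?h (0 + t)"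
    using DERIV_pos_inc_right[OF d D0] by blast
  have h0: "?h 0 = 0" by (simp add: inner_add_right inner_scaleR_right dual)
  have "isCont (\<lambda>t. bw \<bullet> ?X t) 0" by (rule DERIV_isCont[OF DERIV_inner_flow])
  moreover have "bw \<bullet> ?X 0 = 1" by (simp add: inner_add_right inner_scaleR_right dual)
  ultimately have "\<forall>\<^sub>F t in at 0. 0 < bw \<bullet> ?X t"
    unfolding isCont_def by (intro order_tendstoD(1)) auto
  then obtain e' where e': "0 < e'" "\<And>t. t \<noteq> 0 \<Longrightarrow> \<bar>t\<bar> < e' \<Longrightarrow> 0 < bw \<bullet> ?X t"
    unfolding eventually_at by (auto simp: dist_real_def)
  define t where "t = min e e' / 2"
  have t: "0 < t" "t < e" "t < e'" using e(1) e'(1) by (auto simp: t_def min_def)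
  have w: "0 < bw \<bullet> ?X t" using e'(2)[of t] t by simp
  define y' where "y' = (bu \<bullet> ?X t) / (bw \<bullet> ?X t)"
  have "?X t = (bw \<bullet> ?X t) *\<^sub>R (y' *\<^sub>R vp + vm)"
    using expand[of "?X t"] w by (simp add: y'_def scaleR_add_right)
  then have "good (?X t)" if "good (y' *\<^sub>R vp + vm)"
    using good_scale[OF that, of "bw \<bullet> ?X t"] w by simp
  moreover have "\<not> good (?X t)" using good_backward[of t i ?x] bad t by auto
  ultimately have "\<sigma> * y' \<le> \<sigma> * y" using ext by blast
  then have "(bw \<bullet> ?X t) * (\<sigma> * y' - \<sigma> * y) \<le> 0" using w by (simp add: mult_nonneg_nonpos)
  moreover have "(bw \<bullet> ?X t) * (\<sigma> * y' - \<sigma> * y) = ?h t"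
    using w by (simp add: y'_def field_simps)
  moreover have "0 < ?h t" using e(2)[OF t(1,2)] by (simp only: h0 add_0_left)
  ultimately show False by linarith
qed

text \<open>The bad directions form a compact subset of the chart \<open>y vp + vm\<close> which is invariant under both
  flows. At its endpoints both vector fields point inwards; since their sum expands the chart, the
  set is \<open>{vm}\<close>, but \<open>vm\<close> is not invariant.\<close>

lemma good_all:
  assumes "x \<noteq> 0"
  shows "good x"
proof -
  define K where "K = {y. \<not> good (y *\<^sub>R vp + vm)}"
  have "open ((\<lambda>y. y *\<^sub>R vp + vm) -` {x. good x})"
    by (rule open_vimage[OF open_good]) (intro continuous_intros)
  moreover have "(\<lambda>y. y *\<^sub>R vp + vm) -` {x. good x} = - K" by (auto simp: K_def)
  ultimately have "closed K" by (simp add: closed_def)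
  have "open ((\<lambda>t. vp + t *\<^sub>R vm) -` {x. good x})"
    by (rule open_vimage[OF open_good]) (intro continuous_intros)
  moreover have "0 \<in> (\<lambda>t. vp + t *\<^sub>R vm) -` {x. good x}" using good_vp by simp
  ultimately obtain d where d': "0 < d" "ball 0 d \<subseteq> (\<lambda>t. vp + t *\<^sub>R vm) -` {x. good x}"
    by (rule openE)
  have d: "0 < d" "\<And>t. \<bar>t\<bar> < d \<Longrightarrow> good (vp + t *\<^sub>R vm)"
  proof -
    show "good (vp + t *\<^sub>R vm)" if "\<bar>t\<bar> < d" for t
    proof -
      have "t \<in> ball 0 d" using that by (simp add: dist_real_def)
      then show ?thesis using d'(2) by blast
    qed
  qed (rule d'(1))
  \<comment> \<open>For large \<open>y\<close> the direction is that of
    \<open>vp + (1 / y) vm\<close>, hence close to the good direction \<open>vp\<close>.\<close>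
  have "\<bar>y\<bar> \<le> 1 / d" if "y \<in> K" for y
  proof (rule ccontr)
    assume "\<not> \<bar>y\<bar> \<le> 1 / d"
    then have y: "1 / d < \<bar>y\<bar>" by simp
    then have "y \<noteq> 0" using d(1) by (auto simp: field_simps)
    have "\<bar>1 / y\<bar> < d" using y d(1) \<open>y \<noteq> 0\<close> by (simp add: field_simps)
    then have "good (y *\<^sub>R (vp + (1 / y) *\<^sub>R vm))" using d(2) \<open>y \<noteq> 0\<close> by (intro good_scale) auto
    then show False using that \<open>y \<noteq> 0\<close> by (simp add: K_def scaleR_add_right)
  qed
  then have "bounded K" unfolding bounded_iff by auto
  with \<open>closed K\<close> have comp: "compact K" by (simp add: compact_eq_bounded_closed)
  have "K = {}"
  proof (rule ccontr)
    assume ne: "K \<noteq> {}"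
    obtain y1 where y1: "y1 \<in> K" "\<And>y. y \<in> K \<Longrightarrow> y \<le> y1" using compact_attains_sup[OF comp ne] by blast
    obtain y0 where y0: "y0 \<in> K" "\<And>y. y \<in> K \<Longrightarrow> y0 \<le> y" using compact_attains_inf[OF comp ne] by blast
    have hi: "bu \<bullet> (a i *v (y1 *\<^sub>R vp + vm)) - y1 * (bw \<bullet> (a i *v (y1 *\<^sub>R vp + vm))) \<le> 0" for i
      using extremal_bad_point[of y1 1 i] y1 by (auto simp: K_def)
    have lo: "0 \<le> bu \<bullet> (a i *v (y0 *\<^sub>R vp + vm)) - y0 * (bw \<bullet> (a i *v (y0 *\<^sub>R vp + vm)))" for i
      using extremal_bad_point[of y0 "-1" i] y0 by (auto simp: K_def)
    have S: "a 0 *v (y *\<^sub>R vp + vm) + a 1 *v (y *\<^sub>R vp + vm) = (y * p) *\<^sub>R vp - m *\<^sub>R vm" for y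
    proof -
      have "a 0 *v (y *\<^sub>R vp + vm) + a 1 *v (y *\<^sub>R vp + vm)
        = y *\<^sub>R (a 0 *v vp + a 1 *v vp) + (a 0 *v vm + a 1 *v vm)"
        by (simp add: matrix_vector_right_distrib matrix_vector_mult_scaleR algebra_simps)
      then show ?thesis unfolding sum_vp sum_vm by simp
    qed
    have u: "bu \<bullet> (a 0 *v (y *\<^sub>R vp + vm)) + bu \<bullet> (a 1 *v (y *\<^sub>R vp + vm)) = y * p"
      and w: "bw \<bullet> (a 0 *v (y *\<^sub>R vp + vm)) + bw \<bullet> (a 1 *v (y *\<^sub>R vp + vm)) = - m" for y
      unfolding inner_add_right[symmetric] S by (simp_all add: inner_diff_right dual)
    \<comment> \<open>Adding the inward conditions of both flows leaves the field of
      \<open>a 0 + a 1\<close>, which in the chart is \<open>y (p + m)\<close> and points away from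
      0. So the upper endpoint is at most 0, the lower one at least 0, and both coincide with
      \<open>vm\<close>, which \<open>a 0\<close> would then have to fix.\<close>
    have "y1 * p + y1 * m \<le> 0"
      using hi[of 0] hi[of 1] u[of y1] arg_cong[OF w[of y1], of "\<lambda>z. y1 * z"] by (simp add: distrib_left)
    then have "y1 * (p + m) \<le> 0" by (simp add: distrib_left)
    then have "y1 \<le> 0" using p_pos m_pos by (simp add: mult_le_0_iff)
    have "0 \<le> y0 * p + y0 * m"
      using lo[of 0] lo[of 1] u[of y0] arg_cong[OF w[of y0], of "\<lambda>z. y0 * z"] by (simp add: distrib_left)
    then have "0 \<le> y0 * (p + m)" by (simp add: distrib_left)
    then have "0 \<le> y0" using p_pos m_pos by (simp add: zero_le_mult_iff)
    have "y0 = 0" "y1 = 0" using \<open>y1 \<le> 0\<close> \<open>0 \<le> y0\<close> y0(2)[OF y1(1)] by auto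
    then show False using hi[of 0] lo[of 0] ne_vm by simp
  qed
  then have chart: "good (y *\<^sub>R vp + vm)" for y by (auto simp: K_def)
  show ?thesis
  proof (cases "bw \<bullet> x = 0")
    case True
    then have "x = (bu \<bullet> x) *\<^sub>R vp" using expand[of x] by simp
    then show ?thesis using good_scale[OF good_vp, of "bu \<bullet> x"] assms by (metis scaleR_zero_left)
  next
    case False
    have "x = (bw \<bullet> x) *\<^sub>R (((bu \<bullet> x) / (bw \<bullet> x)) *\<^sub>R vp + vm)"
      using False by (subst expand[of x]) (simp add: scaleR_add_right)
    then show ?thesis using good_scale[OF chart False] by metis
  qed
qed

text \<open>A finite subcover of the unit circle yields a smallest \<open>\<eta>\<close> and a
  largest \<open>k\<close>, but no common \<open>k\<close>: a minorization after \<open>k\<close>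
  steps need not persist with the same form after more steps. Hence only some
  \<open>k \<le> M\<close> is claimed for each pair of point and function.\<close>

lemma uniform_minorization:
  "\<exists>M \<eta>. 0 < \<eta> \<and> (\<forall>x f. x \<noteq> 0 \<longrightarrow> proj_fun f \<longrightarrow> (\<forall>x. x \<noteq> 0 \<longrightarrow> 0 \<le> f x) \<longrightarrow> (\<exists>k\<le>M. \<eta> * \<phi> f \<le> (Q ^^ k) f x))"
proof -
  let ?P = "\<lambda>U k \<eta>. \<forall>y\<in>U. \<forall>f. proj_fun f \<longrightarrow> (\<forall>x. x \<noteq> 0 \<longrightarrow> 0 \<le> f x) \<longrightarrow> \<eta> * \<phi> f \<le> (Q ^^ k) f y"
  have "\<forall>x\<in>sphere 0 1. \<exists>U k \<eta>. open U \<and> x \<in> U \<and> 0 < \<eta> \<and> ?P U k \<eta>"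
  proof
    fix x :: "real^2" assume "x \<in> sphere 0 1"
    then have "x \<noteq> 0" by auto
    from good_all[OF this] show "\<exists>U k \<eta>. open U \<and> x \<in> U \<and> 0 < \<eta> \<and> ?P U k \<eta>" unfolding good_def by blast
  qed
  then obtain U k \<eta> where U: "\<And>x. x \<in> sphere 0 1 \<Longrightarrow> open (U x) \<and> x \<in> U x \<and> 0 < \<eta> x \<and> ?P (U x) (k x) (\<eta> x)"
    by metis
  have "compact (sphere (0::real^2) 1)" by simp
  then obtain D where D: "D \<subseteq> sphere 0 1" "finite D" "sphere 0 1 \<subseteq> (\<Union>x\<in>D. U x)"
    by (rule compactE_image[of _ "sphere 0 1" U]) (use U in auto)
  have "\<exists>M e. 0 < e \<and> (\<forall>x\<in>D. k x \<le> (M::nat) \<and> e \<le> (\<eta> x::real))"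
    using D(2,1)
  proof (induction D rule: finite_induct)
    case empty
    show ?case by (intro exI[of _ 0] exI[of _ 1]) auto
  next
    case (insert x D)
    then obtain M e where "0 < e" "\<forall>x\<in>D. k x \<le> M \<and> e \<le> \<eta> x" by auto
    then show ?case using U[of x] insert.prems
      by (intro exI[of _ "max M (k x)"] exI[of _ "min e (\<eta> x)"]) (auto simp: max_def min_def)
  qed
  then obtain M e where Me: "0 < e" "\<And>x. x \<in> D \<Longrightarrow> k x \<le> M \<and> e \<le> \<eta> x" by blast
  show ?thesis
  proof (rule exI[of _ M], rule exI[of _ e], intro conjI allI impI Me(1))
    fix x :: "real^2" and f assume x: "x \<noteq> 0" and f: "proj_fun f" "\<forall>x. x \<noteq> 0 \<longrightarrow> 0 \<le> f x"
    let ?y = "(1 / norm x) *\<^sub>R x"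
    have "?y \<in> sphere 0 1" using x by simp
    then obtain z where z: "z \<in> D" "?y \<in> U z" using D(3) by blast
    have \<phi>: "0 \<le> \<phi> f"
      unfolding late_mean_def using f(2) vp_ne by (intro integral_nonneg_AE) auto
    have "e * \<phi> f \<le> \<eta> z * \<phi> f" using Me(2)[OF z(1)] \<phi> by (intro mult_right_mono) auto
    also have "\<dots> \<le> (Q ^^ k z) f ?y" using U[of z] z D(1) f by blast
    also have "\<dots> = (Q ^^ k z) f x" using x by (intro proj_fun_scale[OF markov_opD(1)[OF Qm f(1)]]) auto
    finally show "\<exists>k\<le>M. e * \<phi> f \<le> (Q ^^ k) f x" using Me(2)[OF z(1)] by blast
  qed
qed

text \<open>For a nonnegative function the average of the first powers dominates any single one up
  to the factor \<open>1 / (M + 1)\<close>, so it is bounded below by \<open>\<delta> \<phi>\<close>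
  at every point. Applied to \<open>f - \<alpha>\<close> and \<open>\<beta> - f\<close>, this
  shrinks the range of values.\<close>

lemma poisson_Q:
  assumes q: "proj_fun q"
  shows "\<exists>c f. proj_fun f \<and> (\<forall>x. x \<noteq> 0 \<longrightarrow> f x - Q f x = q x - c)"
proof -
  obtain M \<eta> where \<eta>: "0 < \<eta>"
    and minor: "\<And>x f. x \<noteq> 0 \<Longrightarrow> proj_fun f \<Longrightarrow> (\<And>x. x \<noteq> 0 \<Longrightarrow> 0 \<le> f x) \<Longrightarrow> \<exists>k\<le>M. \<eta> * \<phi> f \<le> (Q ^^ k) f x"
    using uniform_minorization by blast
  let ?K = "\<lambda>f x. (\<Sum>k\<le>M. (Q ^^ k) f x) / real (Suc M)"
  have K: "markov_op ?K" by (rule markov_op_average[OF markov_op_Q])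
  define \<delta> where "\<delta> = \<eta> / real (Suc M)"
  have \<delta>0: "0 < \<delta>" using \<eta> by (simp add: \<delta>_def)
  have Kge: "\<delta> * \<phi> f \<le> ?K f x" if x: "x \<noteq> 0" and f: "proj_fun f" "\<And>x. x \<noteq> 0 \<Longrightarrow> 0 \<le> f x" for f x
  proof -
    obtain k where k: "k \<le> M" "\<eta> * \<phi> f \<le> (Q ^^ k) f x" using minor[OF x f] by blast
    have "(Q ^^ k) f x \<le> (\<Sum>k\<le>M. (Q ^^ k) f x)"
      using k(1) markov_opD(5)[OF Qm f x] by (intro member_le_sum) auto
    then have "\<eta> * \<phi> f / real (Suc M) \<le> ?K f x" using k(2) by (intro divide_right_mono) auto
    then show ?thesis by (simp add: \<delta>_def)
  qed
  let ?\<kappa> = "\<phi> (\<lambda>_. 1)"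
  have \<kappa>: "0 < ?\<kappa>" by (rule late_mean_one_pos)
  have K1: "\<delta> * ?\<kappa> \<le> 1"
    using Kge[OF vp_ne, of "\<lambda>_. 1"] markov_opD(4)[OF K, of 1] by (simp add: fun_eq_iff)
  show ?thesis
  proof (rule poisson_of_average_contraction[OF markov_op_Q q, of "1 - \<delta> * ?\<kappa> / 2" M])
    show "0 \<le> 1 - \<delta> * ?\<kappa> / 2" "1 - \<delta> * ?\<kappa> / 2 < 1" using K1 \<delta>0 \<kappa> by auto
    fix f \<alpha> \<beta> assume f: "proj_fun f" and b: "\<And>x. x \<noteq> 0 \<Longrightarrow> \<alpha> \<le> f x \<and> f x \<le> \<beta>"
    have Kf: "\<alpha> \<le> ?K f x" "?K f x \<le> \<beta>" if "x \<noteq> 0" for x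
      using markov_op_bounds[OF K f that] b by blast+
    have A: "\<delta> * (\<phi> f - \<alpha> * ?\<kappa>) \<le> ?K f x - \<alpha>" if "x \<noteq> 0" for x
    proof -
      have g: "proj_fun (\<lambda>x. f x - \<alpha>)" by (intro proj_fun_diff f proj_fun_const)
      have "?K (\<lambda>x. f x - \<alpha>) x = ?K f x - \<alpha>"
        using markov_op_diff[OF K f proj_fun_const, of \<alpha>] markov_opD(4)[OF K, of \<alpha>] by (simp add: fun_eq_iff)
      then show ?thesis using Kge[OF that g] b late_mean_diff_const[OF f, of "a 0" vp \<alpha>] by auto
    qed
    have B: "\<delta> * (\<beta> * ?\<kappa> - \<phi> f) \<le> \<beta> - ?K f x" if "x \<noteq> 0" for x
    proof -
      have g: "proj_fun (\<lambda>x. \<beta> - f x)" by (intro proj_fun_diff f proj_fun_const)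
      have "?K (\<lambda>x. \<beta> - f x) x = \<beta> - ?K f x"
        using markov_op_diff[OF K proj_fun_const f, of \<beta>] markov_opD(4)[OF K, of \<beta>] by (simp add: fun_eq_iff)
      moreover have "\<phi> (\<lambda>x. \<beta> - f x) = \<beta> * ?\<kappa> - \<phi> f"
        unfolding late_mean_def
        using integrable_late_mean[OF f, of "a 0" vp] integrable_late_mean[of "\<lambda>_. 1" "a 0" vp]
        by (simp add: right_diff_distrib mult.commute[of _ \<beta>])
      ultimately show ?thesis using Kge[OF that g] b by auto
    qed
    show "\<exists>a' b'. (\<forall>x. x \<noteq> 0 \<longrightarrow> a' \<le> ?K f x \<and> ?K f x \<le> b') \<and> b' - a' \<le> (1 - \<delta> * ?\<kappa> / 2) * (\<beta> - \<alpha>)"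
    \<comment> \<open>Compare \<open>\<phi> f\<close> with its value on the constant midpoint. On
      one side the lower bound rises, on the other the upper bound falls, in either case by
      \<open>\<delta> ?\<kappa> (\<beta> - \<alpha>) / 2\<close>.\<close>
    proof (cases "?\<kappa> * (\<alpha> + \<beta>) / 2 \<le> \<phi> f")
      case True
      then have "\<delta> * (?\<kappa> * (\<alpha> + \<beta>) / 2 - \<alpha> * ?\<kappa>) \<le> \<delta> * (\<phi> f - \<alpha> * ?\<kappa>)" using \<delta>0 by simp
      then have "\<alpha> + \<delta> * (?\<kappa> * (\<alpha> + \<beta>) / 2 - \<alpha> * ?\<kappa>) \<le> ?K f x" if "x \<noteq> 0" for x
        using A[OF that] by linarith
      then show ?thesis using Kf(2)
        by (intro exI[of _ "\<alpha> + \<delta> * (?\<kappa> * (\<alpha> + \<beta>) / 2 - \<alpha> * ?\<kappa>)"] exI[of _ \<beta>]) (auto simp: field_simps)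
    next
      case False
      then have "\<delta> * (\<beta> * ?\<kappa> - ?\<kappa> * (\<alpha> + \<beta>) / 2) \<le> \<delta> * (\<beta> * ?\<kappa> - \<phi> f)" using \<delta>0 by simp
      then have "?K f x \<le> \<beta> - \<delta> * (\<beta> * ?\<kappa> - ?\<kappa> * (\<alpha> + \<beta>) / 2)" if "x \<noteq> 0" for x
        using B[OF that] by linarith
      then show ?thesis using Kf(1)
        by (intro exI[of _ \<alpha>] exI[of _ "\<beta> - \<delta> * (\<beta> * ?\<kappa> - ?\<kappa> * (\<alpha> + \<beta>) / 2)"]) (auto simp: field_simps)
    qed
  qed
qed

end

section \<open>Geometric sums of exponential times\<close>

lemma exp_law_moment: "integrable exp_law (\<lambda>s. s ^ i)" "(\<integral>s. s ^ i \<partial>exp_law) = fact i"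
proof -
  interpret prob_space exp_law by (rule prob_space_exp_law)
  have D: "distributed exp_law lborel (\<lambda>x. x) (exponential_density 1)"
    unfolding distributed_def by (auto simp: distr_id2[of lborel, simplified] intro!: distr_id2)
  show "integrable exp_law (\<lambda>s. s ^ i)" by (rule erlang_ith_moment_integrable[OF _ D]) simp
  show "(\<integral>s. s ^ i \<partial>exp_law) = fact i" using erlang_ith_moment[OF _ D, of i] by simp
qed

lemma exp_law_mean: "integrable exp_law (\<lambda>s. s)" "(\<integral>s. s \<partial>exp_law) = 1"
  using exp_law_moment[of 1] by auto

text \<open>An exponential variable with mean 2 is a sum of a geometric number of unit exponential
  variables; its law \<open>\<nu>\<close> therefore satisfies \<open>2 \<nu> = \<mu> + \<nu> * \<mu>\<close> with \<open>\<mu>\<close> = \<^term>\<open>exp_law\<close>.\<close>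

lemma nn_integral_exp_law_double:
  assumes [measurable]: "g \<in> borel_measurable borel"
  shows "2 * (\<integral>\<^sup>+s. g (2 * s) \<partial>exp_law) = (\<integral>\<^sup>+s. g s \<partial>exp_law) + (\<integral>\<^sup>+s. \<integral>\<^sup>+t. g (2 * s + t) \<partial>exp_law \<partial>exp_law)"
proof -
  let ?d = "\<lambda>x. ennreal (exponential_density 1 x)"
  \<comment> \<open>The claim on the level of densities: \<open>2 \<nu>\<close> has density
    \<open>?d (u / 2)\<close>, and the integral is the density of the sum of an independent pair
    with laws \<nu> and \<mu>.\<close>
  have inner: "(\<integral>\<^sup>+s. ?d s * ?d (u - 2 * s) \<partial>lborel) + ?d u = ?d (u / 2)" for u :: real
  proof (cases "0 \<le> u")
    case True
    have "(\<integral>\<^sup>+s. ?d s * ?d (u - 2 * s) \<partial>lborel) = (\<integral>\<^sup>+s. ennreal (exp (s - u)) * indicator {0..u/2} s \<partial>lborel)"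
      by (intro nn_integral_cong)
        (auto split: split_indicator simp: exponential_density_def ennreal_mult[symmetric] exp_add[symmetric])
    also have "\<dots> = ennreal (exp (u / 2 - u) - exp (0 - u))"
      using True by (intro nn_integral_FTC_Icc) (auto intro!: derivative_eq_intros)
    finally have "(\<integral>\<^sup>+s. ?d s * ?d (u - 2 * s) \<partial>lborel) = ennreal (exp (- (u / 2)) - exp (- u))"
      by (simp add: field_simps)
    moreover have "exp (- u) \<le> exp (- (u / 2))" using True by simp
    ultimately show ?thesis
      using True by (simp add: exponential_density_def ennreal_plus[symmetric] del: ennreal_plus)
  next
    case False
    then have z: "?d s * ?d (u - 2 * s) = 0" for s by (auto simp: exponential_density_def)
    show ?thesis unfolding z using False by (simp add: exponential_density_def)
  qed
  have "2 * (\<integral>\<^sup>+s. g (2 * s) \<partial>exp_law) = 2 * (\<integral>\<^sup>+s. ?d s * g (2 * s) \<partial>lborel)"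
    by (subst nn_integral_density) auto
  also have "\<dots> = (\<integral>\<^sup>+u. ?d (u / 2) * g u \<partial>lborel)"
    using nn_integral_real_affine[of "\<lambda>u. ?d (u / 2) * g u" 2 0] by simp
  also have "\<dots> = (\<integral>\<^sup>+u. ?d u * g u + (\<integral>\<^sup>+s. ?d s * ?d (u - 2 * s) \<partial>lborel) * g u \<partial>lborel)"
    unfolding inner[symmetric] by (simp add: distrib_right add.commute)
  also have "\<dots> = (\<integral>\<^sup>+u. ?d u * g u \<partial>lborel) + (\<integral>\<^sup>+u. (\<integral>\<^sup>+s. ?d s * ?d (u - 2 * s) \<partial>lborel) * g u \<partial>lborel)"
    by (rule nn_integral_add) measurable
  also have "(\<integral>\<^sup>+u. ?d u * g u \<partial>lborel) = (\<integral>\<^sup>+s. g s \<partial>exp_law)"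
    by (subst nn_integral_density) auto
  also have "(\<integral>\<^sup>+u. (\<integral>\<^sup>+s. ?d s * ?d (u - 2 * s) \<partial>lborel) * g u \<partial>lborel)
      = (\<integral>\<^sup>+u. \<integral>\<^sup>+s. ?d s * (?d (u - 2 * s) * g u) \<partial>lborel \<partial>lborel)"
    by (subst nn_integral_multc[symmetric]) (auto simp: mult.assoc)
  also have "\<dots> = (\<integral>\<^sup>+s. \<integral>\<^sup>+u. ?d s * (?d (u - 2 * s) * g u) \<partial>lborel \<partial>lborel)"
    by (rule lborel_pair.Fubini') measurable
  also have "\<dots> = (\<integral>\<^sup>+s. ?d s * (\<integral>\<^sup>+t. ?d t * g (2 * s + t) \<partial>lborel) \<partial>lborel)"
  proof (rule nn_integral_cong)
    fix s :: real
    have "(\<integral>\<^sup>+u. ?d (u - 2 * s) * g u \<partial>lborel) = (\<integral>\<^sup>+t. ?d t * g (2 * s + t) \<partial>lborel)"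
      using nn_integral_real_affine[of "\<lambda>u. ?d (u - 2 * s) * g u" 1 "2 * s"] by simp
    then show "(\<integral>\<^sup>+u. ?d s * (?d (u - 2 * s) * g u) \<partial>lborel) = ?d s * (\<integral>\<^sup>+t. ?d t * g (2 * s + t) \<partial>lborel)"
      by (subst nn_integral_cmult) auto
  qed
  also have "\<dots> = (\<integral>\<^sup>+s. \<integral>\<^sup>+t. g (2 * s + t) \<partial>exp_law \<partial>exp_law)"
  proof -
    have "(\<integral>\<^sup>+t. g (2 * s + t) \<partial>exp_law) = (\<integral>\<^sup>+t. ?d t * g (2 * s + t) \<partial>lborel)" for s
      by (subst nn_integral_density) auto
    then show ?thesis by (subst nn_integral_density) auto
  qed
  finally show ?thesis .
qed

text \<open>Integrability over the product follows from the nonnegative identity applied to the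
  absolute value of \<open>g\<close>; the signed identity is then the difference of those for the
  positive and negative parts.\<close>

lemma integral_exp_law_double:
  fixes g :: "real \<Rightarrow> real"
  assumes [measurable]: "g \<in> borel_measurable borel" and B: "\<And>t. 0 \<le> t \<Longrightarrow> \<bar>g t\<bar> \<le> \<alpha> + \<beta> * t"
  shows "2 * (\<integral>s. g (2 * s) \<partial>exp_law) = (\<integral>s. g s \<partial>exp_law) + (\<integral>s. \<integral>t. g (2 * s + t) \<partial>exp_law \<partial>exp_law)"
proof -
  interpret prob_space exp_law by (rule prob_space_exp_law)
  interpret P: pair_prob_space exp_law exp_law ..
  have i1: "integrable exp_law g"
  proof (rule Bochner_Integration.integrable_bound[of _ "\<lambda>t. \<alpha> + \<beta> * t"])
    show "integrable exp_law (\<lambda>t. \<alpha> + \<beta> * t)" using exp_law_mean by simp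
    show "AE s in exp_law. norm (g s) \<le> norm (\<alpha> + \<beta> * s)"
      using AE_exp_law_nonneg
    proof eventually_elim
      case (elim s)
      then show ?case using B[of s] by simp
    qed
  qed simp
  have i2: "integrable exp_law (\<lambda>s. g (2 * s))"
  proof (rule Bochner_Integration.integrable_bound[of _ "\<lambda>t. \<alpha> + \<beta> * (2 * t)"])
    show "integrable exp_law (\<lambda>t. \<alpha> + \<beta> * (2 * t))" using exp_law_mean by simp
    show "AE s in exp_law. norm (g (2 * s)) \<le> norm (\<alpha> + \<beta> * (2 * s))"
      using AE_exp_law_nonneg
    proof eventually_elim
      case (elim s)
      then show ?case using B[of "2 * s"] by (simp add: mult.left_commute)
    qed
  qed simp
  let ?G = "\<lambda>p. g (2 * fst p + snd p)"
  have [measurable]: "?G \<in> borel_measurable (exp_law \<Otimes>\<^sub>M exp_law)" by measurable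
  have nn: "(\<integral>\<^sup>+p. h (2 * fst p + snd p) \<partial>(exp_law \<Otimes>\<^sub>M exp_law)) = (\<integral>\<^sup>+s. \<integral>\<^sup>+t. h (2 * s + t) \<partial>exp_law \<partial>exp_law)"
    if [measurable]: "h \<in> borel_measurable borel" for h :: "real \<Rightarrow> ennreal"
    by (subst nn_integral_fst[symmetric]) auto
  have i3: "integrable (exp_law \<Otimes>\<^sub>M exp_law) ?G"
  proof (rule integrableI_bounded)
    have "(\<integral>\<^sup>+p. ennreal (norm (?G p)) \<partial>(exp_law \<Otimes>\<^sub>M exp_law)) \<le> 2 * (\<integral>\<^sup>+s. ennreal \<bar>g (2 * s)\<bar> \<partial>exp_law)"
      using nn[of "\<lambda>x. ennreal \<bar>g x\<bar>"] nn_integral_exp_law_double[of "\<lambda>x. ennreal \<bar>g x\<bar>"] by (simp del: sets_density)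
    also have "\<dots> < \<infinity>"
      using i2 by (auto simp: integrable_iff_bounded ennreal_mult_less_top)
    finally show "(\<integral>\<^sup>+p. ennreal (norm (?G p)) \<partial>(exp_law \<Otimes>\<^sub>M exp_law)) < \<infinity>" .
  qed simp
  have eq: "2 * (\<integral>\<^sup>+s. ennreal (h (2 * s)) \<partial>exp_law) = (\<integral>\<^sup>+s. ennreal (h s) \<partial>exp_law) + (\<integral>\<^sup>+p. ennreal (h (2 * fst p + snd p)) \<partial>(exp_law \<Otimes>\<^sub>M exp_law))"
    if [measurable]: "h \<in> borel_measurable borel" for h :: "real \<Rightarrow> real"
    using nn_integral_exp_law_double[of "\<lambda>x. ennreal (h x)"] nn[of "\<lambda>x. ennreal (h x)"] by simp
  \<comment> \<open>Since \<open>ennreal\<close> sends negative numbers to 0, the cases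
    \<open>g\<close> and \<open>- g\<close> of this identity are those of the positive and the
    negative part.\<close>
  have fin: "2 * enn2real (\<integral>\<^sup>+s. ennreal (h (2 * s)) \<partial>exp_law) = enn2real (\<integral>\<^sup>+s. ennreal (h s) \<partial>exp_law) + enn2real (\<integral>\<^sup>+p. ennreal (h (2 * fst p + snd p)) \<partial>(exp_law \<Otimes>\<^sub>M exp_law))"
    if h[measurable]: "h \<in> borel_measurable borel" and le: "\<And>x. h x \<le> \<bar>g x\<bar>" for h :: "real \<Rightarrow> real"
  proof -
    have "(\<integral>\<^sup>+s. ennreal (h s) \<partial>exp_law) \<le> (\<integral>\<^sup>+s. ennreal (norm (g s)) \<partial>exp_law)"
      by (intro nn_integral_mono ennreal_leI) (simp add: le)
    also have "\<dots> < \<infinity>" using i1 unfolding integrable_iff_bounded by blast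
    finally have f1: "(\<integral>\<^sup>+s. ennreal (h s) \<partial>exp_law) < top" by simp
    have "(\<integral>\<^sup>+p. ennreal (h (2 * fst p + snd p)) \<partial>(exp_law \<Otimes>\<^sub>M exp_law)) \<le> (\<integral>\<^sup>+p. ennreal (norm (?G p)) \<partial>(exp_law \<Otimes>\<^sub>M exp_law))"
      by (intro nn_integral_mono ennreal_leI) (simp add: le)
    also have "\<dots> < \<infinity>" using i3 unfolding integrable_iff_bounded by blast
    finally have f2: "(\<integral>\<^sup>+p. ennreal (h (2 * fst p + snd p)) \<partial>(exp_law \<Otimes>\<^sub>M exp_law)) < top" by simp
    show ?thesis
      using arg_cong[OF eq[OF h], of enn2real] unfolding enn2real_plus[OF f1 f2] enn2real_mult by simp
  qed
  have "2 * (\<integral>s. g (2 * s) \<partial>exp_law) = (\<integral>s. g s \<partial>exp_law) + integral\<^sup>L (exp_law \<Otimes>\<^sub>M exp_law) ?G"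
    unfolding real_lebesgue_integral_def[OF i1] real_lebesgue_integral_def[OF i2] real_lebesgue_integral_def[OF i3]
    using fin[of g] fin[of "\<lambda>x. - g x"] by (simp add: right_diff_distrib)
  also have "integral\<^sup>L (exp_law \<Otimes>\<^sub>M exp_law) ?G = (\<integral>s. \<integral>t. g (2 * s + t) \<partial>exp_law \<partial>exp_law)"
    using P.integral_fst'[OF i3] by simp
  finally show ?thesis .
qed

section \<open>Potentials with a logarithmic part\<close>

lemma ln_norm_mat_exp_bound:
  fixes M :: "real^'n^'n"
  assumes "x \<noteq> 0" "0 \<le> s"
  shows "\<bar>ln (norm (mat_exp (s *\<^sub>R M) *v x)) - ln (norm x)\<bar> \<le> mnorm M * s"
proof -
  let ?y = "mat_exp (s *\<^sub>R M) *v x"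
  have pos: "0 < norm x" "0 < norm ?y" using assms by auto
  have "ln (norm ?y) \<le> ln (exp (mnorm M * s) * norm x)"
    using mat_exp_norm_bounds(1)[OF assms(2)] pos by (subst ln_le_cancel_iff) auto
  moreover have "ln (exp (- mnorm M * s) * norm x) \<le> ln (norm ?y)"
    using mat_exp_norm_bounds(2)[OF assms(2)] pos by (subst ln_le_cancel_iff) auto
  ultimately show ?thesis using pos by (simp add: ln_mult abs_le_iff)
qed

definition log_growth :: "real^2^2 \<Rightarrow> real^2 \<Rightarrow> real" where
  "log_growth M x = (\<integral>s. ln (norm (mat_exp (s *\<^sub>R M) *v x) / norm x) \<partial>exp_law)"

lemma ln_ratio_bound:
  fixes M :: "real^'n^'n"
  assumes "0 \<le> s"
  shows "\<bar>ln (norm (mat_exp (s *\<^sub>R M) *v x) / norm x)\<bar> \<le> mnorm M * s"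
  using ln_norm_mat_exp_bound[of x s M] assms mnorm_nonneg[of M] by (cases "x = 0") (auto simp: ln_div)

lemma integrable_ln_ratio:
  "integrable exp_law (\<lambda>s. ln (norm (mat_exp (s *\<^sub>R M) *v x) / norm x))" for x :: "real^2"
proof (rule Bochner_Integration.integrable_bound)
  show "integrable exp_law (\<lambda>s. mnorm M * s)" using exp_law_mean by simp
  show "AE s in exp_law. norm (ln (norm (mat_exp (s *\<^sub>R M) *v x) / norm x)) \<le> norm (mnorm M * s)"
    using AE_exp_law_nonneg
  proof eventually_elim
    case (elim s)
    then show ?case using ln_ratio_bound[OF elim, of M x] by simp
  qed
qed simp

lemma proj_fun_log_growth: "proj_fun (log_growth M)"
proof -
  interpret prob_space exp_law by (rule prob_space_exp_law)
  have "\<bar>log_growth M x\<bar> \<le> mnorm M" for x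
  proof -
    have "\<bar>log_growth M x\<bar> \<le> (\<integral>s. \<bar>ln (norm (mat_exp (s *\<^sub>R M) *v x) / norm x)\<bar> \<partial>exp_law)"
      unfolding log_growth_def by (rule integral_abs_bound)
    also have "\<dots> \<le> (\<integral>s. mnorm M * s \<partial>exp_law)"
    proof (rule integral_mono_AE)
      show "AE s in exp_law. \<bar>ln (norm (mat_exp (s *\<^sub>R M) *v x) / norm x)\<bar> \<le> mnorm M * s"
        using AE_exp_law_nonneg by eventually_elim (rule ln_ratio_bound)
    qed (use exp_law_mean integrable_ln_ratio in auto)
    finally show ?thesis using exp_law_mean by simp
  qed
  moreover have "log_growth M \<in> borel_measurable borel"
    unfolding log_growth_def by measurable
  moreover have "log_growth M (c *\<^sub>R x) = log_growth M x" if "c \<noteq> 0" for c x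
    unfolding log_growth_def using that by (simp add: matrix_vector_mult_scaleR)
  ultimately show ?thesis unfolding proj_fun_def by blast
qed

text \<open>The unbounded term \<open>ln (norm x)\<close> is reproduced by the resolvent up to a
  bounded function of the direction. This reduces equations for potentials of this form to equations
  between bounded functions.\<close>

lemma
  assumes f: "proj_fun f" and x: "x \<noteq> 0"
  shows integrable_log_fun: "integrable exp_law (\<lambda>s. ln (norm (mat_exp (s *\<^sub>R M) *v x)) + f (mat_exp (s *\<^sub>R M) *v x))"
    and resolv_log_fun: "resolv M (\<lambda>x. ln (norm x) + f x) x = ln (norm x) + (log_growth M x + resolv M f x)"
proof -
  interpret prob_space exp_law by (rule prob_space_exp_law)
  have eq: "ln (norm (mat_exp (s *\<^sub>R M) *v x)) + f (mat_exp (s *\<^sub>R M) *v x)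
     = ln (norm (mat_exp (s *\<^sub>R M) *v x) / norm x) + ln (norm x) + f (mat_exp (s *\<^sub>R M) *v x)" for s
    using x by (simp add: ln_div)
  show "integrable exp_law (\<lambda>s. ln (norm (mat_exp (s *\<^sub>R M) *v x)) + f (mat_exp (s *\<^sub>R M) *v x))"
    unfolding eq by (intro Bochner_Integration.integrable_add integrable_ln_ratio integrable_resolv[OF f]) simp
  show "resolv M (\<lambda>x. ln (norm x) + f x) x = ln (norm x) + (log_growth M x + resolv M f x)"
    unfolding resolv_def eq log_growth_def using integrable_ln_ratio[of M x] integrable_resolv[OF f, of M x] prob_space
    by simp
qed

lemma log_fun_bound:
  fixes M :: "real^'n^'n"
  assumes f: "\<And>x. \<bar>f x\<bar> \<le> B" and x: "x \<noteq> 0" and s: "0 \<le> s"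
  shows "\<bar>ln (norm (mat_exp (s *\<^sub>R M) *v x)) + f (mat_exp (s *\<^sub>R M) *v x) - ln (norm x)\<bar> \<le> B + mnorm M * s"
  using ln_norm_mat_exp_bound[OF x s, of M] f[of "mat_exp (s *\<^sub>R M) *v x"] by linarith

text \<open>With \<open>D\<close> the derivative along \<open>M x\<close>, this is the formal
  identity \<open>(1 - 2 D)^-1 (2 - (1 - D)^-1) = (1 - D)^-1\<close>. It is proved along a single
  orbit, as the law of geometric sums of exponential times applied to \<open>t\<close> mapped to
  \<open>G\<close> at time \<open>t\<close>.\<close>

lemma resolv_double:
  assumes f: "proj_fun f" and x: "x \<noteq> 0"
  defines "G \<equiv> \<lambda>x. ln (norm x) + f x"
  shows "resolv (2 *\<^sub>R M) (\<lambda>x. 2 * G x - resolv M G x) x = resolv M G x"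
proof -
  note [measurable] = proj_fun_measurable[OF f]
  interpret prob_space exp_law by (rule prob_space_exp_law)
  obtain B where B: "\<And>x. \<bar>f x\<bar> \<le> B" using proj_fun_bounded[OF f] by blast
  let ?g = "\<lambda>t. G (mat_exp (t *\<^sub>R M) *v x)"
  have [measurable]: "?g \<in> borel_measurable borel" unfolding G_def by measurable
  have gb: "\<bar>?g t\<bar> \<le> (\<bar>ln (norm x)\<bar> + B) + mnorm M * t" if "0 \<le> t" for t
    using log_fun_bound[where f = f, OF B x that, of M] unfolding G_def by linarith
  have e: "(s *\<^sub>R (2 *\<^sub>R M)) = (2 * s) *\<^sub>R M" for s by (simp add: mult.commute)
  have R: "resolv M G (mat_exp ((2 * s) *\<^sub>R M) *v x) = (\<integral>t. ?g (2 * s + t) \<partial>exp_law)" for s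
    unfolding resolv_def by (simp add: mat_exp_add add.commute[of "2 * s"])
  have fi: "proj_fun (\<lambda>x. log_growth M x + resolv M f x)"
    by (intro proj_fun_add proj_fun_log_growth markov_opD(1)[OF markov_op_resolv f])
  have i1: "integrable exp_law (\<lambda>s. ?g (2 * s))"
    using integrable_log_fun[OF f x, of "2 *\<^sub>R M"] unfolding e G_def .
  have i2: "integrable exp_law (\<lambda>s. resolv M G (mat_exp ((2 * s) *\<^sub>R M) *v x))"
    using integrable_log_fun[OF fi x, of "2 *\<^sub>R M"] x unfolding e G_def
    by (subst resolv_log_fun[OF f]) auto
  have "resolv (2 *\<^sub>R M) (\<lambda>x. 2 * G x - resolv M G x) x
     = 2 * (\<integral>s. ?g (2 * s) \<partial>exp_law) - (\<integral>s. resolv M G (mat_exp ((2 * s) *\<^sub>R M) *v x) \<partial>exp_law)"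
    unfolding resolv_def[of "2 *\<^sub>R M"] e using i1 i2 by simp
  also have "\<dots> = (\<integral>s. ?g s \<partial>exp_law)"
    unfolding R using integral_exp_law_double[OF _ gb] by simp
  finally show ?thesis by (simp add: resolv_def)
qed

context flow_pair
begin

lemma lyapunov_potential:
  "\<exists>c f. proj_fun f \<and> (\<forall>x. x \<noteq> 0 \<longrightarrow>
     (resolv (a 0) (\<lambda>x. ln (norm x) + f x) x + resolv (a 1) (\<lambda>x. ln (norm x) + f x) x) / 2 = ln (norm x) + f x + c)"
proof -
  let ?q = "\<lambda>x. 1/2 * (log_growth (a 0) x + log_growth (a 1) x)"
  have "proj_fun ?q" by (intro proj_fun_cmult proj_fun_add proj_fun_log_growth)
  from poisson_Q[OF this] obtain c f where f: "proj_fun f" "\<And>x. x \<noteq> 0 \<Longrightarrow> f x - Q f x = ?q x - c" by blast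
  show ?thesis
  proof (intro exI[of _ c] exI[of _ f] conjI f(1) allI impI)
    fix x :: "real^2" assume x: "x \<noteq> 0"
    show "(resolv (a 0) (\<lambda>x. ln (norm x) + f x) x + resolv (a 1) (\<lambda>x. ln (norm x) + f x) x) / 2 = ln (norm x) + f x + c"
      using f(2)[OF x] unfolding resolv_log_fun[OF f(1) x] Q_def by (simp add: field_simps)
  qed
qed

text \<open>Put \<open>G_i = R_i G\<close>. The mixture equation reads
  \<open>G_0 + G_1 = 2 G + 2 c\<close>, so \<open>G_(1-i) = 2 G - G_i + 2 c\<close>; the resolvent
  of \<open>2 a i\<close>, the flow with half the rate, sends \<open>2 G - G_i\<close> to
  \<open>G_i\<close> and keeps the constant.\<close>

lemma alternating_potential:
  assumes f: "proj_fun f"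
    and eq: "\<And>x. x \<noteq> 0 \<Longrightarrow>
     (resolv (a 0) (\<lambda>x. ln (norm x) + f x) x + resolv (a 1) (\<lambda>x. ln (norm x) + f x) x) / 2 = ln (norm x) + f x + c"
  shows "\<exists>g. (\<forall>i. proj_fun (g i)) \<and>
     (\<forall>i x. x \<noteq> 0 \<longrightarrow> resolv (2 *\<^sub>R a i) (\<lambda>x. ln (norm x) + g (1 - i) x) x = ln (norm x) + g i x + 2 * c)"
proof -
  let ?G = "\<lambda>x. ln (norm x) + f x"
  let ?g = "\<lambda>i x. log_growth (a i) x + resolv (a i) f x"
  have g: "proj_fun (?g i)" for i
    by (intro proj_fun_add proj_fun_log_growth markov_opD(1)[OF markov_op_resolv f])
  have Gi: "ln (norm x) + ?g i x = resolv (a i) ?G x" if "x \<noteq> 0" for i x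
    by (rule resolv_log_fun[OF f that, symmetric])
  have other: "ln (norm x) + ?g (1 - i) x = 2 * ?G x - resolv (a i) ?G x + 2 * c" if "x \<noteq> 0" for i x
    using eq[OF that] two_cases[of i] unfolding Gi[OF that] by auto
  have "resolv (2 *\<^sub>R a i) (\<lambda>x. ln (norm x) + ?g (1 - i) x) x = ln (norm x) + ?g i x + 2 * c" if x: "x \<noteq> 0" for i x
  proof -
    interpret prob_space exp_law by (rule prob_space_exp_law)
    have i: "integrable exp_law (\<lambda>s. 2 * ?G (mat_exp (s *\<^sub>R 2 *\<^sub>R a i) *v x) - resolv (a i) ?G (mat_exp (s *\<^sub>R 2 *\<^sub>R a i) *v x))"
    proof -
      have "2 * ?G y - resolv (a i) ?G y = ln (norm y) + (2 * f y - ?g i y)" if "y \<noteq> 0" for y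
        using Gi[OF that, of i] by simp
      moreover have "proj_fun (\<lambda>y. 2 * f y - ?g i y)" by (intro proj_fun_diff proj_fun_cmult f g)
      ultimately show ?thesis using integrable_log_fun[of "\<lambda>y. 2 * f y - ?g i y" x "2 *\<^sub>R a i"] x by (simp only: mat_exp_vec_eq_0 not_False_eq_True)
    qed
    have "resolv (2 *\<^sub>R a i) (\<lambda>x. ln (norm x) + ?g (1 - i) x) x = resolv (2 *\<^sub>R a i) (\<lambda>x. (2 * ?G x - resolv (a i) ?G x) + 2 * c) x"
      unfolding resolv_def[of "2 *\<^sub>R a i"] by (intro Bochner_Integration.integral_cong refl other) (use x in simp)
    also have "\<dots> = resolv (2 *\<^sub>R a i) (\<lambda>x. 2 * ?G x - resolv (a i) ?G x) x + 2 * c"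
      unfolding resolv_def[of "2 *\<^sub>R a i"] using i prob_space by simp
    also have "\<dots> = ln (norm x) + ?g i x + 2 * c"
      unfolding resolv_double[OF f x] Gi[OF x] ..
    finally show ?thesis .
  qed
  then show ?thesis using g by (intro exI[of _ ?g]) blast
qed

end

section \<open>Random products\<close>

lemma growth_rate_of_increments:
  fixes L G :: "nat \<Rightarrow> real"
  assumes lim: "(\<lambda>n. (\<Sum>k<n. G (Suc k) - G k - c) / real n) \<longlonglongrightarrow> 0"
    and bd: "\<And>n. \<bar>G n - L n\<bar> \<le> B"
  shows "(\<lambda>n. L n / real n) \<longlonglongrightarrow> c"
proof -
  have z: "(\<lambda>n. b / real n) \<longlonglongrightarrow> 0" for b
    by (rule lim_const_over_n)
  have "(\<lambda>n. (L n - G n + G 0) / real n) \<longlonglongrightarrow> 0"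
  proof (rule Lim_null_comparison[OF _ z[of "B + \<bar>G 0\<bar>"]])
    have "\<bar>L n - G n + G 0\<bar> \<le> B + \<bar>G 0\<bar>" for n using bd[of n] by linarith
    then show "\<forall>\<^sub>F n in sequentially. norm ((L n - G n + G 0) / real n) \<le> (B + \<bar>G 0\<bar>) / real n"
      by (intro always_eventually allI) (simp add: divide_right_mono)
  qed
  then have "(\<lambda>n. (\<Sum>k<n. G (Suc k) - G k - c) / real n + (L n - G n + G 0) / real n + c) \<longlonglongrightarrow> 0 + 0 + c"
    by (intro tendsto_add lim tendsto_const)
  moreover have "(\<Sum>k<n. G (Suc k) - G k - c) = G n - G 0 - real n * c" for n
    by (induction n) (auto simp: algebra_simps)
  ultimately have "(\<lambda>n. (G n - G 0 - real n * c) / real n + (L n - G n + G 0) / real n + c) \<longlonglongrightarrow> c" by simp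
  then show ?thesis
  proof (rule Lim_transform_eventually)
    show "\<forall>\<^sub>F n in sequentially. (G n - G 0 - real n * c) / real n + (L n - G n + G 0) / real n + c = L n / real n"
      using eventually_gt_at_top[of 0] by eventually_elim (simp add: field_simps)
  qed
qed

lemma borel_measurable_matrix_vector [measurable (raw)]:
  assumes f: "f \<in> borel_measurable N" and g: "g \<in> borel_measurable N"
  shows "(\<lambda>x. (f x :: real^2^2) *v g x) \<in> borel_measurable N"
proof -
  have "continuous_on UNIV (\<lambda>p :: (real^2^2) \<times> (real^2). fst p *v snd p)"
    unfolding matrix_vector_mult_def by (intro continuous_on_vec_lambda continuous_on_sum continuous_on_mult continuous_intros)
  then have "(\<lambda>p :: (real^2^2) \<times> (real^2). fst p *v snd p) \<in> borel_measurable (borel \<Otimes>\<^sub>M borel)"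
    unfolding borel_prod by (rule borel_measurable_continuous_onI)
  from measurable_compose[OF measurable_Pair[OF f g] this] show ?thesis by simp
qed

lemma det_mat_exp: "det (mat_exp (s *\<^sub>R M)) \<noteq> 0"
proof -
  have "\<forall>x. mat_exp (s *\<^sub>R M) *v x = 0 \<longrightarrow> x = 0" by simp
  then have "\<exists>B. B ** mat_exp (s *\<^sub>R M) = mat 1" using matrix_left_invertible_ker by blast
  then have "invertible (mat_exp (s *\<^sub>R M))" by (simp add: invertible_left_inverse)
  then show ?thesis by (simp add: invertible_det_nz)
qed

lemma measurable_mat_exp_curve [measurable (raw)]:
  assumes f: "f \<in> borel_measurable N"
  shows "(\<lambda>x. mat_exp (f x *\<^sub>R M)) \<in> borel_measurable N"
  using measurable_compose[OF f borel_measurable_continuous_onI[OF continuous_mat_exp[of M]]] by simp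

text \<open>The law of one factor is realised on the product of a fair coin and \<^term>\<open>exp_law\<close>.\<close>

definition mixture_map :: "(2 \<Rightarrow> real^2^2) \<Rightarrow> bool \<times> real \<Rightarrow> real^2^2" where
  "mixture_map a p = (if fst p then mat_exp (snd p *\<^sub>R a 0) else mat_exp (snd p *\<^sub>R a 1))"

abbreviation coin_exp :: "(bool \<times> real) measure" where
  "coin_exp \<equiv> measure_pmf (bernoulli_pmf (1/2)) \<Otimes>\<^sub>M exp_law"

lemma measurable_mixture_map [measurable]: "mixture_map a \<in> borel_measurable coin_exp"
proof -
  have [measurable]: "Measurable.pred coin_exp fst"
    by (rule measurable_compose[OF measurable_fst]) simp
  show ?thesis unfolding mixture_map_def by measurable
qed

lemma nn_integral_coin_exp:
  assumes [measurable]: "h \<in> borel_measurable borel"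
  shows "(\<integral>\<^sup>+p. h (mixture_map a p) \<partial>coin_exp)
    = (\<integral>\<^sup>+s. h (mat_exp (s *\<^sub>R a 0)) \<partial>exp_law) * ennreal (1/2) + (\<integral>\<^sup>+s. h (mat_exp (s *\<^sub>R a 1)) \<partial>exp_law) * ennreal (1/2)"
proof -
  interpret prob_space exp_law by (rule prob_space_exp_law)
  have "(\<integral>\<^sup>+p. h (mixture_map a p) \<partial>coin_exp)
     = (\<integral>\<^sup>+b. \<integral>\<^sup>+s. h (mixture_map a (b, s)) \<partial>exp_law \<partial>measure_pmf (bernoulli_pmf (1/2)))"
    by (subst nn_integral_fst[symmetric]) auto
  then show ?thesis by (simp add: mixture_map_def)
qed

lemma emeasure_distr_nn_integral:
  assumes f: "f \<in> M \<rightarrow>\<^sub>M N" and B: "B \<in> sets N"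
  shows "emeasure (distr M N f) B = (\<integral>\<^sup>+x. indicator B (f x) \<partial>M)"
proof -
  have "emeasure (distr M N f) B = (\<integral>\<^sup>+x. indicator B x \<partial>distr M N f)" using B by simp
  also have "\<dots> = (\<integral>\<^sup>+x. indicator B (f x) \<partial>M)" by (rule nn_integral_distr[OF f]) (use B in simp)
  finally show ?thesis .
qed

lemma distr_mixture:
  assumes M: "prob_space M" and W[measurable]: "W \<in> borel_measurable M"
    and law: "\<And>B. B \<in> sets borel \<Longrightarrow> measure (distr M borel W) B =
      (1/2) * measure (distr exp_law borel (\<lambda>s. mat_exp (s *\<^sub>R a 0))) B +
      (1/2) * measure (distr exp_law borel (\<lambda>s. mat_exp (s *\<^sub>R a 1))) B"
  shows "distr M borel W = distr coin_exp borel (mixture_map a)"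
proof (rule measure_eqI)
  fix B assume "B \<in> sets (distr M borel W)"
  then have B[measurable]: "B \<in> sets borel" by simp
  interpret M: prob_space M by (rule M)
  interpret L: prob_space "distr M borel W" by (rule M.prob_space_distr) simp
  interpret E: prob_space exp_law by (rule prob_space_exp_law)
  interpret E0: prob_space "distr exp_law borel (\<lambda>s. mat_exp (s *\<^sub>R a 0))" by (rule E.prob_space_distr) simp
  interpret E1: prob_space "distr exp_law borel (\<lambda>s. mat_exp (s *\<^sub>R a 1))" by (rule E.prob_space_distr) simp
  have "emeasure (distr coin_exp borel (mixture_map a)) B = (\<integral>\<^sup>+p. indicator B (mixture_map a p) \<partial>coin_exp)"
    by (rule emeasure_distr_nn_integral) simp_all
  also have "\<dots> = emeasure (distr exp_law borel (\<lambda>s. mat_exp (s *\<^sub>R a 0))) B * ennreal (1/2)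
       + emeasure (distr exp_law borel (\<lambda>s. mat_exp (s *\<^sub>R a 1))) B * ennreal (1/2)"
  proof -
    have "emeasure (distr exp_law borel (\<lambda>s. mat_exp (s *\<^sub>R a i))) B = (\<integral>\<^sup>+s. indicator B (mat_exp (s *\<^sub>R a i)) \<partial>exp_law)" for i
      by (rule emeasure_distr_nn_integral) simp_all
    then show ?thesis by (subst nn_integral_coin_exp) auto
  qed
  also have "\<dots> = emeasure (distr M borel W) B"
  proof -
    have h: "ennreal x * ennreal (1/2) = ennreal ((1/2) * x)" if "0 \<le> x" for x
      using that by (subst ennreal_mult[symmetric]) (auto simp: mult.commute)
    show ?thesis
      unfolding L.emeasure_eq_measure law[OF B] E0.emeasure_eq_measure E1.emeasure_eq_measure
      by (subst (1 2) h, simp, simp, rule ennreal_plus[symmetric]) auto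
  qed
  finally show "emeasure (distr M borel W) B = emeasure (distr coin_exp borel (mixture_map a)) B" ..
qed simp

lemma (in prob_space)
  fixes h :: "real^2^2 \<Rightarrow> real"
  assumes W[measurable]: "W \<in> borel_measurable M"
    and D: "distr M borel W = distr coin_exp borel (mixture_map a)"
    and h[measurable]: "h \<in> borel_measurable borel"
    and i: "integrable exp_law (\<lambda>s. h (mat_exp (s *\<^sub>R a 0)))" "integrable exp_law (\<lambda>s. h (mat_exp (s *\<^sub>R a 1)))"
  shows integrable_mixture: "integrable M (\<lambda>\<omega>. h (W \<omega>))"
    and integral_mixture: "(\<integral>\<omega>. h (W \<omega>) \<partial>M) = ((\<integral>s. h (mat_exp (s *\<^sub>R a 0)) \<partial>exp_law) + (\<integral>s. h (mat_exp (s *\<^sub>R a 1)) \<partial>exp_law)) / 2"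
proof -
  interpret E: prob_space exp_law by (rule prob_space_exp_law)
  interpret P: pair_prob_space "measure_pmf (bernoulli_pmf (1/2))" exp_law ..
  have K: "integrable coin_exp (\<lambda>p. h (mixture_map a p))"
  proof (rule integrableI_bounded)
    show "(\<integral>\<^sup>+p. ennreal (norm (h (mixture_map a p))) \<partial>coin_exp) < \<infinity>"
      using i ennreal_less_top[of "1/2"] nn_integral_coin_exp[of "\<lambda>x. ennreal (norm (h x))" a]
      by (auto simp: integrable_iff_bounded ennreal_mult_less_top)
  qed simp
  have "integrable (distr M borel W) h" unfolding D using K by (subst integrable_distr_eq) auto
  then show "integrable M (\<lambda>\<omega>. h (W \<omega>))" by (subst (asm) integrable_distr_eq) auto
  have "(\<integral>\<omega>. h (W \<omega>) \<partial>M) = (\<integral>x. h x \<partial>distr M borel W)" by (subst integral_distr) auto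
  also have "\<dots> = (\<integral>p. h (mixture_map a p) \<partial>coin_exp)" unfolding D by (subst integral_distr) auto
  also have "\<dots> = (\<integral>b. \<integral>s. h (mixture_map a (b, s)) \<partial>exp_law \<partial>measure_pmf (bernoulli_pmf (1/2)))"
    using P.integral_fst'[OF K] by simp
  also have "\<dots> = ((\<integral>s. h (mat_exp (s *\<^sub>R a 0)) \<partial>exp_law) + (\<integral>s. h (mat_exp (s *\<^sub>R a 1)) \<partial>exp_law)) / 2"
    by (simp add: mixture_map_def field_simps)
  finally show "(\<integral>\<omega>. h (W \<omega>) \<partial>M) = ((\<integral>s. h (mat_exp (s *\<^sub>R a 0)) \<partial>exp_law) + (\<integral>s. h (mat_exp (s *\<^sub>R a 1)) \<partial>exp_law)) / 2" .
qed

text \<open>The factors are known only through their law, so the nonsingularity of exponentials is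
  transferred through the Borel condition that the determinant is nonzero.\<close>

lemma (in prob_space) AE_mixture_nonsingular:
  assumes W[measurable]: "W \<in> borel_measurable M"
    and D: "distr M borel W = distr coin_exp borel (mixture_map a)"
  shows "AE \<omega> in M. \<forall>x. W \<omega> *v x = 0 \<longrightarrow> x = 0"
proof -
  have [measurable]: "(\<lambda>A::real^2^2. det A) \<in> borel_measurable borel"
    unfolding det_2 by (intro borel_measurable_continuous_onI continuous_intros)
  have "AE p in coin_exp. det (mixture_map a p) \<noteq> 0"
    by (simp add: mixture_map_def det_mat_exp)
  then have "AE A in distr coin_exp borel (mixture_map a). det A \<noteq> 0"
    by (subst AE_distr_iff) auto
  then have "AE \<omega> in M. det (W \<omega>) \<noteq> 0"
    unfolding D[symmetric] by (subst (asm) AE_distr_iff) auto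
  then show ?thesis
  proof eventually_elim
    case (elim \<omega>)
    then have "invertible (W \<omega>)" by (simp add: invertible_det_nz)
    then have "\<exists>B. B ** W \<omega> = mat 1" by (simp add: invertible_left_inverse)
    then show ?case using matrix_left_invertible_ker by blast
  qed
qed

lemma (in prob_space) indep_vars_shift:
  assumes "indep_vars (\<lambda>_. N) V {1..}"
  shows "indep_vars (\<lambda>_. N) (\<lambda>n. V (Suc n)) UNIV"
proof -
  have "indep_vars (\<lambda>j. PiM {Suc j} (\<lambda>_. N)) (\<lambda>j \<omega>. restrict (\<lambda>i. V i \<omega>) {Suc j}) UNIV"
    by (rule indep_vars_restrict[OF assms]) (auto simp: disjoint_family_on_def)
  from indep_vars_compose2[OF this, where N = "\<lambda>_. N" and Y = "\<lambda>j f. f (Suc j)"]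
  show ?thesis by simp
qed

lemma onorm_le_sum_columns:
  fixes P :: "real^2^2"
  shows "onorm (\<lambda>x. P *v x) \<le> norm (P *v axis 1 1) + norm (P *v axis 2 1)"
proof (rule onorm_le)
  fix x :: "real^2"
  have x: "x = x $ 1 *\<^sub>R axis 1 1 + x $ 2 *\<^sub>R axis 2 1"
    by (simp add: vec_eq_iff forall_2 axis_def)
  have "P *v x = x $ 1 *\<^sub>R (P *v axis 1 1) + x $ 2 *\<^sub>R (P *v axis 2 1)"
    by (subst x) (simp add: matrix_vector_right_distrib matrix_vector_mult_scaleR)
  then have "norm (P *v x) \<le> \<bar>x $ 1\<bar> * norm (P *v axis 1 1) + \<bar>x $ 2\<bar> * norm (P *v axis 2 1)"
    by (metis norm_scaleR norm_triangle_ineq)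
  also have "\<dots> \<le> norm x * norm (P *v axis 1 1) + norm x * norm (P *v axis 2 1)"
    by (intro add_mono mult_right_mono component_le_norm_cart) auto
  finally show "norm (P *v x) \<le> (norm (P *v axis 1 1) + norm (P *v axis 2 1)) * norm x"
    by (simp add: algebra_simps)
qed

lemma chain_left_prod: "chain (\<lambda>n y v. v *v y) y (\<lambda>n. V (Suc n)) n = left_prod V n *v y"
  by (induction n) (auto simp: matrix_vector_mul_assoc)

context flow_pair
begin

lemma vector_growth_discrete:
  assumes f: "proj_fun f"
    and eq: "\<And>x. x \<noteq> 0 \<Longrightarrow>
     (resolv (a 0) (\<lambda>x. ln (norm x) + f x) x + resolv (a 1) (\<lambda>x. ln (norm x) + f x) x) / 2 = ln (norm x) + f x + c"
    and M: "prob_space M" and indep: "prob_space.indep_vars M (\<lambda>_. borel) V {1..}"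
    and D: "\<And>k. 1 \<le> k \<Longrightarrow> distr M borel (V k) = distr coin_exp borel (mixture_map a)"
    and y0: "y0 \<noteq> 0"
  shows "AE \<omega> in M. (\<lambda>k. ln (norm (left_prod (\<lambda>j. V j \<omega>) k *v y0)) / real k) \<longlonglongrightarrow> c"
    and "AE \<omega> in M. \<forall>k. left_prod (\<lambda>j. V j \<omega>) k *v y0 \<noteq> 0"
proof -
  interpret prob_space M by (rule M)
  interpret E: prob_space exp_law by (rule prob_space_exp_law)
  note [measurable] = proj_fun_measurable[OF f]
  have V[measurable]: "V (Suc k) \<in> borel_measurable M" for k using indep by (auto simp: indep_vars_def)
  let ?G = "\<lambda>x. ln (norm x) + f x"
  \<comment> \<open>The value 0 at the origin makes the centring and the moment bounds hold for
    every state; almost surely the chain never gets there.\<close>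
  define d :: "nat \<Rightarrow> real^2 \<Rightarrow> real^2^2 \<Rightarrow> real" where
    "d n y v = (if y = 0 then 0 else ?G (v *v y) - ?G y - c)" for n y v
  obtain B where B: "\<And>x. \<bar>f x\<bar> \<le> B" using proj_fun_bounded[OF f] by blast
  have B0: "0 \<le> B" using B[of 0] by linarith
  define K where "K = mnorm (a 0) + mnorm (a 1)"
  have K: "mnorm (a i) \<le> K" for i
    using two_cases[of i] mnorm_nonneg[of "a 0"] mnorm_nonneg[of "a 1"] by (auto simp: K_def)
  have K0: "0 \<le> K" using mnorm_nonneg[of "a 0"] mnorm_nonneg[of "a 1"] by (simp add: K_def)
  define b where "b = 2 * B + \<bar>c\<bar>"
  have [measurable]: "(\<lambda>v. d n y v) \<in> borel_measurable borel" for n y unfolding d_def by measurable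
  have dexp: "d n y (mat_exp (s *\<^sub>R a i)) = ?G (mat_exp (s *\<^sub>R a i) *v y) - (?G y + c)" if "y \<noteq> 0" for n y s i
    using that by (simp add: d_def)
  have i1: "integrable exp_law (\<lambda>s. d n y (mat_exp (s *\<^sub>R a i)))" for n y i
  proof (cases "y = 0")
    case False
    then show ?thesis unfolding dexp[OF False]
      by (intro Bochner_Integration.integrable_diff integrable_log_fun[OF f False]) simp
  qed (simp add: d_def)
  have sqb: "AE s in exp_law. (d n y (mat_exp (s *\<^sub>R a i)))\<^sup>2 \<le> 2 * (b\<^sup>2 + K\<^sup>2 * s\<^sup>2)" for n y i
    using AE_exp_law_nonneg
  proof eventually_elim
    case (elim s)
    have "\<bar>d n y (mat_exp (s *\<^sub>R a i))\<bar> \<le> b + K * s"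
    proof (cases "y = 0")
      case True
      then show ?thesis using elim K0 B0 by (simp add: d_def b_def)
    next
      case False
      have "mnorm (a i) * s \<le> K * s" using K elim by (intro mult_right_mono)
      then show ?thesis unfolding dexp[OF False]
        using log_fun_bound[where f = f, OF B False elim, of "a i"] B[of y] unfolding b_def by linarith
    qed
    then have "\<bar>d n y (mat_exp (s *\<^sub>R a i))\<bar>\<^sup>2 \<le> (b + K * s)\<^sup>2" by (intro power_mono) auto
    also have "\<dots> \<le> 2 * (b\<^sup>2 + (K * s)\<^sup>2)" by (rule power2_sum_le)
    finally show ?case by (simp add: power_mult_distrib)
  qed
  have bint: "integrable exp_law (\<lambda>s. 2 * (b\<^sup>2 + K\<^sup>2 * s\<^sup>2))" using exp_law_moment(1)[of 2] by simp
  have i2: "integrable exp_law (\<lambda>s. (d n y (mat_exp (s *\<^sub>R a i)))\<^sup>2)" for n y i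
    by (rule Bochner_Integration.integrable_bound[OF bint]) (use sqb in \<open>auto elim!: eventually_mono\<close>)
  have le2: "(\<integral>s. (d n y (mat_exp (s *\<^sub>R a i)))\<^sup>2 \<partial>exp_law) \<le> 2 * (b\<^sup>2 + K\<^sup>2 * 2)" for n y i
  proof -
    have "(\<integral>s. (d n y (mat_exp (s *\<^sub>R a i)))\<^sup>2 \<partial>exp_law) \<le> (\<integral>s. 2 * (b\<^sup>2 + K\<^sup>2 * s\<^sup>2) \<partial>exp_law)"
      by (rule integral_mono_AE[OF i2 bint sqb])
    also have "\<dots> = 2 * (b\<^sup>2 + K\<^sup>2 * 2)" using exp_law_moment[of 2] E.prob_space by simp
    finally show ?thesis .
  qed
  have Dk: "distr M borel (V (Suc k)) = distr coin_exp borel (mixture_map a)" for k by (rule D) simp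
  have slln: "AE \<omega> in M. (\<lambda>n. (\<Sum>k<n. d k (chain (\<lambda>n y v. v *v y) y0 (\<lambda>j. V (Suc j) \<omega>) k) (V (Suc k) \<omega>)) / real n) \<longlonglongrightarrow> 0"
  proof (rule chain_slln[where \<xi> = "\<lambda>n. V (Suc n)" and d = d and \<Phi> = "\<lambda>n y v. v *v y" and S = borel and N = borel and C = "2 * (b\<^sup>2 + K\<^sup>2 * 2)"])
    show "indep_vars (\<lambda>_. borel) (\<lambda>n. V (Suc n)) UNIV" by (rule indep_vars_shift[OF indep])
    show "(\<lambda>(y :: real^2, v :: real^2^2). v *v y) \<in> borel \<Otimes>\<^sub>M borel \<rightarrow>\<^sub>M borel" by measurable
    show "(\<lambda>(y, v). d n y v) \<in> borel_measurable (borel \<Otimes>\<^sub>M borel)" for n unfolding d_def by measurable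
    show "y0 \<in> space borel" by simp
    fix n y
    show "(\<integral>\<omega>. d n y (V (Suc n) \<omega>) \<partial>M) = 0"
    proof (cases "y = 0")
      case False
      have "(\<integral>\<omega>. d n y (V (Suc n) \<omega>) \<partial>M)
        = ((\<integral>s. d n y (mat_exp (s *\<^sub>R a 0)) \<partial>exp_law) + (\<integral>s. d n y (mat_exp (s *\<^sub>R a 1)) \<partial>exp_law)) / 2"
        by (rule integral_mixture[OF _ Dk]) (auto intro: i1)
      moreover have "(\<integral>s. d n y (mat_exp (s *\<^sub>R a i)) \<partial>exp_law) = resolv (a i) ?G y - (?G y + c)" for i
        unfolding dexp[OF False] resolv_def using integrable_log_fun[OF f False, of "a i"] E.prob_space
        by (subst Bochner_Integration.integral_diff) auto
      ultimately show ?thesis using eq[OF False] by (simp only:) (simp add: field_simps)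
    qed (simp add: d_def)
    show "integrable M (\<lambda>\<omega>. (d n y (V (Suc n) \<omega>))\<^sup>2)"
      by (rule integrable_mixture[OF _ Dk, where h = "\<lambda>v. (d n y v)\<^sup>2"]) (auto intro: i2)
    have "(\<integral>\<omega>. (d n y (V (Suc n) \<omega>))\<^sup>2 \<partial>M)
        = ((\<integral>s. (d n y (mat_exp (s *\<^sub>R a 0)))\<^sup>2 \<partial>exp_law) + (\<integral>s. (d n y (mat_exp (s *\<^sub>R a 1)))\<^sup>2 \<partial>exp_law)) / 2"
      by (rule integral_mixture[OF _ Dk, where h = "\<lambda>v. (d n y v)\<^sup>2"]) (auto intro: i2)
    then show "(\<integral>\<omega>. (d n y (V (Suc n) \<omega>))\<^sup>2 \<partial>M) \<le> 2 * (b\<^sup>2 + K\<^sup>2 * 2)"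
      using add_mono[OF le2[of n y 0] le2[of n y 1]] by simp
  qed
  have "AE \<omega> in M. \<forall>k x. V (Suc k) \<omega> *v x = 0 \<longrightarrow> x = 0"
    unfolding AE_all_countable by (intro allI AE_mixture_nonsingular[OF V Dk])
  then show ne: "AE \<omega> in M. \<forall>k. left_prod (\<lambda>j. V j \<omega>) k *v y0 \<noteq> 0"
  proof eventually_elim
    case (elim \<omega>)
    show ?case
    proof
      fix k show "left_prod (\<lambda>j. V j \<omega>) k *v y0 \<noteq> 0"
        using elim y0 by (induction k) (auto simp: matrix_vector_mul_assoc[symmetric])
    qed
  qed
  from slln ne show "AE \<omega> in M. (\<lambda>k. ln (norm (left_prod (\<lambda>j. V j \<omega>) k *v y0)) / real k) \<longlonglongrightarrow> c"
  proof eventually_elim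
    case (elim \<omega>)
    let ?Y = "\<lambda>k. left_prod (\<lambda>j. V j \<omega>) k *v y0"
    have "(\<lambda>n. (\<Sum>k<n. ?G (?Y (Suc k)) - ?G (?Y k) - c) / real n) \<longlonglongrightarrow> 0"
      using elim unfolding chain_left_prod[where V = "\<lambda>j. V j \<omega>"] by (simp add: d_def matrix_vector_mul_assoc)
    then show ?case
      by (rule growth_rate_of_increments[where B = B]) (use B in simp)
  qed
qed

text \<open>The operator norm lies between the norm of the first column and twice the larger of the
  two column norms, and both columns grow at the rate \<open>c\<close>.\<close>

lemma norm_growth_discrete:
  assumes f: "proj_fun f"
    and eq: "\<And>x. x \<noteq> 0 \<Longrightarrow>
     (resolv (a 0) (\<lambda>x. ln (norm x) + f x) x + resolv (a 1) (\<lambda>x. ln (norm x) + f x) x) / 2 = ln (norm x) + f x + c"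
    and M: "prob_space M" and indep: "prob_space.indep_vars M (\<lambda>_. borel) V {1..}"
    and D: "\<And>k. 1 \<le> k \<Longrightarrow> distr M borel (V k) = distr coin_exp borel (mixture_map a)"
  shows "AE \<omega> in M. (\<lambda>k. ln (onorm (\<lambda>x. left_prod (\<lambda>j. V j \<omega>) k *v x)) / real k) \<longlonglongrightarrow> c"
proof -
  let ?e1 = "axis 1 1 :: real^2" and ?e2 = "axis 2 1 :: real^2"
  have e: "?e1 \<noteq> 0" "?e2 \<noteq> 0" by (auto simp: axis_eq_0_iff)
  have g: "AE \<omega> in M. (\<lambda>k. ln (norm (left_prod (\<lambda>j. V j \<omega>) k *v y0)) / real k) \<longlonglongrightarrow> c"
    "AE \<omega> in M. \<forall>k. left_prod (\<lambda>j. V j \<omega>) k *v y0 \<noteq> 0" if "y0 \<noteq> 0" for y0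
    by (rule vector_growth_discrete[OF f _ M indep _ that]; (rule eq D; assumption))+
  from g[OF e(1)] g[OF e(2)] show ?thesis
  proof eventually_elim
    case (elim \<omega>)
    let ?P = "left_prod (\<lambda>j. V j \<omega>)"
    let ?a = "\<lambda>k. norm (?P k *v ?e1)" and ?b = "\<lambda>k. norm (?P k *v ?e2)" and ?o = "\<lambda>k. onorm (\<lambda>x. ?P k *v x)"
    have a: "0 < ?a k" and b: "0 < ?b k" for k using elim by auto
    have lo: "?a k \<le> ?o k" for k
      using onorm[of "\<lambda>x. ?P k *v x" ?e1] by (simp add: linear_linear norm_axis_1)
    have hi: "?o k \<le> 2 * max (?a k) (?b k)" for k
      using onorm_le_sum_columns[of "?P k"] by linarith
    have hi': "ln (?o k) / real k \<le> ln 2 / real k + max (ln (?a k) / real k) (ln (?b k) / real k)" for k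
    proof -
      have "ln (?o k) \<le> ln (2 * max (?a k) (?b k))"
        using hi[of k] a[of k] less_le_trans[OF a[of k] lo[of k]]
        by (subst ln_le_cancel_iff) (auto simp: less_max_iff_disj)
      also have "\<dots> = ln 2 + max (ln (?a k)) (ln (?b k))"
        using a[of k] b[of k] by (subst ln_mult) (auto simp: max_def)
      finally have "ln (?o k) / real k \<le> (ln 2 + max (ln (?a k)) (ln (?b k))) / real k" by (intro divide_right_mono) auto
      then show ?thesis by (simp add: add_divide_distrib max_divide_distrib_right)
    qed
    show ?case
    proof (rule tendsto_sandwich)
      show "(\<lambda>k. ln (?a k) / real k) \<longlonglongrightarrow> c" using elim by blast
      have "(\<lambda>k. ln 2 / real k + max (ln (?a k) / real k) (ln (?b k) / real k)) \<longlonglongrightarrow> 0 + max c c"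
        using elim by (intro tendsto_add tendsto_max lim_const_over_n) auto
      then show "(\<lambda>k. ln 2 / real k + max (ln (?a k) / real k) (ln (?b k) / real k)) \<longlonglongrightarrow> c" by simp
      show "\<forall>\<^sub>F k in sequentially. ln (?a k) / real k \<le> ln (?o k) / real k"
        using lo a less_le_trans[OF a lo]
        by (intro always_eventually allI divide_right_mono iffD2[OF ln_le_cancel_iff]) simp_all
      show "\<forall>\<^sub>F k in sequentially. ln (?o k) / real k \<le> ln 2 / real k + max (ln (?a k) / real k) (ln (?b k) / real k)"
        by (intro always_eventually allI hi')
    qed
  qed
qed

end

section \<open>From jump times to continuous time\<close>

text \<open>As an indefinite integral \<open>X\<close> is continuous. Within one holding interval
  the integrand equals \<open>A i *v X\<close> except possibly at the right end, where the index may
  already have jumped; so \<open>X\<close> solves the linear equation inside and uniqueness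
  applies.\<close>

lemma switched_path_between_jumps:
  fixes X :: "real \<Rightarrow> real^'n"
  assumes T: "0 \<le> s" "s < e" and I: "\<And>t. s \<le> t \<Longrightarrow> t < e \<Longrightarrow> I t = i"
    and int: "\<And>t. 0 \<le> t \<Longrightarrow> ((\<lambda>u. A (I u) *v X u) has_integral (X t - X 0)) {0..t}"
    and t: "s \<le> t" "t \<le> e"
  shows "X t = mat_exp ((t - s) *\<^sub>R A i) *v X s"
proof -
  let ?f = "\<lambda>u. A (I u) *v X u" and ?g = "\<lambda>u. A i *v X u"
  have fint: "?f integrable_on {0..e}" using int[of e] T by (auto simp: integrable_on_def)
  have Xeq: "X t = X 0 + integral {0..t} ?f" if "0 \<le> t" for t
    using integral_unique[OF int[OF that]] by simp
  have "continuous_on {0..e} (\<lambda>t. X 0 + integral {0..t} ?f)"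
    by (intro continuous_intros indefinite_integral_continuous_1[OF fint])
  then have cont0: "continuous_on {0..e} X"
    by (rule continuous_on_eq) (rule Xeq[symmetric], simp)
  then have cont: "continuous_on {s..e} X" by (rule continuous_on_subset) (use T in auto)
  then have contg: "continuous_on {s..e} ?g"
    by (intro bounded_linear.continuous_on[OF matrix_vector_mul_bounded_linear])
  have eq: "X t = X s + integral {s..t} ?g" if t: "s \<le> t" "t \<le> e" for t
  proof -
    have "integral {0..s} ?f + integral {s..t} ?f = integral {0..t} ?f"
      by (rule Henstock_Kurzweil_Integration.integral_combine)
        (use T t fint in \<open>auto intro: integrable_on_subinterval\<close>)
    moreover have "integral {s..t} ?f = integral {s..t} ?g"
      by (rule integral_spike[of "{t}"]) (use I t in auto)
    ultimately have "integral {0..t} ?f = integral {0..s} ?f + integral {s..t} ?g" by simp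
    moreover have "X t = X 0 + integral {0..t} ?f" by (rule Xeq) (use T t in simp)
    moreover have "X s = X 0 + integral {0..s} ?f" by (rule Xeq[OF T(1)])
    ultimately show ?thesis by (simp only: add.assoc)
  qed
  have der: "(X has_vector_derivative A i *v X u) (at u)" if u: "s < u" "u < e" for u
  proof -
    have "((\<lambda>t. integral {s..t} ?g) has_vector_derivative ?g u) (at u within {s..e})"
      by (rule integral_has_vector_derivative[OF contg]) (use u in auto)
    then have "((\<lambda>t. integral {s..t} ?g) has_vector_derivative ?g u) (at u)"
      using u by (simp add: at_within_Icc_at)
    then have "((\<lambda>t. X s + integral {s..t} ?g) has_vector_derivative ?g u) (at u)"
      by (auto intro!: derivative_eq_intros)
    then show ?thesis
    proof (rule has_vector_derivative_transform_within_open[of _ _ _ "{s<..<e}"])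
      show "X s + integral {s..t} ?g = X t" if "t \<in> {s<..<e}" for t
        using that by (intro eq[symmetric]) auto
    qed (use u in auto)
  qed
  show ?thesis
    by (rule linear_ode_unique[OF t(1)])
      (use t der cont in \<open>auto intro: continuous_on_subset\<close>)
qed

text \<open>Let \<open>N t\<close> be the number of jumps up to \<open>t\<close>. Both
  \<open>t / N t\<close> and \<open>T (N t) / N t\<close> tend to \<open>\<tau>\<close>, so the time
  since the last jump is negligible against \<open>N t\<close>, and with it the oscillation of
  \<open>L\<close>. The limit is the quotient of growth per jump by time per jump.\<close>

lemma growth_rate_interpolation:
  fixes L :: "real \<Rightarrow> real" and T :: "nat \<Rightarrow> real"
  assumes T0: "T 0 = 0" and mono: "\<And>n. T n < T (Suc n)"
    and Tlim: "(\<lambda>n. T n / real n) \<longlonglongrightarrow> \<tau>" and \<tau>: "0 < \<tau>"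
    and Llim: "(\<lambda>n. L (T n) / real n) \<longlonglongrightarrow> \<kappa>"
    and osc: "\<And>n t. T n \<le> t \<Longrightarrow> t < T (Suc n) \<Longrightarrow> \<bar>L t - L (T n)\<bar> \<le> K * (t - T n)"
    and K: "0 \<le> K"
  shows "((\<lambda>t. L t / t) \<longlongrightarrow> \<kappa> / \<tau>) at_top"
proof -
  have sm: "strict_mono T" using mono by (simp add: strict_mono_Suc_iff)
  have T_le: "T m \<le> T n" if "m \<le> n" for m n using strict_mono_less_eq[OF sm] that by blast
  have Tinf: "filterlim T at_top sequentially"
  proof -
    have "filterlim (\<lambda>n. T n / real n * real n) at_top sequentially"
      by (rule filterlim_tendsto_pos_mult_at_top[OF Tlim \<tau> filterlim_real_sequentially])
    moreover have "T n / real n * real n = T n" for n by (cases n) (auto simp: T0)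
    ultimately show ?thesis by simp
  qed
  have ex: "\<exists>n. T n \<le> t \<and> t < T (Suc n)" if t: "0 \<le> t" for t
  proof -
    have "\<exists>n. t < T n"
      using Tinf[unfolded filterlim_at_top_dense] by (auto simp: eventually_sequentially)
    then have "t < T (LEAST n. t < T n)" by (rule LeastI_ex)
    then obtain n where n: "t < T n" "\<And>m. m < n \<Longrightarrow> \<not> t < T m"
      using not_less_Least[of _ "\<lambda>n. t < T n"] by blast
    have "n \<noteq> 0" using n(1) T0 t by (intro notI) simp
    then obtain m where "n = Suc m" by (cases n) auto
    then show ?thesis using n(1) n(2)[of m] by (intro exI[of _ m]) auto
  qed
  define N where "N t = (SOME n. T n \<le> t \<and> t < T (Suc n))" for t
  have N: "T (N t) \<le> t" "t < T (Suc (N t))" if "0 \<le> t" for t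
    using someI_ex[OF ex[OF that]] unfolding N_def by blast+
  have Nlim: "filterlim N at_top at_top"
    unfolding filterlim_at_top
  proof
    fix Z :: nat
    show "\<forall>\<^sub>F t in at_top. Z \<le> N t"
      using eventually_ge_at_top[of "max 0 (T Z)"]
    proof eventually_elim
      case (elim t)
      then have "T Z < T (Suc (N t))" using N(2)[of t] by linarith
      then have "Z < Suc (N t)" using strict_mono_less[OF sm] by blast
      then show ?case by simp
    qed
  qed
  have S: "(\<lambda>n. T (Suc n) / real n) \<longlonglongrightarrow> \<tau>"
  proof -
    have "(\<lambda>n. T (Suc n) / real (Suc n)) \<longlonglongrightarrow> \<tau>" by (rule LIMSEQ_Suc[OF Tlim])
    moreover have "(\<lambda>n. real (Suc n) / real n) \<longlonglongrightarrow> 1"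
      by (rule LIMSEQ_Suc_n_over_n)
    ultimately have "(\<lambda>n. T (Suc n) / real (Suc n) * (real (Suc n) / real n)) \<longlonglongrightarrow> \<tau> * 1"
      by (rule tendsto_mult)
    then show ?thesis by (simp del: of_nat_Suc)
  qed
  have tN: "((\<lambda>t. t / real (N t)) \<longlongrightarrow> \<tau>) at_top"
  proof (rule tendsto_sandwich)
    show "((\<lambda>t. T (N t) / real (N t)) \<longlongrightarrow> \<tau>) at_top" by (rule filterlim_compose[OF Tlim Nlim])
    show "((\<lambda>t. T (Suc (N t)) / real (N t)) \<longlongrightarrow> \<tau>) at_top" by (rule filterlim_compose[OF S Nlim])
    show "\<forall>\<^sub>F t in at_top. T (N t) / real (N t) \<le> t / real (N t)"
      using eventually_ge_at_top[of 0] by eventually_elim (use N in \<open>auto intro: divide_right_mono\<close>)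
    show "\<forall>\<^sub>F t in at_top. t / real (N t) \<le> T (Suc (N t)) / real (N t)"
      using eventually_ge_at_top[of 0] by eventually_elim (rule divide_right_mono[OF less_imp_le[OF N(2)]], simp_all)
  qed
  have "((\<lambda>t. (L t - L (T (N t))) / real (N t)) \<longlongrightarrow> 0) at_top"
  proof (rule Lim_null_comparison)
    have "((\<lambda>t. K * (t / real (N t) - T (N t) / real (N t))) \<longlongrightarrow> K * (\<tau> - \<tau>)) at_top"
      by (intro tendsto_intros tN filterlim_compose[OF Tlim Nlim])
    then show "((\<lambda>t. K * (t / real (N t) - T (N t) / real (N t))) \<longlongrightarrow> 0) at_top" by simp
    show "\<forall>\<^sub>F t in at_top. norm ((L t - L (T (N t))) / real (N t)) \<le> K * (t / real (N t) - T (N t) / real (N t))"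
      using eventually_ge_at_top[of 0]
    proof eventually_elim
      case (elim t)
      have "\<bar>L t - L (T (N t))\<bar> / real (N t) \<le> K * (t - T (N t)) / real (N t)"
        using osc[OF N(1)[OF elim] N(2)[OF elim]] by (intro divide_right_mono) auto
      then show ?case by (simp only: real_norm_def abs_divide abs_of_nat diff_divide_distrib[symmetric] times_divide_eq_right)
    qed
  qed
  then have "((\<lambda>t. (L t - L (T (N t))) / real (N t) + L (T (N t)) / real (N t)) \<longlongrightarrow> 0 + \<kappa>) at_top"
    by (intro tendsto_add filterlim_compose[OF Llim Nlim])
  then have "((\<lambda>t. L t / real (N t)) \<longlongrightarrow> \<kappa>) at_top" by (simp add: add_divide_distrib[symmetric])
  then have "((\<lambda>t. (L t / real (N t)) / (t / real (N t))) \<longlongrightarrow> \<kappa> / \<tau>) at_top"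
    by (rule tendsto_divide[OF _ tN]) (use \<tau> in simp)
  then show ?thesis
  proof (rule Lim_transform_eventually)
    have "\<forall>\<^sub>F t in at_top. 1 \<le> N t" using Nlim unfolding filterlim_at_top by blast
    then show "\<forall>\<^sub>F t in at_top. (L t / real (N t)) / (t / real (N t)) = L t / t"
      by eventually_elim simp
  qed
qed

section \<open>Laws of large numbers for the alternating flow and its holding times\<close>

lemma jump_chain_Suc: "jump_chain i (Suc n) = 1 - jump_chain i n"
  by (simp add: jump_chain_def)

lemma sum_jump_chain:
  fixes h :: "2 \<Rightarrow> real"
  shows "\<bar>(\<Sum>k<n. h (jump_chain i k)) - real n * ((h 0 + h 1) / 2)\<bar> \<le> \<bar>h 0\<bar> + \<bar>h 1\<bar>"
proof -
  have i: "i = 0 \<or> i = 1" by (rule two_cases)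
  have even: "(\<Sum>k<2 * m. h (jump_chain i k)) = real m * (h 0 + h 1)" for m
    using i by (induction m) (auto simp: jump_chain_def algebra_simps)
  show ?thesis
  proof (cases "even n")
    case True
    then obtain m where "n = 2 * m" by blast
    then show ?thesis using even[of m] by simp
  next
    case False
    then obtain m where n: "n = Suc (2 * m)" using oddE by fastforce
    have "(\<Sum>k<n. h (jump_chain i k)) = real m * (h 0 + h 1) + h i"
      using even[of m] by (simp add: n jump_chain_def)
    then have "(\<Sum>k<n. h (jump_chain i k)) - real n * ((h 0 + h 1) / 2) = h i - (h 0 + h 1) / 2"
      by (simp add: n field_simps)
    moreover have "\<bar>h i - (h 0 + h 1) / 2\<bar> \<le> \<bar>h 0\<bar> + \<bar>h 1\<bar>"
    proof -
      have "\<bar>x - (x + y) / 2\<bar> \<le> \<bar>x\<bar> + \<bar>y\<bar>" "\<bar>y - (x + y) / 2\<bar> \<le> \<bar>x\<bar> + \<bar>y\<bar>" for x y :: real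
        by (simp_all add: abs_if field_simps)
      then show ?thesis using i by (elim disjE) simp_all
    qed
    ultimately show ?thesis by simp
  qed
qed

lemma average_jump_chain:
  "(\<lambda>n. (\<Sum>k<n. h (jump_chain i k)) / real n) \<longlonglongrightarrow> (h 0 + h 1) / (2::real)"
proof -
  let ?m = "(h 0 + h 1) / 2" and ?S = "\<lambda>n. \<Sum>k<n. h (jump_chain i k)"
  have "(\<lambda>n. (?S n - real n * ?m) / real n) \<longlonglongrightarrow> 0"
  proof (rule Lim_null_comparison[OF _ lim_const_over_n[of "\<bar>h 0\<bar> + \<bar>h 1\<bar>"]])
    show "\<forall>\<^sub>F n in sequentially. norm ((?S n - real n * ?m) / real n) \<le> (\<bar>h 0\<bar> + \<bar>h 1\<bar>) / real n"
      using sum_jump_chain[of h i] by (intro always_eventually allI) (simp add: divide_right_mono)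
  qed
  then have "(\<lambda>n. (?S n - real n * ?m) / real n + ?m) \<longlonglongrightarrow> 0 + ?m" by (intro tendsto_intros)
  then have "(\<lambda>n. (?S n - real n * ?m) / real n + ?m) \<longlonglongrightarrow> ?m" by simp
  then show ?thesis
  proof (rule Lim_transform_eventually)
    show "\<forall>\<^sub>F n in sequentially. (?S n - real n * ?m) / real n + ?m = ?S n / real n"
      using eventually_gt_at_top[of 0] by eventually_elim (simp add: field_simps)
  qed
qed

text \<open>Convergence is rewritten with countable quantifiers; measurability of the event is what
  Fubini's theorem asks for when the initial value is random.\<close>

lemma pred_LIMSEQ [measurable (raw)]:
  fixes f :: "nat \<Rightarrow> 'a \<Rightarrow> real"
  assumes [measurable]: "\<And>n. f n \<in> borel_measurable M"
  shows "Measurable.pred M (\<lambda>x. (\<lambda>n. f n x) \<longlonglongrightarrow> c)"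
proof -
  have "(\<lambda>n. f n x) \<longlonglongrightarrow> c \<longleftrightarrow> (\<forall>k. \<exists>N. \<forall>n. N \<le> n \<longrightarrow> \<bar>f n x - c\<bar> < 1 / real (Suc k))" for x
  proof
    assume "(\<lambda>n. f n x) \<longlonglongrightarrow> c"
    then show "\<forall>k. \<exists>N. \<forall>n. N \<le> n \<longrightarrow> \<bar>f n x - c\<bar> < 1 / real (Suc k)"
      unfolding LIMSEQ_def dist_real_def by auto
  next
    assume R: "\<forall>k. \<exists>N. \<forall>n. N \<le> n \<longrightarrow> \<bar>f n x - c\<bar> < 1 / real (Suc k)"
    show "(\<lambda>n. f n x) \<longlonglongrightarrow> c"
      unfolding LIMSEQ_def dist_real_def
    proof (intro allI impI)
      fix r :: real assume "0 < r"
      then obtain k where "1 / real (Suc k) < r" using nat_approx_posE by blast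
      then show "\<exists>no. \<forall>n\<ge>no. \<bar>f n x - c\<bar> < r" using R by (meson less_trans)
    qed
  qed
  then show ?thesis by (simp only:) measurable
qed

definition alt_step :: "(2 \<Rightarrow> real^2^2) \<Rightarrow> 2 \<Rightarrow> nat \<Rightarrow> real^2 \<Rightarrow> real \<Rightarrow> real^2" where
  "alt_step b i n y s = mat_exp (s *\<^sub>R b (jump_chain i n)) *v y"

text \<open>The potential alternates with the index: before step \<open>n\<close> it is
  \<open>ln (norm y) + g (jump_chain i n) y\<close>. The equation says that its mean gain in each
  step is \<open>\<kappa>\<close>, so the gains minus \<open>\<kappa>\<close> are centred whatever
  the current state is.\<close>

lemma (in prob_space) alternating_growth:
  assumes g: "\<And>i. proj_fun (g i)"
    and eq: "\<And>i x. x \<noteq> 0 \<Longrightarrow> resolv (b i) (\<lambda>x. ln (norm x) + g (1 - i) x) x = ln (norm x) + g i x + \<kappa>"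
    and indep: "indep_vars (\<lambda>_. borel) S UNIV"
    and law: "\<And>n. distr M borel (S n) = exp_law"
    and y0: "y0 \<noteq> 0"
  shows "AE \<omega> in M. (\<lambda>n. ln (norm (chain (alt_step b i) y0 (\<lambda>j. S j \<omega>) n)) / real n) \<longlonglongrightarrow> \<kappa>"
proof -
  interpret E: prob_space exp_law by (rule prob_space_exp_law)
  note [measurable] = proj_fun_measurable[OF g]
  have S[measurable]: "S n \<in> borel_measurable M" for n using indep by (auto simp: indep_vars_def)
  have tr: "(\<integral>\<omega>. h (S n \<omega>) \<partial>M) = (\<integral>s. h s \<partial>exp_law)" "integrable M (\<lambda>\<omega>. h (S n \<omega>)) \<longleftrightarrow> integrable exp_law h"
    if h: "h \<in> borel_measurable borel" for h :: "real \<Rightarrow> real" and n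
    unfolding law[of n, symmetric] by (simp_all only: integral_distr[OF S h] integrable_distr_eq[OF S h])
  let ?j = "jump_chain i"
  let ?G = "\<lambda>n y. ln (norm y) + g (?j n) y"
  define d :: "nat \<Rightarrow> real^2 \<Rightarrow> real \<Rightarrow> real" where
    "d n y s = (if y = 0 then 0 else ?G (Suc n) (alt_step b i n y s) - ?G n y - \<kappa>)" for n y s
  have "\<exists>B. \<forall>i x. \<bar>g i x\<bar> \<le> B"
  proof -
    obtain B0 B1 where "\<And>x. \<bar>g 0 x\<bar> \<le> B0" "\<And>x. \<bar>g 1 x\<bar> \<le> B1" using proj_fun_bounded[OF g] by metis
    then have "\<bar>g i x\<bar> \<le> max B0 B1" for i x using two_cases[of i] by (auto simp: le_max_iff_disj)
    then show ?thesis by blast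
  qed
  then obtain B where B: "\<And>i x. \<bar>g i x\<bar> \<le> B" by blast
  have B0: "0 \<le> B" using B[of 0 0] by linarith
  define K where "K = mnorm (b 0) + mnorm (b 1)"
  have K: "mnorm (b i) \<le> K" for i
    using two_cases[of i] mnorm_nonneg[of "b 0"] mnorm_nonneg[of "b 1"] by (auto simp: K_def)
  have K0: "0 \<le> K" using mnorm_nonneg[of "b 0"] mnorm_nonneg[of "b 1"] by (simp add: K_def)
  define \<beta> where "\<beta> = 2 * B + \<bar>\<kappa>\<bar>"
  have [measurable]: "(\<lambda>s. d n y s) \<in> borel_measurable borel" for n y unfolding d_def alt_step_def by measurable
  have dne: "d n y s = (ln (norm (mat_exp (s *\<^sub>R b (?j n)) *v y)) + g (1 - ?j n) (mat_exp (s *\<^sub>R b (?j n)) *v y)) - (?G n y + \<kappa>)"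
    if "y \<noteq> 0" for n y s
    using that by (simp add: d_def alt_step_def jump_chain_Suc)
  have sqb: "AE s in exp_law. (d n y s)\<^sup>2 \<le> 2 * (\<beta>\<^sup>2 + K\<^sup>2 * s\<^sup>2)" for n y
    using AE_exp_law_nonneg
  proof eventually_elim
    case (elim s)
    have "\<bar>d n y s\<bar> \<le> \<beta> + K * s"
    proof (cases "y = 0")
      case True
      then show ?thesis using elim K0 B0 by (simp add: d_def \<beta>_def)
    next
      case False
      have "mnorm (b (?j n)) * s \<le> K * s" using K elim by (intro mult_right_mono)
      then show ?thesis unfolding dne[OF False]
        using log_fun_bound[where f = "g (1 - ?j n)", OF B False elim, of "b (?j n)"] B[of "?j n" y] unfolding \<beta>_def by linarith
    qed
    then have "\<bar>d n y s\<bar>\<^sup>2 \<le> (\<beta> + K * s)\<^sup>2" by (intro power_mono) auto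
    also have "\<dots> \<le> 2 * (\<beta>\<^sup>2 + (K * s)\<^sup>2)" by (rule power2_sum_le)
    finally show ?case by (simp add: power_mult_distrib)
  qed
  have bint: "integrable exp_law (\<lambda>s. 2 * (\<beta>\<^sup>2 + K\<^sup>2 * s\<^sup>2))" using exp_law_moment(1)[of 2] by simp
  have i2: "integrable exp_law (\<lambda>s. (d n y s)\<^sup>2)" for n y
    by (rule Bochner_Integration.integrable_bound[OF bint]) (use sqb in \<open>auto elim!: eventually_mono\<close>)
  have le2: "(\<integral>s. (d n y s)\<^sup>2 \<partial>exp_law) \<le> 2 * (\<beta>\<^sup>2 + K\<^sup>2 * 2)" for n y
  proof -
    have "(\<integral>s. (d n y s)\<^sup>2 \<partial>exp_law) \<le> (\<integral>s. 2 * (\<beta>\<^sup>2 + K\<^sup>2 * s\<^sup>2) \<partial>exp_law)"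
      by (rule integral_mono_AE[OF i2 bint sqb])
    also have "\<dots> = 2 * (\<beta>\<^sup>2 + K\<^sup>2 * 2)" using exp_law_moment[of 2] E.prob_space by simp
    finally show ?thesis .
  qed
  have slln: "AE \<omega> in M. (\<lambda>n. (\<Sum>k<n. d k (chain (alt_step b i) y0 (\<lambda>j. S j \<omega>) k) (S k \<omega>)) / real n) \<longlonglongrightarrow> 0"
  proof (rule chain_slln[where \<xi> = S and d = d and \<Phi> = "alt_step b i" and S = borel and N = borel and C = "2 * (\<beta>\<^sup>2 + K\<^sup>2 * 2)"])
    show "indep_vars (\<lambda>_. borel) S UNIV" by (rule indep)
    show "(\<lambda>(y, s). alt_step b i n y s) \<in> borel \<Otimes>\<^sub>M borel \<rightarrow>\<^sub>M borel" for n
      unfolding alt_step_def by measurable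
    show "(\<lambda>(y, s). d n y s) \<in> borel_measurable (borel \<Otimes>\<^sub>M borel)" for n unfolding d_def alt_step_def by measurable
    show "y0 \<in> space borel" by simp
    fix n y
    show "(\<integral>\<omega>. d n y (S n \<omega>) \<partial>M) = 0"
    proof (cases "y = 0")
      case False
      have "(\<integral>\<omega>. d n y (S n \<omega>) \<partial>M) = (\<integral>s. d n y s \<partial>exp_law)" by (rule tr) simp
      also have "\<dots> = resolv (b (?j n)) (\<lambda>x. ln (norm x) + g (1 - ?j n) x) y - (?G n y + \<kappa>)"
        unfolding dne[OF False] resolv_def using integrable_log_fun[OF g False, of "b (?j n)" "1 - ?j n"] E.prob_space
        by (subst Bochner_Integration.integral_diff) auto
      finally show ?thesis using eq[OF False] by simp
    qed (simp add: d_def)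
    show "integrable M (\<lambda>\<omega>. (d n y (S n \<omega>))\<^sup>2)"
      using tr(2)[of "\<lambda>s. (d n y s)\<^sup>2" n] i2 by simp
    show "(\<integral>\<omega>. (d n y (S n \<omega>))\<^sup>2 \<partial>M) \<le> 2 * (\<beta>\<^sup>2 + K\<^sup>2 * 2)"
      using tr(1)[of "\<lambda>s. (d n y s)\<^sup>2" n] le2[of n y] by simp
  qed
  then show ?thesis
  proof eventually_elim
    case (elim \<omega>)
    let ?Y = "chain (alt_step b i) y0 (\<lambda>j. S j \<omega>)"
    have ne: "?Y k \<noteq> 0" for k using y0 by (induction k) (auto simp: alt_step_def)
    have "(\<lambda>n. (\<Sum>k<n. ?G (Suc k) (?Y (Suc k)) - ?G k (?Y k) - \<kappa>) / real n) \<longlonglongrightarrow> 0"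
      using elim ne by (simp add: d_def)
    then show ?case
      by (rule growth_rate_of_increments[where B = B]) (use B in simp)
  qed
qed

text \<open>The law of large numbers for chains with a one-point state space, applied to the centred
  times \<open>S - 1\<close> weighted by the inverse rates; the weights themselves average to the
  limit.\<close>

lemma (in prob_space) average_holding_times:
  assumes indep: "indep_vars (\<lambda>_. borel) S UNIV"
    and law: "\<And>n. distr M borel (S n) = exp_law"
  shows "AE \<omega> in M. (\<lambda>n. (\<Sum>k<n. S k \<omega> / r (jump_chain i k)) / real n) \<longlonglongrightarrow> (1 / r 0 + 1 / r 1) / (2::real)"
proof -
  interpret E: prob_space exp_law by (rule prob_space_exp_law)
  have S[measurable]: "S n \<in> borel_measurable M" for n using indep by (auto simp: indep_vars_def)
  have tr: "(\<integral>\<omega>. h (S n \<omega>) \<partial>M) = (\<integral>s. h s \<partial>exp_law)" "integrable M (\<lambda>\<omega>. h (S n \<omega>)) \<longleftrightarrow> integrable exp_law h"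
    if h: "h \<in> borel_measurable borel" for h :: "real \<Rightarrow> real" and n
    unfolding law[of n, symmetric] by (simp_all only: integral_distr[OF S h] integrable_distr_eq[OF S h])
  define d where "d n (y::unit) s = (s - 1) / r (jump_chain i n)" for n y and s :: real
  define C where "C = (1 / r 0)\<^sup>2 + (1 / r 1)\<^sup>2"
  have sq: "(d n y s)\<^sup>2 = (1 / r (jump_chain i n))\<^sup>2 * (s\<^sup>2 - 2 * s + 1)" for n y s
    by (simp add: d_def power_divide power2_diff)
  have mom: "integrable exp_law (\<lambda>s. s\<^sup>2 - 2 * s + 1)" "(\<integral>s. s\<^sup>2 - 2 * s + 1 \<partial>exp_law) = 1"
    using exp_law_moment[of 2] exp_law_mean E.prob_space by auto
  have "AE \<omega> in M. (\<lambda>n. (\<Sum>k<n. d k (chain (\<lambda>_ y _. y) () (\<lambda>j. S j \<omega>) k) (S k \<omega>)) / real n) \<longlonglongrightarrow> 0"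
  proof (rule chain_slln[where \<xi> = S and d = d and \<Phi> = "\<lambda>_ y _. y" and S = "count_space UNIV" and N = borel and C = C])
    show "indep_vars (\<lambda>_. borel) S UNIV" by (rule indep)
    show "(\<lambda>(y, s). d n y s) \<in> borel_measurable (count_space UNIV \<Otimes>\<^sub>M borel)" for n unfolding d_def by measurable
    fix n y
    have "(\<integral>s. (s - 1) / r (jump_chain i n) \<partial>exp_law) = ((\<integral>s. s \<partial>exp_law) - 1) / r (jump_chain i n)"
      using exp_law_mean E.prob_space by simp
    moreover have "(\<integral>\<omega>. d n y (S n \<omega>) \<partial>M) = (\<integral>s. (s - 1) / r (jump_chain i n) \<partial>exp_law)"
      unfolding d_def by (rule tr(1)) measurable
    ultimately show "(\<integral>\<omega>. d n y (S n \<omega>) \<partial>M) = 0" by (simp only: exp_law_mean) simp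
    have m: "(\<lambda>s. (1 / r (jump_chain i n))\<^sup>2 * (s\<^sup>2 - 2 * s + 1)) \<in> borel_measurable borel" by measurable
    show "integrable M (\<lambda>\<omega>. (d n y (S n \<omega>))\<^sup>2)"
      unfolding sq tr(2)[OF m] using mom(1) by (rule integrable_mult_right)
    have "(\<integral>\<omega>. (d n y (S n \<omega>))\<^sup>2 \<partial>M) = (1 / r (jump_chain i n))\<^sup>2"
      unfolding sq tr(1)[OF m] unfolding integral_mult_right_zero mom(2) by simp
    then show "(\<integral>\<omega>. (d n y (S n \<omega>))\<^sup>2 \<partial>M) \<le> C"
      using two_cases[of "jump_chain i n"] by (auto simp: C_def)
  qed auto
  then show ?thesis
  proof eventually_elim
    case (elim \<omega>)
    have "(\<lambda>n. (\<Sum>k<n. d k () (S k \<omega>)) / real n + (\<Sum>k<n. 1 / r (jump_chain i k)) / real n) \<longlonglongrightarrow> 0 + (1 / r 0 + 1 / r 1) / 2"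
      using elim by (intro tendsto_add average_jump_chain[of "\<lambda>i. 1 / r i"]) simp
    moreover have "(\<Sum>k<n. d k () (S k \<omega>)) + (\<Sum>k<n. 1 / r (jump_chain i k)) = (\<Sum>k<n. S k \<omega> / r (jump_chain i k))" for n
      unfolding sum.distrib[symmetric] by (simp add: d_def diff_divide_distrib)
    ultimately show ?case by (simp add: add_divide_distrib[symmetric])
  qed
qed

section \<open>Random initial values\<close>

lemma measurable_alt_step [measurable (raw)]:
  assumes "f \<in> borel_measurable N" "g \<in> borel_measurable N"
  shows "(\<lambda>x. alt_step b i n (f x) (g x)) \<in> borel_measurable N"
  unfolding alt_step_def using assms by measurable

lemma measurable_alt_chain [measurable]:
  "(\<lambda>p. chain (alt_step b i) (fst p) (snd p) n) \<in> borel_measurable (borel \<Otimes>\<^sub>M PiM UNIV (\<lambda>_. borel))"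
proof (induction n)
  case (Suc n)
  note [measurable] = Suc
  have [measurable]: "(\<lambda>p. snd p n) \<in> borel_measurable (borel \<Otimes>\<^sub>M PiM UNIV (\<lambda>_. borel))"
    by (rule measurable_compose[OF measurable_snd]) simp
  show ?case unfolding chain.simps by measurable
qed simp

text \<open>Independence is given for generated sigma-algebras. That these consist of events already
  contains the measurability of \<open>x0\<close>, and the product formula on rectangles identifies
  the joint law of \<open>x0\<close> and the whole sequence of holding times.\<close>

lemma (in prob_space) indep_initial_holding:
  fixes x0 :: "'a \<Rightarrow> real^2" and i0 :: "'a \<Rightarrow> 2" and S :: "nat \<Rightarrow> 'a \<Rightarrow> real"
  assumes S: "\<And>n. random_variable borel (S n)"
    and ind: "indep_set
       (sets (vimage_algebra (space M) (\<lambda>\<omega>. (x0 \<omega>, i0 \<omega>)) (borel \<Otimes>\<^sub>M count_space UNIV)))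
       (sets (vimage_algebra (space M) (\<lambda>\<omega> n. S n \<omega>) (Pi\<^sub>M UNIV (\<lambda>_. borel))))"
  shows "random_variable borel x0"
    and "distr M borel x0 \<Otimes>\<^sub>M distr M (Pi\<^sub>M UNIV (\<lambda>_. borel)) (\<lambda>\<omega> n. S n \<omega>)
       = distr M (borel \<Otimes>\<^sub>M Pi\<^sub>M UNIV (\<lambda>_. borel)) (\<lambda>\<omega>. (x0 \<omega>, \<lambda>n. S n \<omega>))"
proof -
  let ?V = "sets (vimage_algebra (space M) (\<lambda>\<omega>. (x0 \<omega>, i0 \<omega>)) (borel \<Otimes>\<^sub>M count_space UNIV))"
  let ?P = "Pi\<^sub>M (UNIV :: nat set) (\<lambda>_. borel :: real measure)"
  let ?S = "\<lambda>\<omega> n. S n \<omega>"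
  have x0V: "x0 -` B \<inter> space M \<in> ?V" if B: "B \<in> sets borel" for B
  proof -
    have "B \<times> UNIV \<in> sets (borel \<Otimes>\<^sub>M count_space UNIV)" using B by (intro pair_measureI) auto
    then have "(\<lambda>\<omega>. (x0 \<omega>, i0 \<omega>)) -` (B \<times> UNIV) \<inter> space M \<in> ?V" by (rule in_vimage_algebra)
    moreover have "(\<lambda>\<omega>. (x0 \<omega>, i0 \<omega>)) -` (B \<times> UNIV) = x0 -` B" by auto
    ultimately show ?thesis by simp
  qed
  have VM: "?V \<subseteq> events" using ind by (simp add: indep_sets2_eq)
  show x0[measurable]: "random_variable borel x0"
    by (rule measurableI) (use x0V VM in auto)
  have Sm[measurable]: "random_variable ?P ?S"
    by (rule measurable_PiM_single') (use S in auto)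
  show "distr M borel x0 \<Otimes>\<^sub>M distr M ?P ?S = distr M (borel \<Otimes>\<^sub>M ?P) (\<lambda>\<omega>. (x0 \<omega>, ?S \<omega>))"
  proof (rule pair_measure_eqI)
    show "sigma_finite_measure (distr M borel x0)" "sigma_finite_measure (distr M ?P ?S)"
      by (auto intro!: prob_space_imp_sigma_finite prob_space_distr)
    fix B C assume "B \<in> sets (distr M borel x0)" "C \<in> sets (distr M ?P ?S)"
    then have B[measurable]: "B \<in> sets borel" and C[measurable]: "C \<in> sets ?P" by simp_all
    have "?S -` C \<inter> space M \<in> sets (vimage_algebra (space M) ?S ?P)" by (rule in_vimage_algebra[OF C])
    with x0V[OF B] have "prob ((x0 -` B \<inter> space M) \<inter> (?S -` C \<inter> space M)) = prob (x0 -` B \<inter> space M) * prob (?S -` C \<inter> space M)"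
      using ind unfolding indep_sets2_eq by blast
    moreover have "(\<lambda>\<omega>. (x0 \<omega>, ?S \<omega>)) -` (B \<times> C) \<inter> space M = (x0 -` B \<inter> space M) \<inter> (?S -` C \<inter> space M)" by auto
    ultimately show "emeasure (distr M borel x0) B * emeasure (distr M ?P ?S) C
        = emeasure (distr M (borel \<Otimes>\<^sub>M ?P) (\<lambda>\<omega>. (x0 \<omega>, ?S \<omega>))) (B \<times> C)"
      by (simp add: emeasure_distr emeasure_eq_measure ennreal_mult)
  qed simp
qed

lemma (in prob_space) AE_pos_of_exp_law:
  assumes "random_variable borel S" "distr M borel S = exp_law"
  shows "AE \<omega> in M. 0 < S \<omega>"
proof -
  have "AE s in lborel. s \<noteq> (0::real)" by (rule AE_lborel_singleton)
  then have "AE s in exp_law. 0 < s"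
    by (subst AE_density) (auto simp: exponential_density_def elim: eventually_mono)
  then have "AE s in distr M borel S. 0 < s" by (simp only: assms(2))
  then show ?thesis using assms(1) by (subst (asm) AE_distr_iff) auto
qed

text \<open>Given the initial value, growth holds for almost every sequence of holding times; independence
  and Fubini's theorem then allow a random initial value.\<close>

lemma switched_growth:
  fixes A :: "2 \<Rightarrow> real^2^2"
  assumes g: "\<And>i. proj_fun (g i)" and r: "\<And>i. 0 < r i"
    and eq: "\<And>i x. x \<noteq> 0 \<Longrightarrow> resolv ((1 / r i) *\<^sub>R A i) (\<lambda>x. ln (norm x) + g (1 - i) x) x = ln (norm x) + g i x + \<kappa>"
    and sys: "switched_system M A r I X" and X0: "AE \<omega> in M. X 0 \<omega> \<noteq> 0"
  shows "AE \<omega> in M. ((\<lambda>t. ln (norm (X t \<omega>)) / t) \<longlongrightarrow> \<kappa> / ((1 / r 0 + 1 / r 1) / 2)) at_top"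
proof -
  interpret prob_space M using sys by (simp add: switched_system_def)
  obtain T where path: "AE \<omega> in M. T 0 \<omega> = 0 \<and>
           (\<forall>n t. T n \<omega> \<le> t \<and> t < T (Suc n) \<omega> \<longrightarrow> I t \<omega> = jump_chain (I 0 \<omega>) n)"
    and stoch: "let S = (\<lambda>n \<omega>. r (jump_chain (I 0 \<omega>) n) * (T (Suc n) \<omega> - T n \<omega>)) in
           indep_vars (\<lambda>_. borel) S UNIV \<and>
           (\<forall>n. distr M borel (S n) = exp_law) \<and>
           indep_set
             (sets (vimage_algebra (space M) (\<lambda>\<omega>. (X 0 \<omega>, I 0 \<omega>))
                (borel \<Otimes>\<^sub>M count_space UNIV)))
             (sets (vimage_algebra (space M) (\<lambda>\<omega> n. S n \<omega>) (Pi\<^sub>M UNIV (\<lambda>_. borel))))"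
    using sys unfolding switched_system_def markov_jump_process_def by auto
  define S where "S n \<omega> = r (jump_chain (I 0 \<omega>) n) * (T (Suc n) \<omega> - T n \<omega>)" for n \<omega>
  have indep: "indep_vars (\<lambda>_. borel) S UNIV" and law: "\<And>n. distr M borel (S n) = exp_law"
    and ind: "indep_set
             (sets (vimage_algebra (space M) (\<lambda>\<omega>. (X 0 \<omega>, I 0 \<omega>)) (borel \<Otimes>\<^sub>M count_space UNIV)))
             (sets (vimage_algebra (space M) (\<lambda>\<omega> n. S n \<omega>) (Pi\<^sub>M UNIV (\<lambda>_. borel))))"
    using stoch unfolding Let_def S_def[abs_def] by auto
  have S[measurable]: "random_variable borel (S n)" for n using indep by (auto simp: indep_vars_def)
  let ?P = "PiM (UNIV :: nat set) (\<lambda>_. borel :: real measure)"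
  note [measurable] = indep_initial_holding(1)[OF S ind]
  have Sm[measurable]: "random_variable ?P (\<lambda>\<omega> n. S n \<omega>)"
    by (rule measurable_PiM_single') (use S in auto)
  define b where "b i = (1 / r i) *\<^sub>R A i" for i
  \<comment> \<open>The starting index is fixed here. As it has only two values, discarding the null
    sets of both allows the random index \<open>I 0\<close> to be inserted later.\<close>
  have grow: "AE \<omega> in M. X 0 \<omega> \<noteq> 0 \<longrightarrow> (\<lambda>n. ln (norm (chain (alt_step b i) (X 0 \<omega>) (\<lambda>j. S j \<omega>) n)) / real n) \<longlonglongrightarrow> \<kappa>" for i
  proof -
    let ?L = "distr M borel (X 0)" and ?E = "distr M ?P (\<lambda>\<omega> n. S n \<omega>)"
    interpret L: prob_space ?L by (rule prob_space_distr) simp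
    interpret E: prob_space ?E by (rule prob_space_distr) simp
    interpret LE: pair_prob_space ?L ?E ..
    let ?Q = "\<lambda>p. fst p \<noteq> 0 \<longrightarrow> (\<lambda>n. ln (norm (chain (alt_step b i) (fst p) (snd p) n)) / real n) \<longlonglongrightarrow> \<kappa>"
    have [measurable]: "Measurable.pred (borel \<Otimes>\<^sub>M ?P) ?Q" by measurable
    have "AE s in ?E. ?Q (x, s)" for x
    proof (cases "x = 0")
      case False
      have [measurable]: "(\<lambda>s. chain (alt_step b i) x s n) \<in> borel_measurable ?P" for n
        using measurable_compose[OF measurable_Pair1'[of x borel ?P] measurable_alt_chain[of b i n]] by simp
      have "AE s in ?E. (\<lambda>n. ln (norm (chain (alt_step b i) x s n)) / real n) \<longlonglongrightarrow> \<kappa>"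
        using alternating_growth[where b = b and g = g, OF g _ indep law False, of \<kappa> i] eq
        by (subst AE_distr_iff) (auto simp: b_def)
      then show ?thesis by simp
    qed simp
    moreover have "Measurable.pred (?L \<Otimes>\<^sub>M ?E) ?Q" by measurable
    then have "{p \<in> space (?L \<Otimes>\<^sub>M ?E). ?Q p} \<in> sets (?L \<Otimes>\<^sub>M ?E)" unfolding pred_def .
    ultimately have "AE p in ?L \<Otimes>\<^sub>M ?E. ?Q p"
      by (intro LE.AE_pair_measure) blast+
    then show ?thesis
      unfolding indep_initial_holding(2)[OF S ind] by (subst (asm) AE_distr_iff) auto
  qed
  have hold: "AE \<omega> in M. (\<lambda>n. (\<Sum>k<n. S k \<omega> / r (jump_chain i k)) / real n) \<longlonglongrightarrow> (1 / r 0 + 1 / r 1) / 2" for i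
    by (rule average_holding_times[OF indep law])
  have pos: "AE \<omega> in M. \<forall>n. 0 < S n \<omega>"
    unfolding AE_all_countable by (intro allI AE_pos_of_exp_law S law)
  have int: "AE \<omega> in M. \<forall>t\<ge>0. ((\<lambda>s. A (I s \<omega>) *v X s \<omega>) has_integral (X t \<omega> - X 0 \<omega>)) {0..t}"
    using sys by (simp add: switched_system_def)
  from path pos int X0 grow[of 0] grow[of 1] hold[of 0] hold[of 1]
  show ?thesis
  proof eventually_elim
    case (elim \<omega>)
    define i where "i = I 0 \<omega>"
    let ?j = "jump_chain i" and ?T = "\<lambda>n. T n \<omega>" and ?X = "\<lambda>t. X t \<omega>"
    have T0: "?T 0 = 0" and I: "\<And>n t. ?T n \<le> t \<Longrightarrow> t < ?T (Suc n) \<Longrightarrow> I t \<omega> = ?j n"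
      using elim(1) by (auto simp: i_def)
    have Sn: "S n \<omega> = r (?j n) * (?T (Suc n) - ?T n)" for n by (simp add: S_def i_def)
    have inc: "?T (Suc n) = ?T n + S n \<omega> / r (?j n)" for n
      using r[of "?j n"] by (simp add: Sn)
    have mono: "?T n < ?T (Suc n)" for n
      using elim(2) r[of "?j n"] by (simp add: inc[of n])
    have Tsum: "?T n = (\<Sum>k<n. S k \<omega> / r (?j k))" for n
      by (induction n) (simp_all add: T0 inc)
    have Tnn: "0 \<le> ?T n" for n
      unfolding Tsum using elim(2) r by (intro sum_nonneg divide_nonneg_nonneg) (auto intro: less_imp_le)
    have flow: "?X t = mat_exp ((t - ?T n) *\<^sub>R A (?j n)) *v ?X (?T n)" if "?T n \<le> t" "t \<le> ?T (Suc n)" for n t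
      by (rule switched_path_between_jumps[OF Tnn mono, where I = "\<lambda>t. I t \<omega>"]) (use I elim(3) that in auto)
    have XT: "?X (?T n) = chain (alt_step b i) (?X 0) (\<lambda>j. S j \<omega>) n" for n
    proof (induction n)
      case (Suc n)
      have "S n \<omega> *\<^sub>R b (?j n) = (?T (Suc n) - ?T n) *\<^sub>R A (?j n)"
        using r[of "?j n"] by (simp add: b_def Sn)
      then show ?case using flow[of n "?T (Suc n)"] mono[of n] by (simp add: alt_step_def Suc less_imp_le)
    qed (simp add: T0)
    have Xne: "?X (?T n) \<noteq> 0" for n
      unfolding XT using elim(4) by (induction n) (auto simp: alt_step_def)
    define K where "K = mnorm (A 0) + mnorm (A 1)"
    have K: "mnorm (A i) \<le> K" for i
      using two_cases[of i] mnorm_nonneg[of "A 0"] mnorm_nonneg[of "A 1"] by (auto simp: K_def)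
    show ?case
    proof (rule growth_rate_interpolation[where T = ?T and L = "\<lambda>t. ln (norm (?X t))" and K = K])
      show "(\<lambda>n. ?T n / real n) \<longlonglongrightarrow> (1 / r 0 + 1 / r 1) / 2"
        unfolding Tsum using elim(7,8) two_cases[of i] by auto
      show "0 < (1 / r 0 + 1 / r 1) / 2" using r[of 0] r[of 1] by (simp add: add_pos_pos)
      show "(\<lambda>n. ln (norm (?X (?T n))) / real n) \<longlonglongrightarrow> \<kappa>"
        unfolding XT using elim(4-6) two_cases[of i] by auto
      show "0 \<le> K" using mnorm_nonneg[of "A 0"] mnorm_nonneg[of "A 1"] by (simp add: K_def)
      fix n t assume t: "?T n \<le> t" "t < ?T (Suc n)"
      have "\<bar>ln (norm (?X t)) - ln (norm (?X (?T n)))\<bar> \<le> mnorm (A (?j n)) * (t - ?T n)"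
        unfolding flow[OF t(1) less_imp_le[OF t(2)]] using t by (intro ln_norm_mat_exp_bound Xne) simp
      also have "\<dots> \<le> K * (t - ?T n)" using K t by (intro mult_right_mono) auto
      finally show "\<bar>ln (norm (?X t)) - ln (norm (?X (?T n)))\<bar> \<le> K * (t - ?T n)" .
    qed (use T0 mono in auto)
  qed
qed

section \<open>A realisation of the switched system\<close>

lemma switched_path_exists:
  fixes A :: "'i \<Rightarrow> real^'n^'n" and T :: "nat \<Rightarrow> real"
  assumes T0: "T 0 = 0" and mono: "\<And>n. T n < T (Suc n)" and unb: "\<And>t. \<exists>n. t < T n"
    and Y: "\<And>n. Y (Suc n) = mat_exp ((T (Suc n) - T n) *\<^sub>R A (i n)) *v Y n"
    and I: "\<And>n t. T n \<le> t \<Longrightarrow> t < T (Suc n) \<Longrightarrow> I t = i n"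
    and X: "\<And>n t. T n \<le> t \<Longrightarrow> t < T (Suc n) \<Longrightarrow> X t = mat_exp ((t - T n) *\<^sub>R A (i n)) *v Y n"
    and t: "0 \<le> t"
  shows "((\<lambda>s. A (I s) *v X s) has_integral (X t - X 0)) {0..t}"
proof -
  let ?f = "\<lambda>s. A (I s) *v X s" and ?Z = "\<lambda>n t. mat_exp ((t - T n) *\<^sub>R A (i n)) *v Y n"
  have XT: "X (T n) = Y n" for n using X[OF order_refl mono] by simp
  have sm: "strict_mono T" using mono by (simp add: strict_mono_Suc_iff)
  have Tnn: "0 \<le> T n" for n using strict_mono_less_eq[OF sm, of 0 n] T0 by simp
  have piece: "(?f has_integral (?Z n t - Y n)) {T n..t}" if t: "T n \<le> t" "t \<le> T (Suc n)" for n t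
  proof -
    have "((\<lambda>s. A (i n) *v ?Z n s) has_integral (?Z n t - ?Z n (T n))) {T n..t}"
      by (rule fundamental_theorem_of_calculus[OF t(1)])
        (use has_vector_derivative_mat_exp_shift[of "- T n" "A (i n)" "Y n"] in simp)
    then have "((\<lambda>s. A (i n) *v ?Z n s) has_integral (?Z n t - Y n)) {T n..t}" by simp
    then show ?thesis
      by (rule has_integral_spike[of "{t}", rotated 2]) (use I X t in auto)
  qed
  have upto: "(?f has_integral (Y n - Y 0)) {0..T n}" for n
  proof (induction n)
    case (Suc n)
    have "(?f has_integral (Y (Suc n) - Y n)) {T n..T (Suc n)}"
      using piece[of n "T (Suc n)"] mono[of n] unfolding Y[of n] by (simp add: less_imp_le)
    from has_integral_combine[OF Tnn less_imp_le[OF mono] Suc this] show ?case by simp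
  qed (simp add: T0 has_integral_refl)
  have "t < T (LEAST n. t < T n)" by (rule LeastI_ex[OF unb])
  then obtain n where n: "t < T n" "\<And>m. m < n \<Longrightarrow> \<not> t < T m"
    using not_less_Least[of _ "\<lambda>n. t < T n"] by blast
  have "n \<noteq> 0" using n(1) T0 t by (intro notI) simp
  then obtain m where "n = Suc m" by (cases n) auto
  then have m: "T m \<le> t" "t < T (Suc m)" using n(1) n(2)[of m] by auto
  from has_integral_combine[OF Tnn m(1) upto piece[OF m(1) less_imp_le[OF m(2)]]] m(2)
  have "(?f has_integral (?Z m t - Y 0)) {0..t}" by simp
  then show ?thesis using X[OF m] XT[of 0] T0 by simp
qed

lemma indep_vars_PiM_coordinates:
  assumes N: "\<And>n. prob_space (N n)" and s: "\<And>n. sets (N n) = sets L"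
  shows "prob_space.indep_vars (PiM (UNIV :: nat set) N) (\<lambda>_. L) (\<lambda>n \<omega>. \<omega> n) UNIV"
    and "distr (PiM UNIV N) L (\<lambda>\<omega>. \<omega> n) = N n"
proof -
  interpret N: prob_space "N n" for n by (rule N)
  interpret product_prob_space N UNIV ..
  interpret P: prob_space "PiM UNIV N" by (rule prob_space_PiM[OF N])
  have c[measurable]: "(\<lambda>\<omega>. \<omega> n) \<in> PiM UNIV N \<rightarrow>\<^sub>M L" for n
    unfolding measurable_cong_sets[OF refl s[of n, symmetric]] by simp
  show d: "distr (PiM UNIV N) L (\<lambda>\<omega>. \<omega> n) = N n" for n
    using PiM_component[of n] distr_cong[OF refl s[of n, symmetric], of "PiM UNIV N" "\<lambda>\<omega>. \<omega> n" "\<lambda>\<omega>. \<omega> n"] by simp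
  have "sets (PiM UNIV (\<lambda>_. L)) = sets (PiM UNIV N)" by (intro sets_PiM_cong refl) (simp add: s)
  then have "distr (PiM UNIV N) (PiM UNIV (\<lambda>_. L)) (\<lambda>\<omega>. \<lambda>i\<in>UNIV. \<omega> i) = PiM UNIV N"
    unfolding restrict_UNIV by (rule distr_id2)
  then show "P.indep_vars (\<lambda>_. L) (\<lambda>n \<omega>. \<omega> n) UNIV"
    by (subst P.indep_vars_iff_distr_eq_PiM) (auto simp: d)
qed

definition jump_time :: "(2 \<Rightarrow> real) \<Rightarrow> nat \<Rightarrow> (nat \<Rightarrow> real) \<Rightarrow> real" where
  "jump_time r n \<omega> = (\<Sum>k<n. \<omega> k / r (jump_chain 0 k))"

text \<open>On a path with increasing unbounded jump times this is the number of jumps up to and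
  including time \<open>t\<close>, which makes the index right-continuous; \<open>Suc n\<close>
  appears because \<open>jump_time r 0\<close> is the start and not a jump.\<close>

definition jump_count :: "(2 \<Rightarrow> real) \<Rightarrow> real \<Rightarrow> (nat \<Rightarrow> real) \<Rightarrow> nat" where
  "jump_count r t \<omega> = (LEAST n. t < jump_time r (Suc n) \<omega>)"

text \<open>The values at time 0 are fixed separately since they must be deterministic also on the null set
  of irregular holding times.\<close>

definition model_index :: "(2 \<Rightarrow> real) \<Rightarrow> real \<Rightarrow> (nat \<Rightarrow> real) \<Rightarrow> 2" where
  "model_index r t \<omega> = (if t = 0 then 0 else jump_chain 0 (jump_count r t \<omega>))"

definition model_state :: "(2 \<Rightarrow> real^2^2) \<Rightarrow> (2 \<Rightarrow> real) \<Rightarrow> real \<Rightarrow> (nat \<Rightarrow> real) \<Rightarrow> real^2" where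
  "model_state A r t \<omega> = (if t = 0 then axis 1 1 else
     (let n = jump_count r t \<omega> in mat_exp ((t - jump_time r n \<omega>) *\<^sub>R A (jump_chain 0 n)) *v
        chain (alt_step (\<lambda>i. (1 / r i) *\<^sub>R A i) 0) (axis 1 1) \<omega> n))"

text \<open>Needed for uniqueness in \<open>growth_exponent\<close>: if there were no realisation at
  all, every number would satisfy the described property. The holding times are the coordinates of a
  product of exponential laws, and the initial data are constant.\<close>

lemma switched_system_model:
  assumes r: "\<And>i. 0 < r i"
  shows "switched_system (PiM (UNIV :: nat set) (\<lambda>_. exp_law)) A r (model_index r) (model_state A r)"
proof -
  let ?M = "PiM (UNIV :: nat set) (\<lambda>_. exp_law)"
  interpret P: prob_space ?M by (rule prob_space_PiM) (rule prob_space_exp_law)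
  have indep: "P.indep_vars (\<lambda>_. borel) (\<lambda>n \<omega>. \<omega> n) UNIV" and law: "\<And>n. distr ?M borel (\<lambda>\<omega>. \<omega> n) = exp_law"
    by (rule indep_vars_PiM_coordinates, rule prob_space_exp_law, simp)+
  have c[measurable]: "(\<lambda>\<omega>. \<omega> n) \<in> borel_measurable ?M" for n using indep by (auto simp: P.indep_vars_def)
  have [measurable]: "(\<lambda>\<omega>. jump_time r n \<omega>) \<in> borel_measurable ?M" for n
    unfolding jump_time_def by measurable
  have [measurable]: "(\<lambda>\<omega>. jump_count r t \<omega>) \<in> ?M \<rightarrow>\<^sub>M count_space UNIV" for t
    unfolding jump_count_def by measurable
  have Im: "model_index r t \<in> ?M \<rightarrow>\<^sub>M count_space UNIV" for t
    unfolding model_index_def by measurable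
  have S_eq: "r (jump_chain (model_index r 0 \<omega>) n) * (jump_time r (Suc n) \<omega> - jump_time r n \<omega>) = \<omega> n" for n \<omega>
    using r[of "jump_chain 0 n"] by (simp add: model_index_def jump_time_def)
  have pos: "AE \<omega> in ?M. \<forall>n. 0 < \<omega> n"
    unfolding AE_all_countable by (intro allI P.AE_pos_of_exp_law c law)
  have hold: "AE \<omega> in ?M. (\<lambda>n. jump_time r n \<omega> / real n) \<longlonglongrightarrow> (1 / r 0 + 1 / r 1) / 2"
    unfolding jump_time_def by (rule P.average_holding_times[OF indep law])
  have regular: "AE \<omega> in ?M. (\<forall>n. jump_time r n \<omega> < jump_time r (Suc n) \<omega>) \<and> (\<forall>t. \<exists>n. t < jump_time r n \<omega>)"
    using pos hold
  proof eventually_elim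
    case (elim \<omega>)
    have "jump_time r n \<omega> < jump_time r (Suc n) \<omega>" for n
      using elim(1) r by (simp add: jump_time_def)
    moreover have "\<exists>n. t < jump_time r n \<omega>" for t
    proof -
      have "0 < (1 / r 0 + 1 / r 1) / 2" using r[of 0] r[of 1] by (simp add: add_pos_pos)
      then have "filterlim (\<lambda>n. jump_time r n \<omega> / real n * real n) at_top sequentially"
        by (rule filterlim_tendsto_pos_mult_at_top[OF elim(2) _ filterlim_real_sequentially])
      moreover have "jump_time r n \<omega> / real n * real n = jump_time r n \<omega>" for n
        by (cases n) (auto simp: jump_time_def)
      ultimately have "filterlim (\<lambda>n. jump_time r n \<omega>) at_top sequentially" by simp
      then show ?thesis unfolding filterlim_at_top_dense by (auto simp: eventually_sequentially)
    qed
    ultimately show ?case by blast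
  qed
  have count: "jump_count r t \<omega> = n" if reg: "\<And>n. jump_time r n \<omega> < jump_time r (Suc n) \<omega>"
    and t: "jump_time r n \<omega> \<le> t" "t < jump_time r (Suc n) \<omega>" for n t \<omega>
    unfolding jump_count_def
  proof (rule Least_equality)
    show "t < jump_time r (Suc n) \<omega>" by (rule t(2))
    fix m assume m: "t < jump_time r (Suc m) \<omega>"
    have sm: "strict_mono (\<lambda>n. jump_time r n \<omega>)" using reg by (simp add: strict_mono_Suc_iff)
    have "jump_time r n \<omega> < jump_time r (Suc m) \<omega>" using m t(1) by simp
    then have "n < Suc m" using strict_mono_less[OF sm] by simp
    then show "n \<le> m" by simp
  qed
  have index: "model_index r t \<omega> = jump_chain 0 n"
    and state: "model_state A r t \<omega> = mat_exp ((t - jump_time r n \<omega>) *\<^sub>R A (jump_chain 0 n)) *v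
        chain (alt_step (\<lambda>i. (1 / r i) *\<^sub>R A i) 0) (axis 1 1) \<omega> n"
    if reg: "\<And>n. jump_time r n \<omega> < jump_time r (Suc n) \<omega>"
      and t: "jump_time r n \<omega> \<le> t" "t < jump_time r (Suc n) \<omega>" for n t \<omega>
  proof -
    have n0: "n = 0" if "t = 0"
    proof -
      have "jump_time r 0 \<omega> \<le> t" "t < jump_time r (Suc 0) \<omega>"
        using reg[of 0] that by (simp_all add: jump_time_def)
      then have "jump_count r t \<omega> = 0" by (rule count[OF reg])
      then show ?thesis using count[OF reg t] by simp
    qed
    show "model_index r t \<omega> = jump_chain 0 n"
      using n0 count[OF reg t] by (auto simp: model_index_def jump_chain_def)
    show "model_state A r t \<omega> = mat_exp ((t - jump_time r n \<omega>) *\<^sub>R A (jump_chain 0 n)) *v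
        chain (alt_step (\<lambda>i. (1 / r i) *\<^sub>R A i) 0) (axis 1 1) \<omega> n"
    proof (cases "t = 0")
      case True
      then show ?thesis using n0 by (simp add: model_state_def jump_time_def)
    next
      case False
      then show ?thesis using count[OF reg t] by (simp add: model_state_def Let_def)
    qed
  qed
  have X0: "model_state A r 0 = (\<lambda>_. axis 1 1)" and I0: "model_index r 0 = (\<lambda>_. 0)"
    by (simp_all add: model_state_def model_index_def fun_eq_iff)
  have "markov_jump_process ?M r (model_state A r 0) (model_index r)"
    unfolding markov_jump_process_def
  proof (intro conjI allI impI exI[of _ "jump_time r"])
    show "model_index r t \<in> ?M \<rightarrow>\<^sub>M count_space UNIV" for t by (rule Im)
    show "AE \<omega> in ?M. jump_time r 0 \<omega> = 0 \<and> (\<forall>n t. jump_time r n \<omega> \<le> t \<and> t < jump_time r (Suc n) \<omega> \<longrightarrow>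
          model_index r t \<omega> = jump_chain (model_index r 0 \<omega>) n)"
      using regular
    proof eventually_elim
      case (elim \<omega>)
      then show ?case using index by (simp add: I0 jump_time_def[of r 0])
    qed
    have "P.indep_set (sets (vimage_algebra (space ?M) (\<lambda>\<omega>. (axis 1 1 :: real^2, 0 :: 2)) (borel \<Otimes>\<^sub>M count_space UNIV)))
             (sets (vimage_algebra (space ?M) (\<lambda>\<omega> n. \<omega> n) (Pi\<^sub>M UNIV (\<lambda>_. borel))))"
      (is "P.indep_set ?U ?W")
      unfolding P.indep_sets2_eq
    proof (intro conjI ballI)
      \<comment> \<open>Constant initial data generate the trivial sigma-algebra, so independence
        reduces to the cases of the empty set and the whole space.\<close>
      have U: "a = {} \<or> a = space ?M" if "a \<in> ?U" for a
        using that by (subst (asm) sets_vimage_algebra2) (auto simp: space_pair_measure split: if_splits)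
      show "?U \<subseteq> P.events" using U by blast
      have "(\<lambda>\<omega> n. \<omega> n) \<in> ?M \<rightarrow>\<^sub>M Pi\<^sub>M UNIV (\<lambda>_. borel)"
        by (rule measurable_PiM_single') (use c in auto)
      then show "?W \<subseteq> P.events"
        by (subst sets_vimage_algebra2) (auto simp: space_PiM)
      show "P.prob (a \<inter> b) = P.prob a * P.prob b" if "a \<in> ?U" "b \<in> ?W" for a b
      proof -
        have "b \<in> P.events" using that \<open>?W \<subseteq> P.events\<close> by blast
        then have "space ?M \<inter> b = b" using sets.sets_into_space by blast
        then show ?thesis using U[OF that(1)] by (auto simp: P.prob_space)
      qed
    qed
    then show "let S = \<lambda>n \<omega>. r (jump_chain (model_index r 0 \<omega>) n) * (jump_time r (Suc n) \<omega> - jump_time r n \<omega>)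
     in P.indep_vars (\<lambda>_. borel) S UNIV \<and> (\<forall>n. distr ?M borel (S n) = exp_law) \<and>
        P.indep_set (sets (vimage_algebra (space ?M) (\<lambda>\<omega>. (model_state A r 0 \<omega>, model_index r 0 \<omega>)) (borel \<Otimes>\<^sub>M count_space UNIV)))
             (sets (vimage_algebra (space ?M) (\<lambda>\<omega> n. S n \<omega>) (Pi\<^sub>M UNIV (\<lambda>_. borel))))"
      unfolding Let_def S_eq X0 unfolding I0 using indep law by blast
  qed
  moreover have "AE \<omega> in ?M. \<forall>t\<ge>0. ((\<lambda>s. A (model_index r s \<omega>) *v model_state A r s \<omega>) has_integral
      (model_state A r t \<omega> - model_state A r 0 \<omega>)) {0..t}"
    using regular
  proof eventually_elim
    case (elim \<omega>)
    let ?Y = "chain (alt_step (\<lambda>i. (1 / r i) *\<^sub>R A i) 0) (axis 1 1) \<omega>"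
    show ?case
    proof (intro allI impI)
      fix t :: real assume t: "0 \<le> t"
      show "((\<lambda>s. A (model_index r s \<omega>) *v model_state A r s \<omega>) has_integral
        (model_state A r t \<omega> - model_state A r 0 \<omega>)) {0..t}"
      proof (rule switched_path_exists[where T = "\<lambda>n. jump_time r n \<omega>" and i = "jump_chain 0" and Y = ?Y, OF _ _ _ _ _ _ t])
        show "?Y (Suc n) = mat_exp ((jump_time r (Suc n) \<omega> - jump_time r n \<omega>) *\<^sub>R A (jump_chain 0 n)) *v ?Y n" for n
          by (simp add: alt_step_def jump_time_def)
        show "model_index r t \<omega> = jump_chain 0 n"
          and "model_state A r t \<omega> = mat_exp ((t - jump_time r n \<omega>) *\<^sub>R A (jump_chain 0 n)) *v ?Y n"
          if "jump_time r n \<omega> \<le> t" "t < jump_time r (Suc n) \<omega>" for n t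
          using index[OF _ that] state[OF _ that] elim by blast+
      qed (use elim in \<open>auto simp: jump_time_def[of r 0]\<close>)
    qed
  qed
  ultimately show ?thesis unfolding switched_system_def using P.prob_space_axioms by blast
qed

text \<open>All realisations share the quotient of the gain \<open>\<kappa>\<close> per jump by the
  mean holding time; the model process shows that no other number has this property.\<close>

lemma growth_exponent_eq:
  fixes A :: "2 \<Rightarrow> real^2^2"
  assumes g: "\<And>i. proj_fun (g i)" and r: "\<And>i. 0 < \<gamma> * lam i"
    and eq: "\<And>i x. x \<noteq> 0 \<Longrightarrow>
       resolv ((1 / (\<gamma> * lam i)) *\<^sub>R A i) (\<lambda>x. ln (norm x) + g (1 - i) x) x = ln (norm x) + g i x + \<kappa>"
  shows "growth_exponent A lam \<gamma> = \<kappa> / ((1 / (\<gamma> * lam 0) + 1 / (\<gamma> * lam 1)) / 2)"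
  unfolding growth_exponent_def
proof (rule the_equality)
  let ?r = "\<lambda>i. \<gamma> * lam i" and ?c = "\<kappa> / ((1 / (\<gamma> * lam 0) + 1 / (\<gamma> * lam 1)) / 2)"
  have *: "AE \<omega> in M. ((\<lambda>t. ln (norm (X t \<omega>)) / t) \<longlongrightarrow> ?c) at_top"
    if "switched_system M A ?r I X" "AE \<omega> in M. X 0 \<omega> \<noteq> 0" for M :: "(nat \<Rightarrow> real) measure" and I X
    by (rule switched_growth[where r = ?r, OF g r eq that])
  then show "\<forall>(M :: (nat \<Rightarrow> real) measure) I X. switched_system M A ?r I X \<and> (AE \<omega> in M. X 0 \<omega> \<noteq> 0) \<longrightarrow>
        (AE \<omega> in M. ((\<lambda>t. ln (norm (X t \<omega>)) / t) \<longlongrightarrow> ?c) at_top)" by blast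
  fix c assume c: "\<forall>(M :: (nat \<Rightarrow> real) measure) I X. switched_system M A ?r I X \<and> (AE \<omega> in M. X 0 \<omega> \<noteq> 0) \<longrightarrow>
        (AE \<omega> in M. ((\<lambda>t. ln (norm (X t \<omega>)) / t) \<longlongrightarrow> c) at_top)"
  let ?M = "PiM (UNIV :: nat set) (\<lambda>_. exp_law)" and ?X = "model_state A ?r"
  interpret P: prob_space ?M by (rule prob_space_PiM) (rule prob_space_exp_law)
  have sys: "switched_system ?M A ?r (model_index ?r) ?X" by (rule switched_system_model[OF r])
  have X0: "AE \<omega> in ?M. ?X 0 \<omega> \<noteq> 0" by (simp add: model_state_def axis_eq_0_iff)
  have "AE \<omega> in ?M. ((\<lambda>t. ln (norm (?X t \<omega>)) / t) \<longlongrightarrow> c) at_top" using c sys X0 by blast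
  with *[OF sys X0] have "AE \<omega> in ?M. c = ?c"
    by eventually_elim (rule tendsto_unique[OF trivial_limit_at_top_linorder])
  then show "c = ?c" by simp
qed

section \<open>Positivity for fast switching\<close>

text \<open>Infinitesimal criterion for a resolvent inequality:
  \<open>exp (- t) * (\<phi> t - \<phi>' t)\<close> is the derivative of
  \<open>- exp (- t) * \<phi> t\<close>, so the hypothesis may be integrated against the exponential
  density. The linear bound on \<phi> removes the boundary term at infinity.\<close>

lemma exp_law_mean_ge:
  fixes \<phi> \<psi> :: "real \<Rightarrow> real"
  assumes d: "\<And>t. (\<phi> has_real_derivative \<phi>' t) (at t)" and c: "continuous_on UNIV \<psi>"
    and i\<psi>: "integrable exp_law \<psi>" and b: "\<And>t. 0 \<le> t \<Longrightarrow> \<bar>\<phi> t\<bar> \<le> \<alpha> + \<beta> * t"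
    and ge: "\<And>t. 0 \<le> t \<Longrightarrow> \<delta> \<le> \<phi>' t + \<psi> t - \<phi> t"
  shows "\<phi> 0 + \<delta> \<le> (\<integral>t. \<psi> t \<partial>exp_law)"
proof -
  interpret prob_space exp_law by (rule prob_space_exp_law)
  have [measurable]: "\<psi> \<in> borel_measurable borel" by (rule borel_measurable_continuous_onI[OF c])
  let ?f = "\<lambda>t. \<psi> t - \<delta>"
  have i: "integrable exp_law ?f" using i\<psi> by simp
  have fin: "\<phi> 0 - exp (- T) * \<phi> T \<le> (\<integral>t. indicator {..T} t *\<^sub>R ?f t \<partial>exp_law)" if T: "0 \<le> T" for T
  proof -
    have h1: "((\<lambda>t. exp (- t) * (\<phi> t - \<phi>' t)) has_integral (- exp (- T) * \<phi> T - - exp (- 0) * \<phi> 0)) {0..T}"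
      by (rule fundamental_theorem_of_calculus[OF T])
        (auto intro!: derivative_eq_intros has_field_derivative_at_within[OF d]
          simp: has_real_derivative_iff_has_vector_derivative[symmetric] algebra_simps)
    have cf: "continuous_on {0..T} (\<lambda>t. exp (- t) * ?f t)"
      by (intro continuous_intros continuous_on_subset[OF c]) auto
    have "- exp (- T) * \<phi> T - - exp (- 0) * \<phi> 0 \<le> integral {0..T} (\<lambda>t. exp (- t) * ?f t)"
    proof (rule has_integral_le[OF h1])
      show "((\<lambda>t. exp (- t) * ?f t) has_integral integral {0..T} (\<lambda>t. exp (- t) * ?f t)) {0..T}"
        by (intro integrable_integral integrable_continuous_real cf)
      show "exp (- t) * (\<phi> t - \<phi>' t) \<le> exp (- t) * ?f t" if "t \<in> {0..T}" for t
        using ge[of t] that by (intro mult_left_mono) auto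
    qed
    also have "integral {0..T} (\<lambda>t. exp (- t) * ?f t) = (LINT t:{0..T}|lborel. exp (- t) * ?f t)"
      by (rule set_borel_integral_eq_integral(2)[symmetric]) (rule borel_integrable_atLeastAtMost', rule cf)
    also have "\<dots> = (\<integral>t. exponential_density 1 t * (indicator {..T} t *\<^sub>R ?f t) \<partial>lborel)"
      unfolding set_lebesgue_integral_def
      by (intro Bochner_Integration.integral_cong refl) (auto simp: exponential_density_def split: split_indicator)
    also have "\<dots> = (\<integral>t. indicator {..T} t *\<^sub>R ?f t \<partial>exp_law)"
      by (subst integral_exp_law) auto
    finally show ?thesis by simp
  qed
  have lim: "((\<lambda>T. \<integral>t. indicator {..T} t *\<^sub>R ?f t \<partial>exp_law) \<longlongrightarrow> (\<integral>t. ?f t \<partial>exp_law)) at_top"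
    by (rule tendsto_integral_at_top[OF _ i]) simp
  have l0: "((\<lambda>T. \<phi> 0 - exp (- T) * \<phi> T) \<longlongrightarrow> \<phi> 0) at_top"
  proof -
    have "((\<lambda>T. exp (- T) * \<phi> T) \<longlongrightarrow> 0) at_top"
    proof (rule Lim_null_comparison)
      have "((\<lambda>T. \<alpha> / exp T + \<beta> * (T ^ 1 / exp T)) \<longlongrightarrow> 0 + \<beta> * 0) at_top"
        by (intro tendsto_add tendsto_mult[OF tendsto_const] tendsto_power_div_exp_0
            real_tendsto_divide_at_top[OF tendsto_const exp_at_top])
      then show "((\<lambda>T. \<alpha> / exp T + \<beta> * (T ^ 1 / exp T)) \<longlongrightarrow> 0) at_top" by simp
      show "\<forall>\<^sub>F T in at_top. norm (exp (- T) * \<phi> T) \<le> \<alpha> / exp T + \<beta> * (T ^ 1 / exp T)"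
        using eventually_ge_at_top[of 0]
      proof eventually_elim
        case (elim T)
        have "exp (- T) * \<bar>\<phi> T\<bar> \<le> exp (- T) * (\<alpha> + \<beta> * T)" using b[OF elim] by (intro mult_left_mono) auto
        then show ?case by (simp add: exp_minus abs_mult field_simps)
      qed
    qed
    then show ?thesis using tendsto_diff[OF tendsto_const[of "\<phi> 0"]] by fastforce
  qed
  have "\<phi> 0 \<le> (\<integral>t. ?f t \<partial>exp_law)"
    by (rule tendsto_le[OF trivial_limit_at_top_linorder lim l0 eventually_mono[OF eventually_ge_at_top[of 0] fin]])
  then show ?thesis using i\<psi> prob_space by simp
qed

text \<open>The difference \<open>k = h - g\<close> is bounded and satisfies
  \<open>k_i + d_i - \<kappa> \<le> R_i k_(1-i)\<close>. Suprema over all directions give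
  \<open>S_i \<le> S_(1-i) - d_i + \<kappa>\<close>, and adding both cases gives
  \<open>d_0 + d_1 \<le> 2 \<kappa>\<close>.\<close>

lemma growth_pos_of_subpotential:
  assumes g: "\<And>i. proj_fun (g i)" and h: "\<And>i. proj_fun (h i)"
    and eq: "\<And>i x. x \<noteq> 0 \<Longrightarrow> resolv (b i) (\<lambda>x. ln (norm x) + g (1 - i) x) x = ln (norm x) + g i x + \<kappa>"
    and ge: "\<And>i x. x \<noteq> 0 \<Longrightarrow> ln (norm x) + h i x + d i \<le> resolv (b i) (\<lambda>x. ln (norm x) + h (1 - i) x) x"
    and d: "\<And>i. 0 < d (i::2)"
  shows "0 < \<kappa>"
proof -
  let ?k = "\<lambda>i x. h i x - g i x"
  have k: "proj_fun (?k i)" for i by (intro proj_fun_diff g h)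
  have step: "?k i x + d i - \<kappa> \<le> resolv (b i) (?k (1 - i)) x" if x: "x \<noteq> 0" for i x
  proof -
    have "resolv (b i) (?k (1 - i)) x = resolv (b i) (h (1 - i)) x - resolv (b i) (g (1 - i)) x"
      using markov_op_diff[OF markov_op_resolv h g, of "b i" "1 - i" "1 - i"] by simp
    then show ?thesis
      using eq[OF x, of i] ge[OF x, of i] unfolding resolv_log_fun[OF g x] resolv_log_fun[OF h x] by linarith
  qed
  define S where "S i = (SUP x\<in>-{0}. ?k i x)" for i
  have bdd: "bdd_above (?k i ` (-{0}))" for i
  proof -
    obtain C where C: "\<And>x. \<bar>?k i x\<bar> \<le> C" using proj_fun_bounded[OF k] by blast
    show ?thesis
      by (rule bdd_aboveI2[of _ _ C]) (use C abs_le_D1 in blast)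
  qed
  have le_S: "?k i x \<le> S i" if "x \<noteq> 0" for i x
    unfolding S_def using that by (intro cSUP_upper bdd) auto
  have "S i \<le> S (1 - i) - d i + \<kappa>" for i
    unfolding S_def[of i]
  proof (rule cSUP_least)
    have "(axis 1 1 :: real^2) \<in> -{0}" by (simp add: axis_eq_0_iff)
    then show "-{0::real^2} \<noteq> {}" by blast
    fix x :: "real^2" assume "x \<in> -{0}"
    then have x: "x \<noteq> 0" by simp
    show "?k i x \<le> S (1 - i) - d i + \<kappa>"
      using step[OF x, of i] markov_op_bounds(2)[OF markov_op_resolv k x, of "1 - i" "S (1 - i)" "b i"] le_S by fastforce
  qed
  from this[of 0] this[of 1] show ?thesis using d[of 0] d[of 1] by simp
qed

lemma bounded_on_unit_box:
  fixes f :: "real \<Rightarrow> real \<Rightarrow> real \<Rightarrow> real"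
  assumes "continuous_on UNIV (\<lambda>p. f (fst p) (fst (snd p)) (snd (snd p)))"
  shows "\<exists>C\<ge>0. \<forall>e u w. 0 \<le> e \<longrightarrow> e \<le> 1 \<longrightarrow> \<bar>u\<bar> \<le> 1 \<longrightarrow> \<bar>w\<bar> \<le> 1 \<longrightarrow> \<bar>f e u w\<bar> \<le> C"
proof -
  let ?S = "{0..1::real} \<times> {-1..1::real} \<times> {-1..1::real}"
  have "compact ((\<lambda>p. f (fst p) (fst (snd p)) (snd (snd p))) ` ?S)"
    by (intro compact_continuous_image continuous_on_subset[OF assms] compact_Times) auto
  then have "bounded ((\<lambda>p. f (fst p) (fst (snd p)) (snd (snd p))) ` ?S)" by (rule compact_imp_bounded)
  then obtain C where C': "\<forall>y\<in>(\<lambda>p. f (fst p) (fst (snd p)) (snd (snd p))) ` ?S. norm y \<le> C"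
    unfolding bounded_iff by blast
  have C: "\<bar>f (fst p) (fst (snd p)) (snd (snd p))\<bar> \<le> C" if "p \<in> ?S" for p
    using bspec[OF C' imageI[OF that]] by simp
  have "0 \<le> C" using C[of "(0, 0, 0)"] by auto
  moreover have "\<bar>f e u w\<bar> \<le> C" if "0 \<le> e" "e \<le> 1" "\<bar>u\<bar> \<le> 1" "\<bar>w\<bar> \<le> 1" for e u w
    using C[of "(e, u, w)"] that by (simp add: abs_le_iff)
  ultimately show ?thesis by blast
qed

text \<open>In eigencoordinates of the mean matrix \<open>L\<close> with eigenvalues
  \<open>lp\<close> and \<open>- lm\<close>, the matrices are \<open>A 0 = L + l B\<close> and
  \<open>A 1 = L - (1 - l) B\<close>, where the \<open>b\<close> are the entries of
  \<open>B = A 0 - A 1\<close>. A nonzero \<open>b12\<close> lets the noise push the contracting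
  direction off itself.\<close>

locale averaged_saddle =
  fixes A :: "2 \<Rightarrow> real^2^2" and bu bw :: "real^2" and l lp lm b11 b12 b21 b22 :: real
  assumes l: "0 < l" "l < 1" and lp: "0 < lp" and lm: "0 < lm" and b12: "b12 \<noteq> 0"
    and inj: "\<And>x. bu \<bullet> x = 0 \<Longrightarrow> bw \<bullet> x = 0 \<Longrightarrow> x = 0"
    and u_A0: "\<And>x. bu \<bullet> (A 0 *v x) = lp * (bu \<bullet> x) + l * (b11 * (bu \<bullet> x) + b12 * (bw \<bullet> x))"
    and u_A1: "\<And>x. bu \<bullet> (A 1 *v x) = lp * (bu \<bullet> x) - (1 - l) * (b11 * (bu \<bullet> x) + b12 * (bw \<bullet> x))"
    and w_A0: "\<And>x. bw \<bullet> (A 0 *v x) = - lm * (bw \<bullet> x) + l * (b21 * (bu \<bullet> x) + b22 * (bw \<bullet> x))"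
    and w_A1: "\<And>x. bw \<bullet> (A 1 *v x) = - lm * (bw \<bullet> x) - (1 - l) * (b21 * (bu \<bullet> x) + b22 * (bw \<bullet> x))"
begin

text \<open>In the eigencoordinates \<open>u, w\<close> of the mean matrix let \<open>N = u\<^sup>2 + \<eta> w\<^sup>2\<close> and let \<open>q\<close> be its
  derivative along \<open>B = A 0 - A 1\<close>. The functions \<open>dN\<close>, \<open>dq\<close>, \<open>dK\<close> are the derivatives of \<open>N\<close>, \<open>q\<close> and
  \<open>q / N\<close> at the point \<open>(u, w)\<close> in the direction \<open>(u', w')\<close>.\<close>

definition "N \<eta> u w = u\<^sup>2 + \<eta> * (w::real)\<^sup>2"
definition "q \<eta> u w = 2 * (b11 * u\<^sup>2 + (b12 + \<eta> * b21) * u * w + \<eta> * b22 * w\<^sup>2)"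
definition "dN \<eta> u w u' w' = 2 * (u * u' + \<eta> * w * (w'::real))"
definition "dq \<eta> u w u' w' = 2 * (2 * b11 * u * u' + (b12 + \<eta> * b21) * (u' * w + u * w') + 2 * \<eta> * b22 * w * w')"
definition "dK \<eta> u w u' w' = dq \<eta> u w u' w' / N \<eta> u w - q \<eta> u w * dN \<eta> u w u' w' / (N \<eta> u w)\<^sup>2"

text \<open>The corrector of the two-state chain: the differences
  \<open>cf (1 - i) - cf i = -1, 1\<close> make the jump term cancel the deviation of
  \<open>A i\<close> from the mean. The additive constant is chosen so that \<open>cf i\<close>
  times the coefficient of \<open>B\<close> in \<open>A i\<close> is \<open>l (1 - l)\<close> in
  both states.\<close>

definition "cf (i::2) = (if i = 0 then 1 - l else - l)"

text \<open>The perturbed test function of averaging. One logarithm of a quadratic form minus half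
  of another is of logarithmic degree 2 - 1 = 1, as the potential must be. The degenerate form
  yields growth near the contracting direction, and the subtracted round form compensates its loss
  at intermediate directions.\<close>

definition "H \<eta> \<gamma> i u w = ln (N \<eta> u w) - ln (N 1 u w) / 2
   + cf i * ((q \<eta> u w / N \<eta> u w - q 1 u w / N 1 u w / 2) / \<gamma>)"

definition "\<Phi> \<eta> \<gamma> i u w =
   dN \<eta> u w (lp * u) (- lm * w) / N \<eta> u w - dN 1 u w (lp * u) (- lm * w) / N 1 u w / 2
   + l * (1 - l) / \<gamma> * (dK \<eta> u w (b11 * u + b12 * w) (b21 * u + b22 * w) - dK 1 u w (b11 * u + b12 * w) (b21 * u + b22 * w) / 2)
   + cf i / \<gamma> * (dK \<eta> u w (lp * u) (- lm * w) - dK 1 u w (lp * u) (- lm * w) / 2)"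

section \<open>Drift of the test function and its expansion for fast switching\<close>

lemma N_pos: "0 < \<eta> \<Longrightarrow> u \<noteq> 0 \<or> w \<noteq> 0 \<Longrightarrow> 0 < N \<eta> u w"
  by (auto simp: N_def add_pos_nonneg add_nonneg_pos)

lemma dN_linear: "dN \<eta> u w (a + c * a') (b + c * b') = dN \<eta> u w a b + c * dN \<eta> u w a' b'"
  by (simp add: dN_def algebra_simps)

lemma dK_linear: "dK \<eta> u w (a + c * a') (b + c * b') = dK \<eta> u w a b + c * dK \<eta> u w a' b'"
proof -
  have "dq \<eta> u w (a + c * a') (b + c * b') = dq \<eta> u w a b + c * dq \<eta> u w a' b'"
    by (simp add: dq_def algebra_simps)
  then show ?thesis unfolding dK_def dN_linear by (simp add: add_divide_distrib algebra_simps)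
qed

lemma q_eq_dN: "q \<eta> u w = dN \<eta> u w (b11 * u + b12 * w) (b21 * u + b22 * w)"
  by (simp add: q_def dN_def power2_eq_square algebra_simps)

lemma H_derivative:
  assumes u: "(u has_real_derivative u') (at t)" and w: "(w has_real_derivative w') (at t)"
    and \<eta>: "0 < \<eta>" and ne: "u t \<noteq> 0 \<or> w t \<noteq> 0"
  shows "((\<lambda>t. H \<eta> \<gamma> i (u t) (w t)) has_real_derivative
     dN \<eta> (u t) (w t) u' w' / N \<eta> (u t) (w t) - dN 1 (u t) (w t) u' w' / N 1 (u t) (w t) / 2
     + cf i * ((dK \<eta> (u t) (w t) u' w' - dK 1 (u t) (w t) u' w' / 2) / \<gamma>)) (at t)"
proof -
  have Nd: "((\<lambda>t. N \<eta> (u t) (w t)) has_real_derivative dN \<eta> (u t) (w t) u' w') (at t)" for \<eta>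
    unfolding N_def dN_def by (auto intro!: derivative_eq_intros u w simp: algebra_simps)
  have qd: "((\<lambda>t. q \<eta> (u t) (w t)) has_real_derivative dq \<eta> (u t) (w t) u' w') (at t)" for \<eta>
    unfolding q_def dq_def by (auto intro!: derivative_eq_intros u w simp: algebra_simps)
  have Kd: "((\<lambda>t. q \<eta> (u t) (w t) / N \<eta> (u t) (w t)) has_real_derivative dK \<eta> (u t) (w t) u' w') (at t)" if "0 < \<eta>" for \<eta>
    using DERIV_divide[OF qd[of \<eta>] Nd[of \<eta>]] N_pos[OF that ne]
    by (simp add: dK_def diff_divide_distrib power2_eq_square)
  have Ld: "((\<lambda>t. ln (N \<eta> (u t) (w t))) has_real_derivative dN \<eta> (u t) (w t) u' w' / N \<eta> (u t) (w t)) (at t)" if "0 < \<eta>" for \<eta>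
    using DERIV_chain2[where f = ln, OF DERIV_ln_divide[OF N_pos[OF that ne]] Nd] by simp
  show ?thesis
    unfolding H_def
    by (intro DERIV_add DERIV_diff DERIV_cmult DERIV_cdivide Ld Kd \<eta>) auto
qed

text \<open>The derivative of the logarithms along the deviation from the mean is cancelled by the
  jump part of the corrector. What remains is the mean drift, the second derivative along
  \<open>B\<close> with the common factor \<open>l (1 - l) / \<gamma>\<close>, and a term of order
  1/\<gamma> along the mean flow.\<close>

lemma H_drift:
  assumes \<gamma>: "0 < \<gamma>" and \<eta>: "0 < \<eta>"
  defines "a u w i \<equiv> lp * u + (if i = 0 then l else - (1 - l)) * (b11 * u + b12 * w)"
    and "b u w i \<equiv> - lm * w + (if i = 0 then l else - (1 - l)) * (b21 * u + b22 * w)"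
  shows "dN \<eta> u w (a u w i) (b u w i) / N \<eta> u w - dN 1 u w (a u w i) (b u w i) / N 1 u w / 2
     + cf i * ((dK \<eta> u w (a u w i) (b u w i) - dK 1 u w (a u w i) (b u w i) / 2) / \<gamma>)
     + \<gamma> * (if i = 0 then l else 1 - l) * (H \<eta> \<gamma> (1 - i) u w - H \<eta> \<gamma> i u w) = \<Phi> \<eta> \<gamma> i u w"
proof -
  let ?k = "(q \<eta> u w / N \<eta> u w - q 1 u w / N 1 u w / 2) / \<gamma>"
  have diff: "H \<eta> \<gamma> (1 - i) u w - H \<eta> \<gamma> i u w = (if i = 0 then - 1 else 1) * ?k"
  proof -
    have e: "(x + c * k) - (x + d * k) = (c - d) * k" for x c d k :: real by (simp add: algebra_simps)
    have "cf (1 - i) - cf i = (if i = 0 then - 1 else 1)" using two_cases[of i] by (auto simp: cf_def)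
    then show ?thesis unfolding H_def e by simp
  qed
  have \<gamma>k: "\<gamma> * c * (s * (X / \<gamma>)) = c * s * X" for c s X using \<gamma> by simp
  consider "i = 0" | "i = 1" using two_cases[of i] by blast
  then show ?thesis
  proof cases
    case 1
    have "\<gamma> * l * (H \<eta> \<gamma> (1 - i) u w - H \<eta> \<gamma> i u w) = - l * (q \<eta> u w / N \<eta> u w - q 1 u w / N 1 u w / 2)"
      unfolding diff \<gamma>k using 1 by simp
    then show ?thesis
      using 1 unfolding a_def b_def \<Phi>_def dN_linear dK_linear q_eq_dN[symmetric] cf_def
      by (simp add: add_divide_distrib diff_divide_distrib algebra_simps)
  next
    case 2
    have "\<gamma> * (1 - l) * (H \<eta> \<gamma> (1 - i) u w - H \<eta> \<gamma> i u w) = (1 - l) * (q \<eta> u w / N \<eta> u w - q 1 u w / N 1 u w / 2)"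
      unfolding diff \<gamma>k using 2 by simp
    then show ?thesis
      using 2 unfolding a_def b_def \<Phi>_def dN_linear dK_linear q_eq_dN[symmetric] cf_def
      by (simp add: add_divide_distrib diff_divide_distrib algebra_simps)
  qed
qed

text \<open>In the coordinates \<open>u = U\<close>, \<open>w = W / e\<close> with
  \<open>U^2 + W^2 = 1\<close>, \<open>e RB\<close> collects all terms of \<open>e^2 dK\<close>
  along \<open>B\<close> that carry a factor \<open>e\<close>, and \<open>RL\<close> is
  \<open>e dK\<close> along the mean flow. Both are polynomials, hence bounded uniformly in
  \<open>e \<le> 1\<close>.\<close>

definition "RB e U W = 4 * b11 * U * (e * b11 * U + b12 * W) + 2 * e * b21 * b12 * W\<^sup>2
   + 2 * (b12 + e\<^sup>2 * b21) * (b11 * U * W + e * b21 * U\<^sup>2 + b22 * U * W)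
   + 4 * e * b22 * W * (e * b21 * U + b22 * W)
   - 4 * (e * (b11 * U\<^sup>2 + e * b21 * U * W + b22 * W\<^sup>2)\<^sup>2 + 2 * (b11 * U\<^sup>2 + e * b21 * U * W + b22 * W\<^sup>2) * b12 * U * W)"

definition "RL e U W = 2 * (2 * e * b11 * lp * U\<^sup>2 + (b12 + e\<^sup>2 * b21) * (lp - lm) * U * W - 2 * e * b22 * lm * W\<^sup>2)
   - 4 * (e * b11 * U\<^sup>2 + (b12 + e\<^sup>2 * b21) * U * W + e * b22 * W\<^sup>2) * (lp * U\<^sup>2 - lm * W\<^sup>2)"

lemma dK_scale:
  assumes "s \<noteq> 0"
  shows "dK \<eta> (s * u) (s * w) (s * u') (s * w') = dK \<eta> u w u' w'"
proof -
  have "N \<eta> (s * u) (s * w) = s\<^sup>2 * N \<eta> u w" "q \<eta> (s * u) (s * w) = s\<^sup>2 * q \<eta> u w"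
    "dN \<eta> (s * u) (s * w) (s * u') (s * w') = s\<^sup>2 * dN \<eta> u w u' w'"
    "dq \<eta> (s * u) (s * w) (s * u') (s * w') = s\<^sup>2 * dq \<eta> u w u' w'"
    by (simp_all add: N_def q_def dN_def dq_def power2_eq_square algebra_simps)
  then show ?thesis using assms by (simp add: dK_def power2_eq_square)
qed

lemma dN_mult: "dN \<eta> u w (c * u') (c * w') = c * dN \<eta> u w u' w'"
  by (simp add: dN_def algebra_simps)

lemma dK_mult: "dK \<eta> u w (c * u') (c * w') = c * dK \<eta> u w u' w'"
  using dK_linear[of \<eta> u w 0 c u' 0 w'] by (simp add: dK_def dq_def dN_def)

lemma N_normalized: "0 < e \<Longrightarrow> U\<^sup>2 + W\<^sup>2 = 1 \<Longrightarrow> N (e\<^sup>2) U (W / e) = 1"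
  by (simp add: N_def power_divide)

lemma q_normalized: "0 < e \<Longrightarrow> e * q (e\<^sup>2) U (W / e) = 2 * (e * b11 * U\<^sup>2 + (b12 + e\<^sup>2 * b21) * U * W + e * b22 * W\<^sup>2)"
  by (simp add: q_def field_simps power2_eq_square)

lemma dK_B_normalized:
  assumes e: "0 < e" and n: "U\<^sup>2 + W\<^sup>2 = 1"
  shows "e\<^sup>2 * dK (e\<^sup>2) U (W / e) (b11 * U + b12 * (W / e)) (b21 * U + b22 * (W / e))
    = 2 * b12\<^sup>2 * W\<^sup>2 - 4 * b12\<^sup>2 * U\<^sup>2 * W\<^sup>2 + e * RB e U W"
proof -
  let ?dq = "dq (e\<^sup>2) U (W / e) (b11 * U + b12 * (W / e)) (b21 * U + b22 * (W / e))"
  have dq: "e\<^sup>2 * ?dq = 4 * b11 * U * e * (e * b11 * U + b12 * W)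
      + 2 * (b12 + e\<^sup>2 * b21) * ((e * b11 * U + b12 * W) * W + e * U * (e * b21 * U + b22 * W))
      + 4 * e\<^sup>2 * b22 * W * (e * b21 * U + b22 * W)"
    using e by (simp add: dq_def field_simps power2_eq_square)
  have "e\<^sup>2 * dK (e\<^sup>2) U (W / e) (b11 * U + b12 * (W / e)) (b21 * U + b22 * (W / e))
     = e\<^sup>2 * ?dq - (e * q (e\<^sup>2) U (W / e))\<^sup>2"
    unfolding dK_def N_normalized[OF e n] q_eq_dN[symmetric] by (simp add: power2_eq_square algebra_simps)
  then show ?thesis
    unfolding dq q_normalized[OF e] RB_def by (simp add: power2_eq_square algebra_simps)
qed

lemma dK_L_normalized:
  assumes e: "0 < e" and n: "U\<^sup>2 + W\<^sup>2 = 1"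
  shows "e * dK (e\<^sup>2) U (W / e) (lp * U) (- lm * (W / e)) = RL e U W"
proof -
  have dq: "e * dq (e\<^sup>2) U (W / e) (lp * U) (- lm * (W / e))
     = 2 * (2 * e * b11 * lp * U\<^sup>2 + (b12 + e\<^sup>2 * b21) * (lp - lm) * U * W - 2 * e * b22 * lm * W\<^sup>2)"
    using e by (simp add: dq_def field_simps power2_eq_square)
  have dN: "dN (e\<^sup>2) U (W / e) (lp * U) (- lm * (W / e)) = 2 * (lp * U\<^sup>2 - lm * W\<^sup>2)"
    using e by (simp add: dN_def field_simps power2_eq_square)
  have "e * dK (e\<^sup>2) U (W / e) (lp * U) (- lm * (W / e))
     = e * dq (e\<^sup>2) U (W / e) (lp * U) (- lm * (W / e)) - (e * q (e\<^sup>2) U (W / e)) * dN (e\<^sup>2) U (W / e) (lp * U) (- lm * (W / e))"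
    unfolding dK_def N_normalized[OF e n] by (simp add: algebra_simps)
  then show ?thesis unfolding dq dN q_normalized[OF e] RL_def by (simp add: algebra_simps)
qed

text \<open>The eigenvector of \<open>- lm\<close> is a repelling fixed direction of the averaged flow, where \<open>ln N\<close>
  alone decreases. On the scale \<open>w = O(e)\<close>, \<open>e\<^sup>2 \<sim> 1 / \<gamma>\<close>, the second order term of the noise is of
  order one; for the chosen \<open>\<gamma> e\<^sup>2\<close> the leading part of \<open>\<Phi>\<close> is
  \<open>lp + (lp + lm) (W\<^sub>0\<^sup>2 - 4 U\<^sup>2 W\<^sup>2)\<close> with \<open>4 U\<^sup>2 W\<^sup>2 \<le> W\<^sub>0\<^sup>2 (1 + 4 e\<^sup>2)\<close>.\<close>

lemma \<Phi>_lower: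
  "\<exists>e0>0. \<forall>e. 0 < e \<longrightarrow> e < e0 \<longrightarrow> (\<forall>u w i. u \<noteq> 0 \<or> w \<noteq> 0 \<longrightarrow>
     lp / 2 \<le> \<Phi> (e\<^sup>2) (l * (1 - l) * b12\<^sup>2 / (e\<^sup>2 * (lp + lm))) i u w)"
proof -
  have "continuous_on UNIV (\<lambda>p. RB (fst p) (fst (snd p)) (snd (snd p)))"
    unfolding RB_def by (intro continuous_intros)
  from bounded_on_unit_box[OF this] obtain CB where CB: "0 \<le> CB"
    "\<And>e u w. 0 \<le> e \<Longrightarrow> e \<le> 1 \<Longrightarrow> \<bar>u\<bar> \<le> 1 \<Longrightarrow> \<bar>w\<bar> \<le> 1 \<Longrightarrow> \<bar>RB e u w\<bar> \<le> CB" by blast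
  have "continuous_on UNIV (\<lambda>p. RL (fst p) (fst (snd p)) (snd (snd p)))"
    unfolding RL_def by (intro continuous_intros)
  from bounded_on_unit_box[OF this] obtain CL where CL: "0 \<le> CL"
    "\<And>e u w. 0 \<le> e \<Longrightarrow> e \<le> 1 \<Longrightarrow> \<bar>u\<bar> \<le> 1 \<Longrightarrow> \<bar>w\<bar> \<le> 1 \<Longrightarrow> \<bar>RL e u w\<bar> \<le> CL" by blast
  \<comment> \<open>For the chosen \<gamma> one has \<open>1 / \<gamma> = e^2 \<nu>\<close> and
    \<open>l (1 - l) / \<gamma> = e^2 mb\<close>. The choice makes the leading second order term
    \<open>2 m W^2\<close>, which turns \<open>- 2 lm W^2\<close> into
    \<open>2 lp W^2\<close>.\<close>
  define m where "m = lp + lm"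
  define mb where "mb = m / b12\<^sup>2"
  define \<nu> where "\<nu> = m / (l * (1 - l) * b12\<^sup>2)"
  have m: "0 < m" using lp lm by (simp add: m_def)
  have mb: "0 < mb" using m b12 by (simp add: mb_def)
  have \<nu>: "0 < \<nu>" using m b12 l by (simp add: \<nu>_def)
  \<comment> \<open>All error terms are at most \<open>e C\<close>: in order, from
    \<open>key\<close>, from the second derivatives of the two forms, and from the mean flow. The
    bound on \<open>e\<close> makes \<open>e C\<close> at most half of \<open>lp\<close>.\<close>
  define C where "C = 4 * m + mb * (CB + (6 * b12\<^sup>2 + CB) / 2) + \<nu> * (CL + CL / 2)"
  have C: "0 \<le> C" using m mb \<nu> CB(1) CL(1) by (simp add: C_def)
  show ?thesis
  proof (intro exI[of _ "min 1 (lp / (2 * (C + 1)))"] conjI allI impI)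
    show "0 < min 1 (lp / (2 * (C + 1)))" using C lp by simp
    fix e u w :: real and i :: 2
    assume e: "0 < e" "e < min 1 (lp / (2 * (C + 1)))" and ne: "u \<noteq> 0 \<or> w \<noteq> 0"
    let ?\<gamma> = "l * (1 - l) * b12\<^sup>2 / (e\<^sup>2 * (lp + lm))"
    have e1: "0 \<le> e" "e \<le> 1" "e\<^sup>2 \<le> e" using e by (auto simp: power2_eq_square mult_left_le)
    have g1: "1 / ?\<gamma> = e\<^sup>2 * \<nu>" and g2: "l * (1 - l) / ?\<gamma> = e\<^sup>2 * mb"
      unfolding m_def[symmetric] \<nu>_def mb_def using l b12 e(1) m by (simp_all add: field_simps)
    define s where "s = sqrt (N (e\<^sup>2) u w)"
    define U where "U = u / s"
    define W where "W = e * w / s"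
    have Np: "0 < N (e\<^sup>2) u w" using e ne by (intro N_pos) auto
    have s: "0 < s" "s\<^sup>2 = N (e\<^sup>2) u w" using Np by (auto simp: s_def)
    have uw: "u = s * U" "w = s * (W / e)" using s e by (auto simp: U_def W_def)
    have UW: "U\<^sup>2 + W\<^sup>2 = 1"
      using s(1) Np unfolding U_def W_def by (simp add: power_divide power_mult_distrib s(2) add_divide_distrib[symmetric]) (simp add: N_def)
    define s0 where "s0 = sqrt (N 1 u w)"
    define U0 where "U0 = u / s0"
    define W0 where "W0 = w / s0"
    have Np0: "0 < N 1 u w" using ne by (intro N_pos) auto
    have s0: "0 < s0" "s0\<^sup>2 = N 1 u w" using Np0 by (auto simp: s0_def)
    have uw0: "u = s0 * U0" "w = s0 * W0" using s0 by (auto simp: U0_def W0_def)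
    have UW0: "U0\<^sup>2 + W0\<^sup>2 = 1"
      using s0(1) Np0 unfolding U0_def W0_def by (simp add: power_divide s0(2) add_divide_distrib[symmetric]) (simp add: N_def)
    have le1: "\<bar>x\<bar> \<le> 1 \<and> \<bar>y\<bar> \<le> 1" if "x\<^sup>2 + y\<^sup>2 = 1" for x y :: real
      using that zero_le_power2[of x] zero_le_power2[of y] unfolding abs_square_le_1[symmetric] by linarith
    let ?B1 = "dK (e\<^sup>2) u w (b11 * u + b12 * w) (b21 * u + b22 * w)"
    let ?B0 = "dK 1 u w (b11 * u + b12 * w) (b21 * u + b22 * w)"
    let ?L1 = "dK (e\<^sup>2) u w (lp * u) (- lm * w)" and ?L0 = "dK 1 u w (lp * u) (- lm * w)"
    have B1: "e\<^sup>2 * ?B1 = 2 * b12\<^sup>2 * W\<^sup>2 - 4 * b12\<^sup>2 * U\<^sup>2 * W\<^sup>2 + e * RB e U W"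
    proof -
      have "?B1 = dK (e\<^sup>2) (s * U) (s * (W / e)) (s * (b11 * U + b12 * (W / e))) (s * (b21 * U + b22 * (W / e)))"
        by (simp only: uw distrib_left mult.left_commute)
      then show ?thesis using dK_B_normalized[OF e(1) UW] s(1) by (simp only: dK_scale)
    qed
    have B0: "?B0 = 2 * b12\<^sup>2 * W0\<^sup>2 - 4 * b12\<^sup>2 * U0\<^sup>2 * W0\<^sup>2 + RB 1 U0 W0"
    proof -
      have "?B0 = dK 1 (s0 * U0) (s0 * W0) (s0 * (b11 * U0 + b12 * W0)) (s0 * (b21 * U0 + b22 * W0))"
        by (simp only: uw0 distrib_left mult.left_commute)
      then show ?thesis using dK_B_normalized[OF _ UW0, of 1] s0(1) by (simp add: dK_scale)
    qed
    have L1: "e * ?L1 = RL e U W"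
    proof -
      have "?L1 = dK (e\<^sup>2) (s * U) (s * (W / e)) (s * (lp * U)) (s * (- lm * (W / e)))"
        by (simp only: uw mult.left_commute)
      then show ?thesis using dK_L_normalized[OF e(1) UW] s(1) by (simp only: dK_scale)
    qed
    have L0: "?L0 = RL 1 U0 W0"
    proof -
      have "?L0 = dK 1 (s0 * U0) (s0 * W0) (s0 * (lp * U0)) (s0 * (- lm * W0))"
        by (simp only: uw0 mult.left_commute)
      also have "\<dots> = dK 1 U0 W0 (lp * U0) (- lm * W0)" by (rule dK_scale) (use s0 in simp)
      finally show ?thesis using dK_L_normalized[OF zero_less_one UW0] by simp
    qed
    have N1: "dN (e\<^sup>2) u w (lp * u) (- lm * w) / N (e\<^sup>2) u w = 2 * (lp * U\<^sup>2 - lm * W\<^sup>2)"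
      unfolding s(2)[symmetric] using s(1) by (simp add: dN_def U_def W_def field_simps power2_eq_square)
    have N0: "dN 1 u w (lp * u) (- lm * w) / N 1 u w / 2 = lp * U0\<^sup>2 - lm * W0\<^sup>2"
      unfolding s0(2)[symmetric] using s0(1) by (simp add: dN_def U0_def W0_def field_simps power2_eq_square)
    have rB1: "\<bar>RB e U W\<bar> \<le> CB" and rL1: "\<bar>RL e U W\<bar> \<le> CL" and rL0: "\<bar>RL 1 U0 W0\<bar> \<le> CL" and rB0: "\<bar>RB 1 U0 W0\<bar> \<le> CB"
      using CB(2) CL(2) le1[OF UW] le1[OF UW0] e1 by auto
    have w01: "W0\<^sup>2 \<le> 1" using UW0 zero_le_power2[of U0] by linarith
    \<comment> \<open>The left side is \<open>W0^2\<close> times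
      \<open>4 e^2 u^2 (u^2 + w^2) / N^2\<close> with the degenerate form \<open>N\<close>. The
      mixed term is at most 1 by the inequality of arithmetic and geometric means, the other at most
      \<open>4 e^2\<close> since \<open>u^2 \<le> N\<close>.\<close>
    have key: "4 * U\<^sup>2 * W\<^sup>2 \<le> W0\<^sup>2 + 4 * e\<^sup>2"
    proof -
      let ?P = "u\<^sup>2" and ?R = "w\<^sup>2" and ?n = "N (e\<^sup>2) u w" and ?k = "N 1 u w"
      have a: "4 * (e\<^sup>2 * ?P * ?R) \<le> ?n\<^sup>2"
        using zero_le_power2[of "?P - e\<^sup>2 * ?R"] by (simp add: N_def power2_eq_square algebra_simps)
      have "?P\<^sup>2 \<le> ?n\<^sup>2" by (intro power_mono) (auto simp: N_def)
      then have b: "4 * e\<^sup>2 * ?P\<^sup>2 \<le> 4 * e\<^sup>2 * ?n\<^sup>2" by (intro mult_left_mono) auto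
      have "4 * e\<^sup>2 * ?P * ?k = 4 * (e\<^sup>2 * ?P * ?R) + 4 * e\<^sup>2 * ?P\<^sup>2"
        by (simp add: N_def power2_eq_square algebra_simps)
      then have c: "4 * e\<^sup>2 * ?P * ?k \<le> (1 + 4 * e\<^sup>2) * ?n\<^sup>2" using a b by (simp add: distrib_right)
      have "4 * U\<^sup>2 * W\<^sup>2 = (4 * e\<^sup>2 * ?P * ?k) / ?n\<^sup>2 * W0\<^sup>2"
        using Np Np0 unfolding U_def W_def W0_def
        by (simp add: power_divide power_mult_distrib s(2) s0(2)) (simp add: field_simps power2_eq_square)
      also have "\<dots> \<le> (1 + 4 * e\<^sup>2) * W0\<^sup>2"
        using c Np by (intro mult_right_mono) (auto simp: divide_le_eq)
      also have "\<dots> \<le> W0\<^sup>2 + 4 * e\<^sup>2"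
        using mult_left_mono[OF w01, of "4 * e\<^sup>2"] by (simp add: distrib_right)
      finally show ?thesis .
    qed
    \<comment> \<open>Using \<open>U^2 + W^2 = U0^2 + W0^2 = 1\<close>, the right side is exactly
      \<open>lp + m W0^2 - 4 m U^2 W^2\<close>, to which \<open>key\<close> applies.\<close>
    have main: "lp - 4 * m * e\<^sup>2 \<le> 2 * (lp * U\<^sup>2 - lm * W\<^sup>2) - (lp * U0\<^sup>2 - lm * W0\<^sup>2) + m * (2 * W\<^sup>2 - 4 * U\<^sup>2 * W\<^sup>2)"
    proof -
      have "m * (4 * U\<^sup>2 * W\<^sup>2) \<le> m * (W0\<^sup>2 + 4 * e\<^sup>2)" using key m by (intro mult_left_mono) auto
      then have k: "m * (4 * U\<^sup>2 * W\<^sup>2) \<le> m * W0\<^sup>2 + 4 * m * e\<^sup>2" by (simp add: distrib_left)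
      have p: "lp * (U\<^sup>2 + W\<^sup>2) = lp" "lp * (U0\<^sup>2 + W0\<^sup>2) = lp" using UW UW0 by auto
      have "2 * (lp * U\<^sup>2 - lm * W\<^sup>2) - (lp * U0\<^sup>2 - lm * W0\<^sup>2) + m * (2 * W\<^sup>2 - 4 * U\<^sup>2 * W\<^sup>2)
          = m * W0\<^sup>2 - m * (4 * U\<^sup>2 * W\<^sup>2) + 2 * (lp * (U\<^sup>2 + W\<^sup>2)) - lp * (U0\<^sup>2 + W0\<^sup>2)"
        by (simp add: m_def algebra_simps)
      then show ?thesis using k unfolding p by linarith
    qed
    have "e\<^sup>2 * mb * ?B1 = mb * (e\<^sup>2 * ?B1)" by simp
    also have "\<dots> = m * (2 * W\<^sup>2 - 4 * U\<^sup>2 * W\<^sup>2) + e * (mb * RB e U W)"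
      unfolding B1 using b12 by (simp add: mb_def field_simps)
    finally have T1: "e\<^sup>2 * mb * ?B1 = m * (2 * W\<^sup>2 - 4 * U\<^sup>2 * W\<^sup>2) + e * (mb * RB e U W)" .
    have E1: "- (e * (mb * CB)) \<le> e * (mb * RB e U W)"
    proof -
      have "\<bar>e * (mb * RB e U W)\<bar> \<le> e * (mb * CB)"
        using e1 mb rB1 by (simp add: abs_mult mult_left_mono)
      then show ?thesis by linarith
    qed
    have E2: "e\<^sup>2 * mb * (?B0 / 2) \<le> e * (mb * ((6 * b12\<^sup>2 + CB) / 2))"
    proof -
      have "b12\<^sup>2 * W0\<^sup>2 \<le> b12\<^sup>2 * 1" by (intro mult_left_mono w01) auto
      moreover have "0 \<le> b12\<^sup>2 * (U0\<^sup>2 * W0\<^sup>2)" by simp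
      ultimately have "?B0 \<le> 6 * b12\<^sup>2 + CB" using rB0 zero_le_power2[of b12] unfolding B0 mult.assoc by linarith
      then have "e\<^sup>2 * mb * (?B0 / 2) \<le> e\<^sup>2 * mb * ((6 * b12\<^sup>2 + CB) / 2)"
        using mb by (intro mult_left_mono) auto
      also have "\<dots> \<le> e * (mb * ((6 * b12\<^sup>2 + CB) / 2))"
        unfolding mult.assoc using e1(3) mb CB(1) by (intro mult_right_mono) auto
      finally show ?thesis .
    qed
    have E3: "- (e * (\<nu> * (CL + CL / 2))) \<le> cf i * (e\<^sup>2 * \<nu>) * (?L1 - ?L0 / 2)"
    proof -
      have "\<bar>e\<^sup>2 * \<nu> * ?L1\<bar> \<le> e * \<nu> * CL"
      proof -
        have "e\<^sup>2 * \<nu> * ?L1 = e * \<nu> * (e * ?L1)" by (simp add: power2_eq_square)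
        also have "\<bar>\<dots>\<bar> = e * \<nu> * \<bar>RL e U W\<bar>" unfolding L1 using e1 \<nu> by (simp add: abs_mult)
        also have "\<dots> \<le> e * \<nu> * CL" using e1 \<nu> rL1 by (intro mult_left_mono) auto
        finally show ?thesis .
      qed
      moreover have "\<bar>e\<^sup>2 * \<nu> * (?L0 / 2)\<bar> \<le> e * \<nu> * (CL / 2)"
      proof -
        have "\<bar>e\<^sup>2 * \<nu> * (?L0 / 2)\<bar> \<le> e\<^sup>2 * \<nu> * (CL / 2)"
          unfolding L0 using \<nu> rL0 by (simp add: abs_mult mult_left_mono)
        also have "\<dots> \<le> e * \<nu> * (CL / 2)" using e1(3) \<nu> CL(1) by (intro mult_right_mono) auto
        finally show ?thesis .
      qed
      ultimately have "\<bar>e\<^sup>2 * \<nu> * ?L1 - e\<^sup>2 * \<nu> * (?L0 / 2)\<bar> \<le> e * \<nu> * CL + e * \<nu> * (CL / 2)"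
        by linarith
      then have b: "\<bar>e\<^sup>2 * \<nu> * ?L1 - e\<^sup>2 * \<nu> * (?L0 / 2)\<bar> \<le> e * (\<nu> * (CL + CL / 2))"
        by (simp only: distrib_left mult.assoc)
      have "\<bar>cf i\<bar> \<le> 1" using l by (auto simp: cf_def)
      then have "\<bar>cf i * (e\<^sup>2 * \<nu> * ?L1 - e\<^sup>2 * \<nu> * (?L0 / 2))\<bar> \<le> 1 * (e * (\<nu> * (CL + CL / 2)))"
        unfolding abs_mult using b by (intro mult_mono) auto
      moreover have "cf i * (e\<^sup>2 * \<nu>) * (?L1 - ?L0 / 2) = cf i * (e\<^sup>2 * \<nu> * ?L1 - e\<^sup>2 * \<nu> * (?L0 / 2))"
        by (simp add: algebra_simps)
      ultimately show ?thesis by linarith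
    qed
    have "\<Phi> (e\<^sup>2) ?\<gamma> i u w = 2 * (lp * U\<^sup>2 - lm * W\<^sup>2) - (lp * U0\<^sup>2 - lm * W0\<^sup>2)
        + (e\<^sup>2 * mb) * (?B1 - ?B0 / 2) + cf i * (e\<^sup>2 * \<nu>) * (?L1 - ?L0 / 2)"
    proof -
      have "cf i / ?\<gamma> = cf i * (1 / ?\<gamma>)" by simp
      then show ?thesis unfolding \<Phi>_def N1 N0 g2 by (simp only: g1)
    qed
    moreover have "(e\<^sup>2 * mb) * (?B1 - ?B0 / 2) = e\<^sup>2 * mb * ?B1 - e\<^sup>2 * mb * (?B0 / 2)" by (rule right_diff_distrib)
    moreover have "4 * m * e\<^sup>2 \<le> e * (4 * m)" using e1(3) m by simp
    moreover have "e * C = e * (4 * m) + e * (mb * CB) + e * (mb * ((6 * b12\<^sup>2 + CB) / 2)) + e * (\<nu> * (CL + CL / 2))"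
      by (simp add: C_def distrib_left)
    ultimately have "lp - e * C \<le> \<Phi> (e\<^sup>2) ?\<gamma> i u w"
      using main T1 E1 E2 E3 by linarith
    moreover have "e * C \<le> lp / 2"
    proof -
      have "e * (C + 1) \<le> lp / (2 * (C + 1)) * (C + 1)" using e C by (intro mult_right_mono) auto
      also have "\<dots> = lp / 2" using C by (simp add: divide_simps)
      finally show ?thesis using e1 by (simp add: distrib_left)
    qed
    ultimately show "lp / 2 \<le> \<Phi> (e\<^sup>2) ?\<gamma> i u w" by linarith
  qed
qed

section \<open>The test function as a subpotential\<close>

lemma proj_fun_H:
  assumes \<eta>: "0 < \<eta>"
  shows "proj_fun (\<lambda>x. if x = 0 then 0 else H \<eta> \<gamma> i (bu \<bullet> x) (bw \<bullet> x) - ln (norm x))"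
proof -
  let ?h = "\<lambda>x. if x = 0 then 0 else H \<eta> \<gamma> i (bu \<bullet> x) (bw \<bullet> x) - ln (norm x)"
  have ne: "bu \<bullet> x \<noteq> 0 \<or> bw \<bullet> x \<noteq> 0" if "x \<noteq> 0" for x using inj that by blast
  have scale: "?h (c *\<^sub>R x) = ?h x" if c: "c \<noteq> 0" for c x
  proof (cases "x = 0")
    case False
    let ?u = "bu \<bullet> x" and ?w = "bw \<bullet> x"
    have N: "N \<zeta> (c * ?u) (c * ?w) = c\<^sup>2 * N \<zeta> ?u ?w" and q: "q \<zeta> (c * ?u) (c * ?w) = c\<^sup>2 * q \<zeta> ?u ?w" for \<zeta>
      by (simp_all add: N_def q_def power2_eq_square algebra_simps)
    have lnN: "ln (N \<zeta> (c * ?u) (c * ?w)) = 2 * ln \<bar>c\<bar> + ln (N \<zeta> ?u ?w)" if "0 < \<zeta>" for \<zeta>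
    proof -
      have "ln (c\<^sup>2 * N \<zeta> ?u ?w) = ln (\<bar>c\<bar>\<^sup>2) + ln (N \<zeta> ?u ?w)"
        using c N_pos[OF that ne[OF False]] by (simp add: ln_mult)
      also have "ln (\<bar>c\<bar>\<^sup>2) = 2 * ln \<bar>c\<bar>" using c by (subst ln_realpow) auto
      finally show ?thesis unfolding N .
    qed
    have "H \<eta> \<gamma> i (c * ?u) (c * ?w) = ln \<bar>c\<bar> + H \<eta> \<gamma> i ?u ?w"
      unfolding H_def lnN[OF \<eta>] lnN[OF zero_less_one] unfolding N q using c by (simp add: add_divide_distrib)
    then show ?thesis using c False by (simp add: ln_mult)
  qed simp
  have "continuous_on (sphere 0 1) (\<lambda>x. H \<eta> \<gamma> i (bu \<bullet> x) (bw \<bullet> x) - ln (norm x))"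
  proof -
    have "N \<zeta> (bu \<bullet> x) (bw \<bullet> x) \<noteq> 0" if "0 < \<zeta>" "x \<in> sphere 0 1" for \<zeta> x
      using N_pos[OF that(1) ne[of x]] that(2) by force
    moreover have "continuous_on (sphere 0 1) (\<lambda>x. N \<zeta> (bu \<bullet> x) (bw \<bullet> x))" "continuous_on (sphere 0 1) (\<lambda>x. q \<zeta> (bu \<bullet> x) (bw \<bullet> x))" for \<zeta>
      unfolding N_def q_def by (intro continuous_intros)+
    ultimately show ?thesis
      unfolding H_def divide_inverse[of _ \<gamma>] using \<eta> by (intro continuous_intros) auto
  qed
  then have "compact ((\<lambda>x. H \<eta> \<gamma> i (bu \<bullet> x) (bw \<bullet> x) - ln (norm x)) ` sphere 0 1)"
    by (rule compact_continuous_image) simp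
  then have "bounded ((\<lambda>x. H \<eta> \<gamma> i (bu \<bullet> x) (bw \<bullet> x) - ln (norm x)) ` sphere 0 1)" by (rule compact_imp_bounded)
  then obtain C where C': "\<forall>y\<in>(\<lambda>x. H \<eta> \<gamma> i (bu \<bullet> x) (bw \<bullet> x) - ln (norm x)) ` sphere 0 1. norm y \<le> C"
    unfolding bounded_iff by blast
  have "\<bar>?h x\<bar> \<le> \<bar>C\<bar>" for x
  proof (cases "x = 0")
    case False
    let ?y = "(1 / norm x) *\<^sub>R x"
    have y: "?y \<in> sphere 0 1" using False by simp
    have "?h x = ?h ?y" using False by (intro scale[symmetric]) simp
    also have "\<dots> = H \<eta> \<gamma> i (bu \<bullet> ?y) (bw \<bullet> ?y) - ln (norm ?y)" using False by simp
    finally show ?thesis using bspec[OF C' imageI[OF y]] by simp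
  qed simp
  moreover have "?h \<in> borel_measurable borel"
    unfolding H_def N_def q_def by measurable
  ultimately show ?thesis unfolding proj_fun_def using scale by blast
qed

text \<open>Time is measured in mean holding times \<open>1 / (\<gamma> lam i)\<close>. Along the
  flow of the rescaled matrix the drift becomes
  \<open>\<phi>' + \<psi> - \<phi> = \<Phi> / (\<gamma> lam i)\<close> with \<open>\<phi>\<close>,
  \<open>\<psi>\<close> the functions \<open>H\<close> of the present and the next index, so the
  infinitesimal criterion applies.\<close>

lemma subpotential:
  assumes \<gamma>: "0 < \<gamma>" and \<eta>: "0 < \<eta>" and \<delta>: "\<And>u w i. u \<noteq> 0 \<or> w \<noteq> 0 \<Longrightarrow> \<delta> \<le> \<Phi> \<eta> \<gamma> i u w"
    and lam: "lam 0 = l" "lam 1 = 1 - l"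
  defines "h \<equiv> \<lambda>i x. if x = 0 then 0 else H \<eta> \<gamma> i (bu \<bullet> x) (bw \<bullet> x) - ln (norm x)"
  assumes x: "x \<noteq> 0"
  shows "ln (norm x) + h i x + \<delta> / (\<gamma> * lam i)
    \<le> resolv ((1 / (\<gamma> * lam i)) *\<^sub>R A i) (\<lambda>x. ln (norm x) + h (1 - i) x) x"
proof -
  have h: "proj_fun (h i)" for i unfolding h_def by (rule proj_fun_H[OF \<eta>])
  define r where "r = \<gamma> * lam i"
  have lami: "lam i = (if i = 0 then l else 1 - l)" using two_cases[of i] lam by auto
  have r: "0 < r" using \<gamma> l by (simp add: r_def lami)
  define b where "b = (1 / r) *\<^sub>R A i"
  let ?x = "\<lambda>t. mat_exp (t *\<^sub>R b) *v x"
  let ?u = "\<lambda>t. bu \<bullet> ?x t" and ?w = "\<lambda>t. bw \<bullet> ?x t"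
  have xne: "?x t \<noteq> 0" for t using x by simp
  have ne: "?u t \<noteq> 0 \<or> ?w t \<noteq> 0" for t using inj xne by blast
  let ?a = "\<lambda>u w. lp * u + (if i = 0 then l else - (1 - l)) * (b11 * u + b12 * w)"
  let ?b = "\<lambda>u w. - lm * w + (if i = 0 then l else - (1 - l)) * (b21 * u + b22 * w)"
  have bv: "b *v y = (1 / r) *\<^sub>R (A i *v y)" for y by (simp add: b_def scaleR_matrix_vector_assoc)
  have uA: "bu \<bullet> (A i *v y) = ?a (bu \<bullet> y) (bw \<bullet> y)" and wA: "bw \<bullet> (A i *v y) = ?b (bu \<bullet> y) (bw \<bullet> y)" for y
    using two_cases[of i] by (auto simp: u_A0 u_A1 w_A0 w_A1 algebra_simps)
  have ud: "(?u has_real_derivative 1 / r * ?a (?u t) (?w t)) (at t)"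
    and wd: "(?w has_real_derivative 1 / r * ?b (?u t) (?w t)) (at t)" for t
    using DERIV_inner_flow[of bu b x t] DERIV_inner_flow[of bw b x t] unfolding bv inner_scaleR_right uA wA by simp_all
  have alg: "1 / r * X / n - 1 / r * Y / n' / 2 + k * ((1 / r * Z - 1 / r * Z' / 2) / \<gamma>)
      = (X / n - Y / n' / 2 + k * ((Z - Z' / 2) / \<gamma>)) / r" for X Y Z Z' n n' k
    by (simp add: add_divide_distrib diff_divide_distrib right_diff_distrib mult_ac)
  let ?E = "\<lambda>j u w. dN \<eta> u w (?a u w) (?b u w) / N \<eta> u w - dN 1 u w (?a u w) (?b u w) / N 1 u w / 2
     + cf j * ((dK \<eta> u w (?a u w) (?b u w) - dK 1 u w (?a u w) (?b u w) / 2) / \<gamma>)"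
  have Hd: "((\<lambda>t. H \<eta> \<gamma> j (?u t) (?w t)) has_real_derivative ?E j (?u t) (?w t) / r) (at t)" for j t
    using H_derivative[OF ud wd \<eta> ne, where i = j and \<gamma> = \<gamma>] unfolding dN_mult dK_mult alg .
  have drift: "?E i u w / r + H \<eta> \<gamma> (1 - i) u w - H \<eta> \<gamma> i u w = \<Phi> \<eta> \<gamma> i u w / r" for u w
  proof -
    have "?E i u w + r * (H \<eta> \<gamma> (1 - i) u w - H \<eta> \<gamma> i u w) = \<Phi> \<eta> \<gamma> i u w"
      using H_drift[OF \<gamma> \<eta>, of u w i] by (simp only: r_def lami)
    then have "\<Phi> \<eta> \<gamma> i u w / r = (?E i u w + r * (H \<eta> \<gamma> (1 - i) u w - H \<eta> \<gamma> i u w)) / r" by (simp only:)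
    also have "\<dots> = ?E i u w / r + (H \<eta> \<gamma> (1 - i) u w - H \<eta> \<gamma> i u w)" using r by (simp only: add_divide_distrib) simp
    finally show ?thesis by linarith
  qed
  have Hh: "H \<eta> \<gamma> j (?u t) (?w t) = ln (norm (?x t)) + h j (?x t)" for j t
    using xne by (simp add: h_def)
  obtain B where B: "\<And>y. \<bar>h i y\<bar> \<le> B" using proj_fun_bounded[OF h] by blast
  have "H \<eta> \<gamma> i (?u 0) (?w 0) + \<delta> / r \<le> (\<integral>t. H \<eta> \<gamma> (1 - i) (?u t) (?w t) \<partial>exp_law)"
  proof (rule exp_law_mean_ge[OF Hd])
    show "continuous_on UNIV (\<lambda>t. H \<eta> \<gamma> (1 - i) (?u t) (?w t))"
      using Hd by (intro DERIV_continuous_on) (rule has_field_derivative_at_within)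
    show "integrable exp_law (\<lambda>t. H \<eta> \<gamma> (1 - i) (?u t) (?w t))"
      unfolding Hh by (rule integrable_log_fun[OF h x])
    show "\<bar>H \<eta> \<gamma> i (?u t) (?w t)\<bar> \<le> (\<bar>ln (norm x)\<bar> + B) + mnorm b * t" if "0 \<le> t" for t
      unfolding Hh using log_fun_bound[where f = "h i", OF B x that, of b] by linarith
    show "\<delta> / r \<le> ?E i (?u t) (?w t) / r + H \<eta> \<gamma> (1 - i) (?u t) (?w t) - H \<eta> \<gamma> i (?u t) (?w t)" for t
      unfolding drift using \<delta>[OF ne] r by (intro divide_right_mono) auto
  qed
  then show ?thesis unfolding Hh resolv_def b_def[symmetric] r_def[symmetric] by simp
qed

lemma growth_eventually_pos:
  assumes lam: "lam 0 = l" "lam 1 = 1 - l"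
  shows "\<exists>\<gamma>0. \<forall>\<gamma> g \<kappa>. \<gamma>0 < \<gamma> \<longrightarrow> (\<forall>i. proj_fun (g i)) \<longrightarrow>
    (\<forall>i x. x \<noteq> 0 \<longrightarrow> resolv ((1 / (\<gamma> * lam i)) *\<^sub>R A i) (\<lambda>x. ln (norm x) + g (1 - i) x) x = ln (norm x) + g i x + \<kappa>)
    \<longrightarrow> 0 < \<kappa>"
proof -
  obtain e0 where e0: "0 < e0" "\<And>e u w i. 0 < e \<Longrightarrow> e < e0 \<Longrightarrow> u \<noteq> 0 \<or> w \<noteq> 0 \<Longrightarrow>
     lp / 2 \<le> \<Phi> (e\<^sup>2) (l * (1 - l) * b12\<^sup>2 / (e\<^sup>2 * (lp + lm))) i u w"
    using \<Phi>_lower by blast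
  define c where "c = l * (1 - l) * b12\<^sup>2 / (lp + lm)"
  have c: "0 < c" using l b12 lp lm by (simp add: c_def)
  show ?thesis
  proof (intro exI[of _ "c / e0\<^sup>2"] allI impI)
    fix \<gamma> g \<kappa> assume \<gamma>: "c / e0\<^sup>2 < \<gamma>" and g: "\<forall>i. proj_fun (g i)"
      and eq: "\<forall>i x. x \<noteq> 0 \<longrightarrow> resolv ((1 / (\<gamma> * lam i)) *\<^sub>R A i) (\<lambda>x. ln (norm x) + g (1 - i) x) x = ln (norm x) + g i x + \<kappa>"
    have \<gamma>0: "0 < \<gamma>" using \<gamma> c e0(1) by (meson divide_pos_pos less_trans zero_less_power)
    \<comment> \<open>Inverts the relation \<open>\<gamma> = c / e^2\<close> under which the lower
      bound for the drift was obtained; large \<gamma> means small \<open>e\<close>.\<close>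
    define e where "e = sqrt (c / \<gamma>)"
    have e: "0 < e" "e\<^sup>2 = c / \<gamma>" using c \<gamma>0 by (auto simp: e_def)
    have "c / \<gamma> < e0\<^sup>2" using \<gamma> \<gamma>0 e0(1) by (simp add: field_simps)
    then have "e\<^sup>2 < e0\<^sup>2" unfolding e(2) .
    then have "e < e0" by (rule power2_less_imp_less) (use e0 in simp)
    moreover have "l * (1 - l) * b12\<^sup>2 / (e\<^sup>2 * (lp + lm)) = \<gamma>"
    proof -
      have "l * (1 - l) * b12\<^sup>2 = c * (lp + lm)" using lp lm by (simp add: c_def)
      then show ?thesis unfolding e(2) using c \<gamma>0 lp lm by simp
    qed
    ultimately have \<Phi>: "lp / 2 \<le> \<Phi> (e\<^sup>2) \<gamma> i u w" if "u \<noteq> 0 \<or> w \<noteq> 0" for i u w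
      using e0(2)[OF e(1) _ that, of i] by simp
    have \<eta>: "0 < e\<^sup>2" using e(1) by (rule zero_less_power)
    let ?h = "\<lambda>i x. if x = 0 then 0 else H (e\<^sup>2) \<gamma> i (bu \<bullet> x) (bw \<bullet> x) - ln (norm x)"
    show "0 < \<kappa>"
    proof (rule growth_pos_of_subpotential[where g = g and h = ?h and b = "\<lambda>i. (1 / (\<gamma> * lam i)) *\<^sub>R A i" and d = "\<lambda>i. lp / 2 / (\<gamma> * lam i)"])
      show "proj_fun (?h i)" for i by (rule proj_fun_H[OF \<eta>])
      show "0 < lp / 2 / (\<gamma> * lam i)" for i
        using two_cases[of i] lam l lp \<gamma>0 by auto
      show "ln (norm x) + ?h i x + lp / 2 / (\<gamma> * lam i)
        \<le> resolv ((1 / (\<gamma> * lam i)) *\<^sub>R A i) (\<lambda>x. ln (norm x) + ?h (1 - i) x) x" if "x \<noteq> 0" for i x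
        by (rule subpotential[OF \<gamma>0 \<eta> \<Phi> lam that])
    qed (use g eq in auto)
  qed
qed

end

section \<open>The theorem\<close>

lemma hurwitz_real_eigenvalue_neg:
  fixes M :: "real^2^2"
  assumes "hurwitz M" "x \<noteq> 0" "M *v x = c *\<^sub>R x"
  shows "c < 0"
proof -
  let ?M = "\<chi> i j. complex_of_real (M $ i $ j)" and ?x = "\<chi> i. complex_of_real (x $ i)"
  have "?x \<noteq> 0" using assms(2) by (simp add: vec_eq_iff)
  moreover have "?M *v ?x = complex_of_real c *s ?x"
  proof -
    have "(?M *v ?x) $ i = complex_of_real ((M *v x) $ i)" for i
      by (simp add: matrix_vector_mult_def)
    then show ?thesis unfolding assms(3) by (simp add: vec_eq_iff)
  qed
  ultimately have "eigenvalue ?M (complex_of_real c)" unfolding eigenvalue_def by blast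
  then have "Re (complex_of_real c) < 0" using assms(1) unfolding hurwitz_def by blast
  then show ?thesis by simp
qed

text \<open>\<open>c\<close> is the eigenvalue on the quotient by the line of \<open>vm\<close>. If
  it differs from \<open>d\<close>, adding a multiple of \<open>vm\<close> turns \<open>vp\<close>
  into an eigenvector for \<open>c\<close>; otherwise \<open>vm\<close> is one.\<close>

lemma hurwitz_triangular_neg:
  fixes M :: "real^2^2"
  assumes M: "hurwitz M" and vm: "vm \<noteq> 0" "M *v vm = d *\<^sub>R vm" and vp: "M *v vp = c *\<^sub>R vp + e *\<^sub>R vm"
    and indep: "\<And>t. vp + t *\<^sub>R vm \<noteq> 0"
  shows "c < 0"
proof (cases "c = d")
  case True
  then show ?thesis using hurwitz_real_eigenvalue_neg[OF M vm] by simp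
next
  case False
  let ?t = "e / (c - d)"
  have "M *v (vp + ?t *\<^sub>R vm) = c *\<^sub>R vp + (e + ?t * d) *\<^sub>R vm"
    by (simp add: matrix_vector_right_distrib matrix_vector_mult_scaleR vp vm(2) scaleR_add_left)
  also have "e + ?t * d = c * ?t" using False by (simp add: field_simps)
  finally have "M *v (vp + ?t *\<^sub>R vm) = c *\<^sub>R (vp + ?t *\<^sub>R vm)" by (simp add: scaleR_add_right)
  from hurwitz_real_eigenvalue_neg[OF M indep this] show ?thesis .
qed

lemma dual_basis:
  fixes L :: "real^2^2"
  assumes "0 < lp" "0 < lm" and vp: "vp \<noteq> 0" "L *v vp = lp *\<^sub>R vp" and vm: "vm \<noteq> 0" "L *v vm = - lm *\<^sub>R vm"
  shows "\<exists>bu bw. bu \<bullet> vp = 1 \<and> bu \<bullet> vm = 0 \<and> bw \<bullet> vp = 0 \<and> bw \<bullet> vm = 1 \<and>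
    (\<forall>x. x = (bu \<bullet> x) *\<^sub>R vp + (bw \<bullet> x) *\<^sub>R vm)"
proof -
  define D where "D = vp $ 1 * vm $ 2 - vp $ 2 * vm $ 1"
  have "D \<noteq> 0"
  proof
    assume D: "D = 0"
    have "vp $ i = 0" for i
    proof (rule ccontr)
      assume i: "vp $ i \<noteq> 0"
      have e: "vp $ i *\<^sub>R vm = vm $ i *\<^sub>R vp"
        using D exhaust_2[of i] by (auto simp: vec_eq_iff forall_2 D_def mult.commute)
      have "(- lm) *\<^sub>R (vp $ i *\<^sub>R vm) = L *v (vp $ i *\<^sub>R vm)"
        by (simp add: matrix_vector_mult_scaleR vm(2) mult.commute)
      also have "\<dots> = L *v (vm $ i *\<^sub>R vp)" by (simp only: e)
      also have "\<dots> = lp *\<^sub>R (vm $ i *\<^sub>R vp)"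
        by (simp add: matrix_vector_mult_scaleR vp(2) mult.commute)
      also have "\<dots> = lp *\<^sub>R (vp $ i *\<^sub>R vm)" by (simp only: e)
      finally have h: "(- lm) *\<^sub>R (vp $ i *\<^sub>R vm) = lp *\<^sub>R (vp $ i *\<^sub>R vm)" .
      have "(- lm - lp) *\<^sub>R (vp $ i *\<^sub>R vm) = 0" unfolding scaleR_left_diff_distrib h by simp
      then show False using i vm(1) assms(1,2) by simp
    qed
    then show False using vp(1) by (simp add: vec_eq_iff)
  qed
  let ?bu = "(1 / D) *\<^sub>R (\<chi> i. if i = 1 then vm $ 2 else - vm $ 1) :: real^2"
  let ?bw = "(1 / D) *\<^sub>R (\<chi> i. if i = 1 then - vp $ 2 else vp $ 1) :: real^2"
  have in2: "a \<bullet> b = a $ 1 * b $ 1 + a $ 2 * b $ 2" for a b :: "real^2" by (simp add: inner_vec_def sum_2)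
  have u: "?bu \<bullet> x = (vm $ 2 * x $ 1 - vm $ 1 * x $ 2) / D" and w: "?bw \<bullet> x = (vp $ 1 * x $ 2 - vp $ 2 * x $ 1) / D" for x
    by (simp_all add: in2 diff_divide_distrib)
  have "x = (?bu \<bullet> x) *\<^sub>R vp + (?bw \<bullet> x) *\<^sub>R vm" for x
    unfolding u w using \<open>D \<noteq> 0\<close> by (simp add: vec_eq_iff forall_2 field_simps) (simp add: D_def algebra_simps)
  moreover have "?bu \<bullet> vp = 1" "?bu \<bullet> vm = 0" "?bw \<bullet> vp = 0" "?bw \<bullet> vm = 1"
    unfolding u w using \<open>D \<noteq> 0\<close> by (simp_all add: D_def mult.commute)
  ultimately show ?thesis by blast
qed

text \<open>Stability enters here, through \<open>b12\<close> and \<open>b21\<close>. If one of them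
  vanished, \<open>A 0\<close> and \<open>A 1\<close> would share an eigenvector and be triangular
  in the same basis; their diagonal entries belonging to \<open>vp\<close> would be negative,
  although their weighted mean is \<open>lp > 0\<close>.\<close>

lemma saddle_coordinates:
  fixes A :: "2 \<Rightarrow> real^2^2"
  assumes H: "hurwitz (A 0)" "hurwitz (A 1)" and l: "0 < l" "l < 1" and pos: "0 < lm" "0 < lp"
    and e: "eigenvalue ((1 - l) *\<^sub>R A 0 + l *\<^sub>R A 1) (- lm)" "eigenvalue ((1 - l) *\<^sub>R A 0 + l *\<^sub>R A 1) lp"
  obtains vp vm bu bw b11 b12 b21 b22 where
    "averaged_saddle A bu bw l lp lm b11 b12 b21 b22"
    "\<forall>\<beta> lam. 0 < \<beta> \<longrightarrow> lam 0 = l \<longrightarrow> lam 1 = 1 - l \<longrightarrow>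
      flow_pair (\<lambda>i. (1 / (\<beta> * lam i)) *\<^sub>R A i) vp vm bu bw (lp / (\<beta> * l * (1 - l))) (lm / (\<beta> * l * (1 - l)))"
proof -
  let ?L = "(1 - l) *\<^sub>R A 0 + l *\<^sub>R A 1"
  obtain vp vm where vp: "vp \<noteq> 0" "?L *v vp = lp *\<^sub>R vp" and vm: "vm \<noteq> 0" "?L *v vm = - lm *\<^sub>R vm"
    using e unfolding eigenvalue_def scalar_mult_eq_scaleR by blast
  obtain bu bw where dual: "bu \<bullet> vp = 1" "bu \<bullet> vm = 0" "bw \<bullet> vp = 0" "bw \<bullet> vm = 1"
    and expand: "\<And>x. x = (bu \<bullet> x) *\<^sub>R vp + (bw \<bullet> x) *\<^sub>R vm"
    using dual_basis[OF pos(2,1) vp vm] by blast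
  define B where "B = A 0 - A 1"
  define b11 where "b11 = bu \<bullet> (B *v vp)"
  define b12 where "b12 = bu \<bullet> (B *v vm)"
  define b21 where "b21 = bw \<bullet> (B *v vp)"
  define b22 where "b22 = bw \<bullet> (B *v vm)"
  have Lx: "?L *v x = (bu \<bullet> x * lp) *\<^sub>R vp + (bw \<bullet> x * - lm) *\<^sub>R vm" for x
    by (subst expand[of x]) (simp add: matrix_vector_right_distrib matrix_vector_mult_scaleR vp vm)
  have Bx: "B *v x = (bu \<bullet> x) *\<^sub>R (B *v vp) + (bw \<bullet> x) *\<^sub>R (B *v vm)" for x
    by (subst expand[of x]) (simp add: matrix_vector_right_distrib matrix_vector_mult_scaleR)
  have A0: "A 0 *v x = ?L *v x + l *\<^sub>R (B *v x)" and A1: "A 1 *v x = ?L *v x - (1 - l) *\<^sub>R (B *v x)" for x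
    by (simp_all add: B_def matrix_vector_mult_diff_rdistrib matrix_vector_mult_add_rdistrib
        scaleR_matrix_vector_assoc[symmetric] algebra_simps)
  have u: "bu \<bullet> (?L *v x) = lp * (bu \<bullet> x)" "bw \<bullet> (?L *v x) = - lm * (bw \<bullet> x)"
    "bu \<bullet> (B *v x) = b11 * (bu \<bullet> x) + b12 * (bw \<bullet> x)" "bw \<bullet> (B *v x) = b21 * (bu \<bullet> x) + b22 * (bw \<bullet> x)" for x
    unfolding Lx Bx[of x] by (simp_all add: inner_add_right inner_diff_right dual b11_def b12_def b21_def b22_def mult.commute)
  have coord: "bu \<bullet> (A 0 *v x) = lp * (bu \<bullet> x) + l * (b11 * (bu \<bullet> x) + b12 * (bw \<bullet> x))"
    "bu \<bullet> (A 1 *v x) = lp * (bu \<bullet> x) - (1 - l) * (b11 * (bu \<bullet> x) + b12 * (bw \<bullet> x))"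
    "bw \<bullet> (A 0 *v x) = - lm * (bw \<bullet> x) + l * (b21 * (bu \<bullet> x) + b22 * (bw \<bullet> x))"
    "bw \<bullet> (A 1 *v x) = - lm * (bw \<bullet> x) - (1 - l) * (b21 * (bu \<bullet> x) + b22 * (bw \<bullet> x))" for x
    unfolding A0 A1 inner_add_right inner_diff_right inner_scaleR_right u by simp_all
  have indep: "vp + t *\<^sub>R vm \<noteq> 0" for t
  proof
    assume "vp + t *\<^sub>R vm = 0"
    then have "bu \<bullet> (vp + t *\<^sub>R vm) = 0" by simp
    then show False by (simp add: inner_add_right dual)
  qed
  have mean: False if "lp + l * b11 < 0" "lp - (1 - l) * b11 < 0"
  proof -
    have "(1 - l) * (lp + l * b11) < 0" "l * (lp - (1 - l) * b11) < 0"
      using that l by (auto intro: mult_pos_neg)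
    moreover have "(1 - l) * (lp + l * b11) + l * (lp - (1 - l) * b11) = lp" by (simp add: algebra_simps)
    ultimately show False using pos by linarith
  qed
  have b21: "b21 \<noteq> 0"
  proof
    assume b: "b21 = 0"
    have "A 0 *v vp = (lp + l * b11) *\<^sub>R vp" "A 1 *v vp = (lp - (1 - l) * b11) *\<^sub>R vp"
      by (rule trans[OF expand], simp add: coord dual b)+
    then show False using hurwitz_real_eigenvalue_neg[OF H(1) vp(1)] hurwitz_real_eigenvalue_neg[OF H(2) vp(1)] mean by blast
  qed
  have b12: "b12 \<noteq> 0"
  proof
    assume b: "b12 = 0"
    have "A 0 *v vm = (- lm + l * b22) *\<^sub>R vm" "A 1 *v vm = (- lm - (1 - l) * b22) *\<^sub>R vm"
      by (rule trans[OF expand], simp add: coord dual b)+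
    moreover have "A 0 *v vp = (lp + l * b11) *\<^sub>R vp + (l * b21) *\<^sub>R vm"
      by (rule trans[OF expand]) (simp add: coord dual b)
    moreover have "A 1 *v vp = (lp - (1 - l) * b11) *\<^sub>R vp + (- ((1 - l) * b21)) *\<^sub>R vm"
    proof -
      have "bu \<bullet> (A 1 *v vp) = lp - (1 - l) * b11" "bw \<bullet> (A 1 *v vp) = - ((1 - l) * b21)"
        unfolding coord dual b by simp_all
      then show ?thesis using expand[of "A 1 *v vp"] by (simp only:)
    qed
    ultimately show False
      using hurwitz_triangular_neg[OF H(1) vm(1) _ _ indep] hurwitz_triangular_neg[OF H(2) vm(1) _ _ indep] mean by blast
  qed
  have inj: "x = 0" if "bu \<bullet> x = 0" "bw \<bullet> x = 0" for x
    by (rule trans[OF expand]) (simp add: that)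
  show ?thesis
  proof (rule that; (intro allI impI)?)
    show "averaged_saddle A bu bw l lp lm b11 b12 b21 b22"
      by unfold_locales (use l pos b12 inj coord in auto)
    fix \<beta> :: real and lam :: "2 \<Rightarrow> real" assume \<beta>: "0 < \<beta>" and lam: "lam 0 = l" "lam 1 = 1 - l"
    have sum: "((1 / (\<beta> * lam 0)) *\<^sub>R A 0) *v x + ((1 / (\<beta> * lam 1)) *\<^sub>R A 1) *v x = (1 / (\<beta> * l * (1 - l))) *\<^sub>R (?L *v x)" for x
      using \<beta> l unfolding lam
      by (simp add: matrix_vector_mult_add_rdistrib scaleR_matrix_vector_assoc[symmetric] scaleR_add_right)
    show "flow_pair (\<lambda>i. (1 / (\<beta> * lam i)) *\<^sub>R A i) vp vm bu bw (lp / (\<beta> * l * (1 - l))) (lm / (\<beta> * l * (1 - l)))"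
    proof
      show "0 < lp / (\<beta> * l * (1 - l))" "0 < lm / (\<beta> * l * (1 - l))" using \<beta> l pos by simp_all
      show "bu \<bullet> vp = 1" "bu \<bullet> vm = 0" "bw \<bullet> vp = 0" "bw \<bullet> vm = 1" by (rule dual)+
      show "x = (bu \<bullet> x) *\<^sub>R vp + (bw \<bullet> x) *\<^sub>R vm" for x by (rule expand)
      show "((1 / (\<beta> * lam 0)) *\<^sub>R A 0) *v vp + ((1 / (\<beta> * lam 1)) *\<^sub>R A 1) *v vp = (lp / (\<beta> * l * (1 - l))) *\<^sub>R vp"
        unfolding sum vp(2) by simp
      show "((1 / (\<beta> * lam 0)) *\<^sub>R A 0) *v vm + ((1 / (\<beta> * lam 1)) *\<^sub>R A 1) *v vm = - (lm / (\<beta> * l * (1 - l))) *\<^sub>R vm"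
        unfolding sum vm(2) by simp
      show "bw \<bullet> (((1 / (\<beta> * lam 0)) *\<^sub>R A 0) *v vp) \<noteq> 0" "bu \<bullet> (((1 / (\<beta> * lam 0)) *\<^sub>R A 0) *v vm) \<noteq> 0"
        using \<beta> l b12 b21 unfolding lam scaleR_matrix_vector_assoc[symmetric] inner_scaleR_right coord dual by simp_all
    qed
  qed
qed

theorem proposition4p1:
  fixes A :: "2 \<Rightarrow> real^2^2" and lam :: "2 \<Rightarrow> real" and l lminus lplus :: real
  assumes "hurwitz (A 0)" and "hurwitz (A 1)"
    and "0 < l" and "l < 1"
    and "0 < lminus" and "0 < lplus"
    and "eigenvalue ((1 - l) *\<^sub>R A 0 + l *\<^sub>R A 1) (- lminus)"
    and "eigenvalue ((1 - l) *\<^sub>R A 0 + l *\<^sub>R A 1) lplus"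
    and "lam 0 = l" and "lam 1 = 1 - l"
  shows "(\<forall>\<beta>>0. \<forall>(M :: 'w measure) (V :: nat \<Rightarrow> 'w \<Rightarrow> real^2^2).
            prob_space M \<and> prob_space.indep_vars M (\<lambda>_. borel) V {1..} \<and>
            (\<forall>k\<ge>1. has_half_sum_law M A lam \<beta> (V k)) \<longrightarrow>
            (AE \<omega> in M.
               (\<lambda>k. ln (onorm (\<lambda>x. left_prod (\<lambda>j. V j \<omega>) k *v x)) / real k)
                 \<longlonglongrightarrow> growth_exponent A lam (\<beta> / 2) / (2 * l * (1 - l) * \<beta>))) \<and>
         (\<forall>\<^sub>F \<beta> in at_top. growth_exponent A lam (\<beta> / 2) / (2 * l * (1 - l) * \<beta>) > 0)"
proof -
  obtain vp vm bu bw b11 b12 b21 b22 where saddle: "averaged_saddle A bu bw l lplus lminus b11 b12 b21 b22"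
    and pair': "\<forall>\<beta> lam. 0 < \<beta> \<longrightarrow> lam 0 = l \<longrightarrow> lam 1 = 1 - l \<longrightarrow>
      flow_pair (\<lambda>i. (1 / (\<beta> * lam i)) *\<^sub>R A i) vp vm bu bw (lplus / (\<beta> * l * (1 - l))) (lminus / (\<beta> * l * (1 - l)))"
    by (rule saddle_coordinates[OF assms(1-8)], rule that)
  note pair = pair'[rule_format]
  interpret S: averaged_saddle A bu bw l lplus lminus b11 b12 b21 b22 by (rule saddle)
  define a where "a \<beta> i = (1 / (\<beta> * lam i)) *\<^sub>R A i" for \<beta> i
  \<comment> \<open>One constant \<open>c\<close> is tied to three things: the random product, the
    alternating flow with halved rates and the growth exponent. The first gives the limit, the
    second its sign.\<close>
  have potential: "\<exists>c f g. proj_fun f \<and>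
      (\<forall>x. x \<noteq> 0 \<longrightarrow> (resolv (a \<beta> 0) (\<lambda>x. ln (norm x) + f x) x + resolv (a \<beta> 1) (\<lambda>x. ln (norm x) + f x) x) / 2 = ln (norm x) + f x + c) \<and>
      (\<forall>i. proj_fun (g i)) \<and>
      (\<forall>i x. x \<noteq> 0 \<longrightarrow> resolv ((1 / (\<beta> / 2 * lam i)) *\<^sub>R A i) (\<lambda>x. ln (norm x) + g (1 - i) x) x = ln (norm x) + g i x + 2 * c) \<and>
      growth_exponent A lam (\<beta> / 2) / (2 * l * (1 - l) * \<beta>) = c" if \<beta>: "0 < \<beta>" for \<beta>
  proof -
    interpret F: flow_pair "a \<beta>" vp vm bu bw "lplus / (\<beta> * l * (1 - l))" "lminus / (\<beta> * l * (1 - l))"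
      unfolding a_def[abs_def] by (rule pair[OF \<beta> assms(9,10)])
    obtain c f where f: "proj_fun f" and eq: "\<And>x. x \<noteq> 0 \<Longrightarrow>
       (resolv (a \<beta> 0) (\<lambda>x. ln (norm x) + f x) x + resolv (a \<beta> 1) (\<lambda>x. ln (norm x) + f x) x) / 2 = ln (norm x) + f x + c"
      using F.lyapunov_potential by blast
    obtain g where g: "\<And>i. proj_fun (g i)" and geq: "\<And>i x. x \<noteq> 0 \<Longrightarrow>
       resolv (2 *\<^sub>R a \<beta> i) (\<lambda>x. ln (norm x) + g (1 - i) x) x = ln (norm x) + g i x + 2 * c"
      using F.alternating_potential[OF f eq] by blast
    have a2: "2 *\<^sub>R a \<beta> i = (1 / (\<beta> / 2 * lam i)) *\<^sub>R A i" for i by (simp add: a_def)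
    have "growth_exponent A lam (\<beta> / 2) = 2 * c / ((1 / (\<beta> / 2 * lam 0) + 1 / (\<beta> / 2 * lam 1)) / 2)"
    proof (rule growth_exponent_eq[where g = g, OF g])
      show "0 < \<beta> / 2 * lam i" for i using two_cases[of i] assms(3,4,9,10) \<beta> by auto
    qed (use geq in \<open>simp only: a2\<close>)
    \<comment> \<open>The mean holding time at speed \<open>\<beta> / 2\<close>. A gain of
      \<open>2 c\<close> per jump thus gives the exponent \<open>2 c \<beta> l (1 - l)\<close>,
      which explains the normalization in the claim.\<close>
    also have "(1 / (\<beta> / 2 * lam 0) + 1 / (\<beta> / 2 * lam 1)) / 2 = 1 / (\<beta> * l * (1 - l))"
      unfolding assms(9,10) using \<beta> assms(3,4) by (simp add: field_simps)
    finally have "growth_exponent A lam (\<beta> / 2) / (2 * l * (1 - l) * \<beta>) = c"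
      using \<beta> assms(3,4) by simp
    with f eq g geq show ?thesis unfolding a2 by blast
  qed
  show ?thesis
  proof (intro conjI allI impI)
    fix \<beta> :: real and M :: "'w measure" and V :: "nat \<Rightarrow> 'w \<Rightarrow> real^2^2"
    assume \<beta>: "0 < \<beta>" and V: "prob_space M \<and> prob_space.indep_vars M (\<lambda>_. borel) V {1..} \<and>
            (\<forall>k\<ge>1. has_half_sum_law M A lam \<beta> (V k))"
    then interpret prob_space M by blast
    interpret F: flow_pair "a \<beta>" vp vm bu bw "lplus / (\<beta> * l * (1 - l))" "lminus / (\<beta> * l * (1 - l))"
      unfolding a_def[abs_def] by (rule pair[OF \<beta> assms(9,10)])
    obtain c f where f: "proj_fun f" and eq: "\<And>x. x \<noteq> 0 \<Longrightarrow>
       (resolv (a \<beta> 0) (\<lambda>x. ln (norm x) + f x) x + resolv (a \<beta> 1) (\<lambda>x. ln (norm x) + f x) x) / 2 = ln (norm x) + f x + c"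
      and c: "growth_exponent A lam (\<beta> / 2) / (2 * l * (1 - l) * \<beta>) = c"
      using potential[OF \<beta>] by blast
    have "distr M borel (V k) = distr coin_exp borel (mixture_map (a \<beta>))" if "1 \<le> k" for k
    proof (rule distr_mixture)
      show "prob_space M" by (rule prob_space_axioms)
      show "V k \<in> borel_measurable M" using V that by (auto simp: indep_vars_def)
      show "measure (distr M borel (V k)) B =
          1 / 2 * measure (distr exp_law borel (\<lambda>s. mat_exp (s *\<^sub>R a \<beta> 0))) B +
          1 / 2 * measure (distr exp_law borel (\<lambda>s. mat_exp (s *\<^sub>R a \<beta> 1))) B" if "B \<in> sets borel" for B
        using V \<open>1 \<le> k\<close> that by (simp add: has_half_sum_law_def a_def)
    qed
    then show "AE \<omega> in M. (\<lambda>k. ln (onorm (\<lambda>x. left_prod (\<lambda>j. V j \<omega>) k *v x)) / real k)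
                 \<longlonglongrightarrow> growth_exponent A lam (\<beta> / 2) / (2 * l * (1 - l) * \<beta>)"
      unfolding c using F.norm_growth_discrete[OF f eq, where M = M and V = V] V by blast
  next
    obtain \<gamma>0 where \<gamma>0: "\<And>\<gamma> g \<kappa>. \<gamma>0 < \<gamma> \<Longrightarrow> (\<And>i. proj_fun (g i)) \<Longrightarrow>
      (\<And>i x. x \<noteq> 0 \<Longrightarrow> resolv ((1 / (\<gamma> * lam i)) *\<^sub>R A i) (\<lambda>x. ln (norm x) + g (1 - i) x) x = ln (norm x) + g i x + \<kappa>) \<Longrightarrow> 0 < \<kappa>"
      using S.growth_eventually_pos[OF assms(9,10)] by blast
    show "\<forall>\<^sub>F \<beta> in at_top. 0 < growth_exponent A lam (\<beta> / 2) / (2 * l * (1 - l) * \<beta>)"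
      \<comment> \<open>The switching speed is \<open>\<beta> / 2\<close>, hence twice the threshold
        \<open>\<gamma>0\<close>.\<close>
      using eventually_gt_at_top[of "max 0 (2 * \<gamma>0)"]
    proof eventually_elim
      case (elim \<beta>)
      then have \<beta>: "0 < \<beta>" "\<gamma>0 < \<beta> / 2" by auto
      obtain c g where g: "\<And>i. proj_fun (g i)" "\<And>i x. x \<noteq> 0 \<Longrightarrow>
        resolv ((1 / (\<beta> / 2 * lam i)) *\<^sub>R A i) (\<lambda>x. ln (norm x) + g (1 - i) x) x = ln (norm x) + g i x + 2 * c"
        and c: "growth_exponent A lam (\<beta> / 2) / (2 * l * (1 - l) * \<beta>) = c"
        using potential[OF \<beta>(1)] by blast
      have "0 < 2 * c" by (rule \<gamma>0[OF \<beta>(2) g])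
      then show ?case unfolding c by simp
    qed
  qed
qed

end
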